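(* Let $\lambda\in\mathbb{C}$ with $|\lambda|>1$, let $\varphi\in \mathrm{Diff}^{\infty}([0,\infty))$ satisfy $\varphi(x)>x$ for all $x>0$ and be tangent to the identity to infinite order at $0$, and let $(R,\mathcal{F},J)$ be the $5$-dimensional LC Reeb component $R=\tilde R/T^{\mathbb{Z}}$ with $T(z_1,z_2,x)=(\lambda z_1,\lambda z_2,\varphi(x))$ (i.e. $\tau=0$, $\lambda=\mu$), with boundary Hopf surface $H$. Then there is an exact sequence of groups $$0\to \mathcal{Z}_{\varphi,\lambda}\times\mathcal{Z}_{\varphi,\lambda}\to \mathrm{Aut}(R,H)\xrightarrow{P} Z_{\varphi}\to 1,$$ and $\mathrm{Aut}(R,H)\cong(\mathcal{Z}_{\varphi,\lambda}\times\mathcal{Z}_{\varphi,\lambda})\rtimes Z_\varphi$, where $\eta\in Z_\varphi$ acts on $(\beta_1,\beta_2)\in\mathcal{Z}_{\varphi,\lambda}\times\mathcal{Z}_{\varphi,\lambda}$ by $(\beta_1,\beta_2)\mapsto(\beta_1\circ\eta,\beta_2\circ\eta)$. Here $\mathcal{Z}_{\varphi,\lambda}$ is an infinite dimensional vector space (regarded as an additive group), and $(\beta_1,\beta_2)$ corresponds to the automorphism of $R$ induced by $(z_1,z_2,x)\mapsto(z_1+\beta_1(x),z_2+\beta_2(x),x)$.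
   Context: Setting. $\tilde R=(\mathbb{C}^2\times[0,\infty))\setminus\{(O,0)\}$ carries the foliation $\tilde{\mathcal F}$ with leaves $\mathbb{C}^2\times\{x\}$ ($x>0$) and $\tilde H=(\mathbb{C}^2\setminus\{O\})\times\{0\}$, with the standard complex structure on leaves. For $G(z_1,z_2)=(\lambda z_1+\tau z_2^p,\mu z_2)$ with $p$ a positive integer, $\lambda,\mu,\tau\in\mathbb{C}$, $|\lambda|\ge|\mu|>1$, $(\lambda-\mu^p)\tau=0$, put $T=G\times\varphi$. The quotient $R=\tilde R/T^{\mathbb{Z}}$ with the induced foliation $\mathcal F$ and leafwise complex structure $J$ is called an LC Reeb component; its boundary leaf $H=(\mathbb{C}^2\setminus\{O\})/G^{\mathbb{Z}}$ is a primary Hopf surface. A leafwise holomorphic smooth automorphism is a smooth diffeomorphism preserving the foliation and mapping leaves biholomorphically to leaves; $\mathrm{Aut}\,R$ is the group of these for $(R,\mathcal F,J)$, and $\mathrm{Aut}(R,H)$ is the subgroup of elements restricting to the identity on $H$ (the kernel of the restriction map $\mathrm{Aut}\,R\to\mathrm{Aut}\,H$). Each $f\in\mathrm{Aut}(R,H)$ has a unique lift to a leafwise holomorphic smooth automorphism of $\tilde R$ commuting with $T$ and equal to the identity on $\tilde H$; this lift has the form $(\xi_1(z_1,z_2,x),\xi_2(z_1,z_2,x),\eta(x))$, and $P(f)=\eta$. $Z_\varphi$ is the centralizer of $\varphi$ in $\mathrm{Diff}^\infty([0,\infty))$. For $\nu\in\mathbb{C}$, $|\nu|>1$, $\mathcal{Z}_{\varphi,\nu}=\{\beta\in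 C^\infty([0,\infty);\mathbb{C}):\beta(\varphi(x))=\nu\beta(x)\ \text{for all }x\}$ (equivalently, smooth solutions on $(0,\infty)$, all of which extend smoothly and flatly to $0$). Since $\beta\mapsto\beta\circ\eta$ is a right action, the semidirect product is formed with the multiplication $(\beta,\eta)(\beta',\eta')=(\beta'+\beta\circ\eta',\,\eta\circ\eta')$. *)

theory Defs
  imports "HOL-Analysis.Analysis" "HOL-Algebra.Coset" "HOL-Algebra.Bij" "HOL-Library.Function_Algebras"
begin

section \<open>Smooth maps\<close>

fun higher_differentiable_on ::
    "'a::euclidean_space set \<Rightarrow> ('a \<Rightarrow> 'b::euclidean_space) \<Rightarrow> nat \<Rightarrow> bool" where
  "higher_differentiable_on S f 0 \<longleftrightarrow> continuous_on S f"
| "higher_differentiable_on S f (Suc n) \<longleftrightarrow>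
     (\<forall>p\<in>S. f differentiable (at p)) \<and>
     (\<forall>v. higher_differentiable_on S (\<lambda>p. frechet_derivative f (at p) v) n)"

text \<open>On sets that are not open (such as \<open>{0..}\<close>, or subsets of a half-space that are open
  relative to it), smooth means: locally the restriction of a smooth map defined on an open set.\<close>

definition smooth_on :: "'a::euclidean_space set \<Rightarrow> ('a \<Rightarrow> 'b::euclidean_space) \<Rightarrow> bool" where
  "smooth_on S f \<longleftrightarrow>
     (\<forall>p\<in>S. \<exists>U g. open U \<and> p \<in> U \<and> (\<forall>n. higher_differentiable_on U g n) \<and>
        (\<forall>q\<in>S \<inter> U. f q = g q))"

text \<open>Holomorphic maps between open subsets of \<open>\<complex>\<^sup>2\<close>: the real derivative exists and is
  complex linear.\<close>

definition holomorphic2_on ::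
    "(complex \<times> complex) set \<Rightarrow> (complex \<times> complex \<Rightarrow> complex \<times> complex) \<Rightarrow> bool" where
  "holomorphic2_on W f \<longleftrightarrow>
     (\<forall>w\<in>W. \<exists>D. (f has_derivative D) (at w) \<and>
        (\<forall>c a b. D (c * a, c * b) = (c * fst (D (a, b)), c * snd (D (a, b)))))"


section \<open>Diffeomorphisms of the half-line\<close>

text \<open>Maps of a set \<open>S\<close> to itself are elements of \<^term>\<open>Bij S\<close>, hence \<open>undefined\<close> outside \<open>S\<close>;
  the product of \<^term>\<open>BijGroup S\<close> is composition, \<open>g \<otimes> f = g \<circ> f\<close> on \<open>S\<close>.\<close>

definition Diff_halfline :: "(real \<Rightarrow> real) monoid" where
  "Diff_halfline = (BijGroup {0..})\<lparr>carrier :=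
     {f \<in> Bij {0..}. smooth_on {0..} f \<and> smooth_on {0..} (inv_into {0..} f)}\<rparr>"

definition centralizer :: "(real \<Rightarrow> real) \<Rightarrow> (real \<Rightarrow> real) monoid" where
  "centralizer \<phi> = Diff_halfline\<lparr>carrier :=
     {\<eta> \<in> carrier Diff_halfline.
        \<phi> \<otimes>\<^bsub>Diff_halfline\<^esub> \<eta> = \<eta> \<otimes>\<^bsub>Diff_halfline\<^esub> \<phi>}\<rparr>"

definition halfline_deriv :: "(real \<Rightarrow> real) \<Rightarrow> real \<Rightarrow> real" where
  "halfline_deriv f x = vector_derivative f (at x within {0..})"

text \<open>All derivatives of \<open>\<phi> - id\<close> (one-sided at the end point) vanish at \<open>0\<close>.\<close>

definition infinitely_tangent_to_id :: "(real \<Rightarrow> real) \<Rightarrow> bool" where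
  "infinitely_tangent_to_id \<phi> \<longleftrightarrow> (\<forall>n. (halfline_deriv ^^ n) (\<lambda>x. \<phi> x - x) 0 = 0)"


section \<open>The space of equivariant functions\<close>

global_interpretation complex_fun: vector_space "\<lambda>(c::complex) (\<beta>::real \<Rightarrow> complex) x. c * \<beta> x"
  by unfold_locales (auto simp: fun_eq_iff algebra_simps)

text \<open>A function \<open>[0,\<infinity>) \<rightarrow> \<complex>\<close> is represented by its extension by \<open>0\<close>, so that these functions
  form a subspace of \<open>real \<Rightarrow> complex\<close> with the pointwise operations.\<close>

definition equivariant_functions :: "(real \<Rightarrow> real) \<Rightarrow> complex \<Rightarrow> (real \<Rightarrow> complex) set" where
  "equivariant_functions \<phi> \<nu> =
     {\<beta>. smooth_on {0..} \<beta> \<and> (\<forall>x\<ge>0. \<beta> (\<phi> x) = \<nu> * \<beta> x) \<and> (\<forall>x<0. \<beta> x = 0)}"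

definition equivariant_group :: "(real \<Rightarrow> real) \<Rightarrow> complex \<Rightarrow> (real \<Rightarrow> complex) monoid" where
  "equivariant_group \<phi> \<nu> = \<lparr>carrier = equivariant_functions \<phi> \<nu>, mult = (+), one = 0\<rparr>"

definition pullback :: "(real \<Rightarrow> real) \<Rightarrow> (real \<Rightarrow> complex) \<Rightarrow> real \<Rightarrow> complex" where
  "pullback \<eta> \<beta> = (\<lambda>x. if 0 \<le> x then \<beta> (\<eta> x) else 0)"

definition pullback_pair ::
    "(real \<Rightarrow> real) \<Rightarrow> (real \<Rightarrow> complex) \<times> (real \<Rightarrow> complex) \<Rightarrow> (real \<Rightarrow> complex) \<times> (real \<Rightarrow> complex)"
  where "pullback_pair \<eta> = map_prod (pullback \<eta>) (pullback \<eta>)"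

text \<open>Semidirect product of \<open>N\<close> and \<open>Q\<close> for a \<^emph>\<open>right\<close> action \<open>act\<close> of \<open>Q\<close> on \<open>N\<close>;
  in additive notation \<open>(b, e) (b', e') = (b' + act e' b, e e')\<close>.\<close>

definition semidirect_product ::
    "('n, 'x) monoid_scheme \<Rightarrow> ('q, 'y) monoid_scheme \<Rightarrow> ('q \<Rightarrow> 'n \<Rightarrow> 'n) \<Rightarrow> ('n \<times> 'q) monoid" where
  "semidirect_product N Q act =
     \<lparr>carrier = carrier N \<times> carrier Q,
      mult = (\<lambda>(b, e) (b', e'). (b' \<otimes>\<^bsub>N\<^esub> act e' b, e \<otimes>\<^bsub>Q\<^esub> e')),
      one = (\<one>\<^bsub>N\<^esub>, \<one>\<^bsub>Q\<^esub>)\<rparr>"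


section \<open>Foliated spaces covered by the punctured half-space\<close>

type_synonym pt = "(complex \<times> complex) \<times> real"

definition Rtilde :: "pt set" where
  "Rtilde = UNIV \<times> {0..} - {((0, 0), 0)}"

definition Htilde :: "pt set" where
  "Htilde = (UNIV - {(0, 0)}) \<times> {0}"

text \<open>Let \<open>q\<close> be the projection of \<^term>\<open>Rtilde\<close> to a quotient \<open>q ` Rtilde\<close> by a properly
  discontinuous free group of leafwise holomorphic smooth automorphisms. The quotient carries the
  foliation by the images of the leaves of \<^term>\<open>Rtilde\<close>; the inverses of the restrictions
  of \<open>q\<close> to relatively open sets on which it is injective form a smooth atlas, and the inverses
  of its restrictions to injectively mapped open subsets of leaves form complex atlases of the
  leaves. The definitions below are applied to \<open>q = id\<close>, giving \<^term>\<open>Rtilde\<close> itself, and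
  to the projection onto the Reeb component.\<close>

definition leaves :: "(pt \<Rightarrow> 'q) \<Rightarrow> 'q set set" where
  "leaves q = {q ` (UNIV \<times> {x}) |x. 0 < x} \<union> {q ` Htilde}"

definition is_chart :: "(pt \<Rightarrow> 'q) \<Rightarrow> pt set \<Rightarrow> bool" where
  "is_chart q U \<longleftrightarrow> openin (top_of_set Rtilde) U \<and> inj_on q U"

definition is_leaf_chart ::
    "(pt \<Rightarrow> 'q) \<Rightarrow> 'q set \<Rightarrow> (complex \<times> complex) set \<Rightarrow> real \<Rightarrow> bool" where
  "is_leaf_chart q L W x \<longleftrightarrow>
     open W \<and> W \<times> {x} \<subseteq> Rtilde \<and> inj_on q (W \<times> {x}) \<and> q ` (W \<times> {x}) \<subseteq> L"

definition smooth_map :: "(pt \<Rightarrow> 'q) \<Rightarrow> ('q \<Rightarrow> 'q) \<Rightarrow> bool" where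
  "smooth_map q f \<longleftrightarrow>
     (\<forall>p\<in>Rtilde. \<exists>U V. is_chart q U \<and> is_chart q V \<and> p \<in> U \<and> f ` q ` U \<subseteq> q ` V \<and>
        smooth_on U (\<lambda>u. inv_into V q (f (q u))))"

definition leaf_holomorphic :: "(pt \<Rightarrow> 'q) \<Rightarrow> 'q set \<Rightarrow> 'q set \<Rightarrow> ('q \<Rightarrow> 'q) \<Rightarrow> bool" where
  "leaf_holomorphic q L L' f \<longleftrightarrow>
     (\<forall>z x. (z, x) \<in> Rtilde \<and> q (z, x) \<in> L \<longrightarrow>
        (\<exists>W W' x'. is_leaf_chart q L W x \<and> is_leaf_chart q L' W' x' \<and> z \<in> W \<and>
           f ` q ` (W \<times> {x}) \<subseteq> q ` (W' \<times> {x'}) \<and>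
           holomorphic2_on W (\<lambda>w. fst (inv_into (W' \<times> {x'}) q (f (q (w, x)))))))"

definition leaf_biholomorphic :: "(pt \<Rightarrow> 'q) \<Rightarrow> 'q set \<Rightarrow> 'q set \<Rightarrow> ('q \<Rightarrow> 'q) \<Rightarrow> bool" where
  "leaf_biholomorphic q L L' f \<longleftrightarrow>
     bij_betw f L L' \<and> leaf_holomorphic q L L' f \<and> leaf_holomorphic q L' L (inv_into L f)"

definition Aut :: "(pt \<Rightarrow> 'q) \<Rightarrow> ('q \<Rightarrow> 'q) monoid" where
  "Aut q = (BijGroup (q ` Rtilde))\<lparr>carrier :=
     {f \<in> Bij (q ` Rtilde).
        smooth_map q f \<and> smooth_map q (inv_into (q ` Rtilde) f) \<and>
        (\<forall>L\<in>leaves q. \<exists>L'\<in>leaves q. leaf_biholomorphic q L L' f)}\<rparr>"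


section \<open>The Reeb component\<close>

definition T_map :: "complex \<Rightarrow> (real \<Rightarrow> real) \<Rightarrow> pt \<Rightarrow> pt" where
  "T_map lam \<phi> = restrict (\<lambda>((z1, z2), x). ((lam * z1, lam * z2), \<phi> x)) Rtilde"

definition proj :: "complex \<Rightarrow> (real \<Rightarrow> real) \<Rightarrow> pt \<Rightarrow> pt set" where
  "proj lam \<phi> p = {(T_map lam \<phi> [^]\<^bsub>BijGroup Rtilde\<^esub> n) p |n::int. True}"

definition Reeb :: "complex \<Rightarrow> (real \<Rightarrow> real) \<Rightarrow> pt set set" where
  "Reeb lam \<phi> = proj lam \<phi> ` Rtilde"

definition Hopf :: "complex \<Rightarrow> (real \<Rightarrow> real) \<Rightarrow> pt set set" where
  "Hopf lam \<phi> = proj lam \<phi> ` Htilde"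

definition Aut_rel :: "complex \<Rightarrow> (real \<Rightarrow> real) \<Rightarrow> (pt set \<Rightarrow> pt set) monoid" where
  "Aut_rel lam \<phi> = (Aut (proj lam \<phi>))\<lparr>carrier :=
     {f \<in> carrier (Aut (proj lam \<phi>)). \<forall>h\<in>Hopf lam \<phi>. f h = h}\<rparr>"

definition is_lift ::
    "complex \<Rightarrow> (real \<Rightarrow> real) \<Rightarrow> (pt set \<Rightarrow> pt set) \<Rightarrow> (pt \<Rightarrow> pt) \<Rightarrow> bool" where
  "is_lift lam \<phi> f F \<longleftrightarrow>
     F \<in> carrier (Aut id) \<and>
     (\<forall>p\<in>Rtilde. proj lam \<phi> (F p) = f (proj lam \<phi> p)) \<and>
     (\<forall>p\<in>Rtilde. F (T_map lam \<phi> p) = T_map lam \<phi> (F p)) \<and>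
     (\<forall>p\<in>Htilde. F p = p)"

text \<open>The lift of \<open>f\<close> has the form \<open>(z, x) \<mapsto> (\<xi> (z, x), \<eta> x)\<close>; this is the map \<open>f \<mapsto> \<eta>\<close>.\<close>

definition P_map :: "complex \<Rightarrow> (real \<Rightarrow> real) \<Rightarrow> (pt set \<Rightarrow> pt set) \<Rightarrow> real \<Rightarrow> real" where
  "P_map lam \<phi> f =
     (THE \<eta>. \<eta> \<in> extensional {0..} \<and>
        (\<exists>F. is_lift lam \<phi> f F \<and> (\<forall>z x. (z, x) \<in> Rtilde \<longrightarrow> snd (F (z, x)) = \<eta> x)))"

text \<open>If \<open>F\<close> commutes with \<open>T\<close>, the image set below is a singleton.\<close>

definition induced ::
    "complex \<Rightarrow> (real \<Rightarrow> real) \<Rightarrow> (pt \<Rightarrow> pt) \<Rightarrow> pt set \<Rightarrow> pt set" where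
  "induced lam \<phi> F = (\<lambda>r\<in>Reeb lam \<phi>. the_elem ((\<lambda>p. proj lam \<phi> (F p)) ` r))"

definition translation_aut ::
    "complex \<Rightarrow> (real \<Rightarrow> real) \<Rightarrow> (real \<Rightarrow> complex) \<times> (real \<Rightarrow> complex) \<Rightarrow> pt set \<Rightarrow> pt set" where
  "translation_aut lam \<phi> = (\<lambda>(\<beta>1, \<beta>2).
     induced lam \<phi> (\<lambda>((z1, z2), x). ((z1 + \<beta>1 x, z2 + \<beta>2 x), x)))"

end

theory Submission
  imports Defs "HOL-Complex_Analysis.Complex_Analysis"
begin

text \<open>
  Let \<open>f\<close> be an automorphism of the Reeb component that is the identity on the Hopf surface. The
  projection \<open>q\<close> from \<^term>\<open>Rtilde\<close> is a covering with deck group \<open>T\<^sup>\<int>\<close>, and \<^term>\<open>Rtilde\<close> is starlike,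
  so that \<open>f\<close> lifts. Exactly one lift \<open>F\<close> is the identity on \<^term>\<open>Htilde\<close>; by uniqueness of lifts it
  commutes with \<open>T\<close>, and it inherits smoothness and leafwise holomorphy from \<open>f\<close>
  (\<open>cont_lift_exists\<close>, \<open>cont_lift_commutes\<close>, \<open>cont_lift_smooth\<close>, \<open>cont_lift_leafwise\<close>).

  The lift is rigid. Write \<open>F (z, x) = (\<xi> (z, x), \<eta> x)\<close>. The displacement \<open>D (z, x) = \<xi> (z, x) - z\<close>
  vanishes for \<open>x = 0\<close> and satisfies \<open>D (\<lambda> z, \<phi> x) = \<lambda> D (z, x)\<close>. On a complex line \<open>t \<mapsto> t v\<close> it is an
  entire function of \<open>t\<close>, small on the unit circle when \<open>x\<close> is small. Its derivative in \<open>t\<close> is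
  invariant under \<open>(t, x) \<mapsto> (\<lambda> t, \<phi> x)\<close>. Moving \<open>(t, x)\<close> backwards along its orbit decreases both \<open>t\<close>
  and \<open>x\<close> to \<open>0\<close>, where Cauchy's estimate makes the derivative arbitrarily small; so it vanishes, and
  \<open>D (z, x) = \<beta> x\<close> does not depend on \<open>z\<close> (\<open>equivariant_entire_constant\<close>, \<open>cont_lift_affine\<close>). Thus
  \<open>F (z, x) = (z + \<beta> x, \<eta> x)\<close> with \<open>\<beta> \<circ> \<phi> = \<lambda> \<beta>\<close> and \<open>\<eta> \<circ> \<phi> = \<phi> \<circ> \<eta>\<close>. The lift is smooth at the boundary
  points \<open>(z, 0)\<close> with \<open>z \<noteq> 0\<close>, whence \<open>\<beta>\<close> and \<open>\<eta>\<close> are smooth up to \<open>0\<close>, and the lift of the inverse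
  automorphism shows that \<open>\<eta>\<close> is a diffeomorphism (\<open>cont_lift_structure\<close>, \<open>induced_aut_surj\<close>).

  Conversely, every such pair \<open>(\<beta>, \<eta>)\<close> has \<open>\<beta> 0 = 0\<close> and \<open>\<eta> 0 = 0\<close>, and the affine map that it defines
  commutes with \<open>T\<close>, is the identity on \<^term>\<open>Htilde\<close> and descends to an automorphism
  (\<open>affine_in_Aut\<close>). The composition of affine maps is the multiplication of the semidirect product
  (\<open>act_mult\<close>), so the automorphism group is this product; \<open>P\<close> is the projection to \<open>\<eta>\<close>, with the
  translations \<open>(z, x) \<mapsto> (z + \<beta> x, x)\<close> as its kernel.

  The space of solutions \<open>\<beta>\<close> is infinite dimensional because a bump function supported inside a
  fundamental domain of \<open>\<phi>\<close> on \<open>(0, \<infinity>)\<close> extends to a solution on \<open>(0, \<infinity>)\<close>, and every solution there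
  is flat at \<open>0\<close>. For the flatness, differentiate the equation \<open>k\<close> times: \<open>\<lambda> \<beta>\<^sup>(\<^sup>k\<^sup>) (x)\<close> becomes
  \<open>\<phi>' (x)\<^sup>k \<beta>\<^sup>(\<^sup>k\<^sup>) (\<phi> x)\<close> plus terms with lower derivatives. As \<open>\<phi>' (0) = 1\<close> and \<open>\<bar>\<lambda>\<bar> > 1\<close>, this is a
  contraction near \<open>0\<close>, so that all derivatives tend to \<open>0\<close> by induction on \<open>k\<close>
  (\<open>differentiated_equation\<close>, \<open>derivatives_tendsto_0\<close>, \<open>equivariant_functions_infinite_dim\<close>).
\<close>

section \<open>Calculus of smooth maps\<close>

lemma hdiff_on_subset:
  "higher_differentiable_on S f n \<Longrightarrow> T \<subseteq> S \<Longrightarrow> higher_differentiable_on T f n"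
  by (induction n arbitrary: f) (auto intro: continuous_on_subset)

lemma hdiff_on_cong:
  assumes "open S" "\<And>x. x \<in> S \<Longrightarrow> f x = g x"
  shows "higher_differentiable_on S f n \<longleftrightarrow> higher_differentiable_on S g n"
proof -
  have *: "higher_differentiable_on S f n \<Longrightarrow> (\<And>x. x \<in> S \<Longrightarrow> f x = g x) \<Longrightarrow>
     higher_differentiable_on S g n" for f g :: "'a \<Rightarrow> 'b"
  proof (induction n arbitrary: f g)
    case 0
    then show ?case by (simp cong: continuous_on_cong_simp)
  next
    case (Suc n)
    have d: "(g has_derivative frechet_derivative f (at p)) (at p)" if "p \<in> S" for p
    proof (rule has_derivative_transform_within_open[where f = f])
      show "(f has_derivative frechet_derivative f (at p)) (at p)"
        using Suc.prems(1) that by (simp add: frechet_derivative_works)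
    qed (use that assms(1) Suc.prems(2) in auto)
    have e: "frechet_derivative g (at p) = frechet_derivative f (at p)" if "p \<in> S" for p
      using frechet_derivative_at[OF d[OF that]] by simp
    show ?case
      unfolding higher_differentiable_on.simps
    proof (intro conjI ballI allI)
      show "g differentiable at p" if "p \<in> S" for p
        using d[OF that] by (auto simp: differentiable_def)
      show "higher_differentiable_on S (\<lambda>p. frechet_derivative g (at p) v) n" for v
        by (rule Suc.IH[of "\<lambda>p. frechet_derivative f (at p) v"]) (use Suc.prems(1) e in auto)
    qed
  qed
  show ?thesis using *[of f g] *[of g f] assms(2) by auto
qed

lemma hdiff_on_local:
  assumes "\<And>p. p \<in> S \<Longrightarrow> \<exists>U. open U \<and> p \<in> U \<and> higher_differentiable_on U f n"
  shows "higher_differentiable_on S f n"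
  using assms
proof (induction n arbitrary: f)
  case 0
  have "isCont f p" if "p \<in> S" for p
    using 0[OF that] by (auto simp: continuous_on_eq_continuous_at)
  then show ?case
    by (simp add: continuous_at_imp_continuous_on)
next
  case (Suc n)
  show ?case
    unfolding higher_differentiable_on.simps
  proof (intro conjI ballI allI)
    fix p assume "p \<in> S"
    from Suc.prems[OF this] show "f differentiable at p"
      by auto
  next
    fix v
    show "higher_differentiable_on S (\<lambda>p. frechet_derivative f (at p) v) n"
    proof (rule Suc.IH)
      fix p assume "p \<in> S"
      from Suc.prems[OF this]
      show "\<exists>U. open U \<and> p \<in> U \<and>
          higher_differentiable_on U (\<lambda>p. frechet_derivative f (at p) v) n"
        unfolding higher_differentiable_on.simps by metis
    qed
  qed
qed

lemma hdiff_on_Suc_imp: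
  "higher_differentiable_on S f (Suc n) \<Longrightarrow> higher_differentiable_on S f n"
proof (induction n arbitrary: f)
  case 0
  then show ?case
    by (auto intro!: continuous_at_imp_continuous_on differentiable_imp_continuous_within)
next
  case (Suc n)
  then show ?case
    unfolding higher_differentiable_on.simps(2)[of S f] by blast
qed

lemma hdiff_on_const: "higher_differentiable_on S (\<lambda>p. c) n"
  by (induction n arbitrary: c) auto

lemma hdiff_on_SucI:
  assumes "open S" and d: "\<And>p. p \<in> S \<Longrightarrow> (f has_derivative D p) (at p)"
    and D: "\<And>v. higher_differentiable_on S (\<lambda>p. D p v) n"
  shows "higher_differentiable_on S f (Suc n)"
proof -
  have "frechet_derivative f (at p) v = D p v" if "p \<in> S" for p v
    using frechet_derivative_at[OF d[OF that]] by metis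
  then show ?thesis
    using d D by (auto simp: differentiable_def cong: hdiff_on_cong[OF assms(1)])
qed

lemma hdiff_on_SucD:
  assumes "higher_differentiable_on S f (Suc n)"
  shows "p \<in> S \<Longrightarrow> (f has_derivative frechet_derivative f (at p)) (at p)"
    and "higher_differentiable_on S (\<lambda>p. frechet_derivative f (at p) v) n"
  using assms by (simp_all add: frechet_derivative_works)

lemma hdiff_on_bounded_linear_compose:
  assumes "bounded_linear L" "open S" "higher_differentiable_on S f n"
  shows "higher_differentiable_on S (\<lambda>p. L (f p)) n"
  using assms(3)
proof (induction n arbitrary: f)
  case 0
  then show ?case by (simp add: bounded_linear.continuous_on[OF assms(1)])
next
  case (Suc n)
  note f = hdiff_on_SucD[OF Suc.prems]
  show ?case
    by (rule hdiff_on_SucI[OF assms(2) bounded_linear.has_derivative[OF assms(1) f(1)]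
          Suc.IH[OF f(2)]])
qed

lemma hdiff_on_bounded_linear:
  assumes "bounded_linear L"
  shows "higher_differentiable_on S L n"
proof (cases n)
  case 0
  then show ?thesis by (simp add: linear_continuous_on assms)
next
  case (Suc m)
  have "frechet_derivative L (at p) = L" for p
    using frechet_derivative_at[OF bounded_linear_imp_has_derivative[OF assms]] by metis
  then show ?thesis
    using Suc bounded_linear_imp_differentiable[OF assms]
    by (simp add: hdiff_on_const)
qed

lemma hdiff_on_add:
  assumes "open S" "higher_differentiable_on S f n" "higher_differentiable_on S g n"
  shows "higher_differentiable_on S (\<lambda>p. f p + g p) n"
  using assms(2,3)
proof (induction n arbitrary: f g)
  case 0
  then show ?case by (simp add: continuous_on_add)
next
  case (Suc n)
  note f = hdiff_on_SucD[OF Suc.prems(1)]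
    and g = hdiff_on_SucD[OF Suc.prems(2)]
  show ?case
    by (rule hdiff_on_SucI[OF assms(1) has_derivative_add[OF f(1) g(1)] Suc.IH[OF f(2) g(2)]])
qed

lemma hdiff_on_sum:
  assumes "open S" "\<And>i. i \<in> I \<Longrightarrow> higher_differentiable_on S (f i) n"
  shows "higher_differentiable_on S (\<lambda>p. \<Sum>i\<in>I. f i p) n"
  using assms(2)
  by (induction I rule: infinite_finite_induct)
    (auto intro!: hdiff_on_const hdiff_on_add[OF assms(1)])

lemma hdiff_on_scaleR:
  fixes a :: "'a::euclidean_space \<Rightarrow> real" and b :: "'a \<Rightarrow> 'b::euclidean_space"
  assumes "open S" "higher_differentiable_on S a n" "higher_differentiable_on S b n"
  shows "higher_differentiable_on S (\<lambda>p. a p *\<^sub>R b p) n"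
  using assms(2,3)
proof (induction n arbitrary: a b)
  case 0
  then show ?case by (simp add: continuous_on_scaleR)
next
  case (Suc n)
  note a = hdiff_on_SucD[OF Suc.prems(1)]
    and b = hdiff_on_SucD[OF Suc.prems(2)]
  show ?case
    by (rule hdiff_on_SucI[OF assms(1) has_derivative_scaleR[OF a(1) b(1)]
          hdiff_on_add[OF assms(1)
            Suc.IH[OF hdiff_on_Suc_imp[OF Suc.prems(1)] b(2)]
            Suc.IH[OF a(2) hdiff_on_Suc_imp[OF Suc.prems(2)]]]])
qed

text \<open>The directional derivatives of \<open>g \<circ> f\<close> are sums of products of the coordinates of directional
  derivatives of \<open>f\<close> with compositions \<open>D\<^sub>i g \<circ> f\<close>, so the order of differentiability can be
  lowered one step at a time.\<close>

lemma hdiff_on_compose: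
  fixes f :: "'a::euclidean_space \<Rightarrow> 'b::euclidean_space" and g :: "'b \<Rightarrow> 'c::euclidean_space"
  assumes "open S" "open T" "f ` S \<subseteq> T"
    and "higher_differentiable_on S f n" "higher_differentiable_on T g n"
  shows "higher_differentiable_on S (\<lambda>p. g (f p)) n"
  using assms(4,5)
proof (induction n arbitrary: g)
  case 0
  then show ?case
    using assms(3) by (auto intro: continuous_on_compose2)
next
  case (Suc n)
  let ?D = "\<lambda>v p. \<Sum>i\<in>Basis. (frechet_derivative f (at p) v \<bullet> i) *\<^sub>R frechet_derivative g (at (f p)) i"
  have d: "((\<lambda>p. g (f p)) has_derivative (\<lambda>v. ?D v p)) (at p)"
    if "p \<in> S" for p
  proof -
    have f: "(f has_derivative frechet_derivative f (at p)) (at p)"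
      using Suc.prems that by (simp add: frechet_derivative_works)
    have g: "(g has_derivative frechet_derivative g (at (f p))) (at (f p))"
      using Suc.prems that assms(3) by (simp add: frechet_derivative_works image_subset_iff)
    have "frechet_derivative g (at (f p)) (frechet_derivative f (at p) v) = ?D v p" for v
    proof -
      have "frechet_derivative g (at (f p)) (frechet_derivative f (at p) v) =
        frechet_derivative g (at (f p)) (\<Sum>i\<in>Basis. (frechet_derivative f (at p) v \<bullet> i) *\<^sub>R i)"
        by (simp add: euclidean_representation)
      also have "\<dots> = ?D v p"
        using has_derivative_linear[OF g] by (simp add: linear_sum linear_cmul)
      finally show ?thesis .
    qed
    then show ?thesis
      using has_derivative_compose[OF f g] by simp
  qed
  have f: "higher_differentiable_on S f n"
    using Suc.prems(1) by (rule hdiff_on_Suc_imp)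
  have "higher_differentiable_on S (?D v) n" for v
  proof (intro hdiff_on_sum hdiff_on_scaleR assms(1)
          hdiff_on_bounded_linear_compose[OF bounded_linear_inner_left])
    show "higher_differentiable_on S (\<lambda>p. frechet_derivative f (at p) v) n"
      using Suc.prems(1) by simp
    show "higher_differentiable_on S (\<lambda>p. frechet_derivative g (at (f p)) i) n" for i
      using Suc.IH[OF f, of "\<lambda>y. frechet_derivative g (at y) i"] Suc.prems(2) by simp
  qed
  with d show ?case
    by (rule hdiff_on_SucI[OF assms(1)])
qed

lemma hdiff_on_Pair:
  fixes f :: "'a::euclidean_space \<Rightarrow> 'b::euclidean_space" and g :: "'a \<Rightarrow> 'c::euclidean_space"
  assumes "open S" "higher_differentiable_on S f n" "higher_differentiable_on S g n"
  shows "higher_differentiable_on S (\<lambda>p. (f p, g p)) n"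
proof -
  have l: "bounded_linear (\<lambda>x::'b. (x, 0::'c))" "bounded_linear (\<lambda>x::'c. (0::'b, x))"
    by (intro bounded_linear_Pair bounded_linear_ident bounded_linear_zero)+
  have "higher_differentiable_on S (\<lambda>p. (f p, 0) + (0, g p)) n"
    using hdiff_on_bounded_linear_compose[OF l(1) assms(1,2)]
      hdiff_on_bounded_linear_compose[OF l(2) assms(1,3)]
    by (rule hdiff_on_add[OF assms(1)])
  then show ?thesis by simp
qed

lemma smooth_onI:
  assumes "\<And>p. p \<in> S \<Longrightarrow> \<exists>U g. open U \<and> p \<in> U \<and> (\<forall>n. higher_differentiable_on U g n) \<and>
      (\<forall>q\<in>S \<inter> U. f q = g q)"
  shows "smooth_on S f"
  using assms by (simp add: smooth_on_def)

lemma smooth_onE: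
  assumes "smooth_on S f" "p \<in> S"
  obtains U g where "open U" "p \<in> U" "\<And>n. higher_differentiable_on U g n"
    "\<And>q. q \<in> S \<Longrightarrow> q \<in> U \<Longrightarrow> f q = g q"
  using bspec[OF assms(1)[unfolded smooth_on_def] assms(2)] by auto

lemma smooth_on_subset: 
  assumes "smooth_on S f" "T \<subseteq> S"
  shows "smooth_on T f"
proof (rule smooth_onI)
  fix p assume "p \<in> T"
  then obtain U h where "open U" "p \<in> U" "\<And>n. higher_differentiable_on U h n"
      "\<And>q. q \<in> S \<Longrightarrow> q \<in> U \<Longrightarrow> f q = h q"
    using smooth_onE[OF assms(1), of p] assms(2) by (metis subsetD)
  then show "\<exists>U h. open U \<and> p \<in> U \<and> (\<forall>n. higher_differentiable_on U h n) \<and>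
      (\<forall>q\<in>T \<inter> U. f q = h q)"
    using \<open>T \<subseteq> S\<close> by (intro exI[of _ U] exI[of _ h]) auto
qed

lemma smooth_on_cong:
  assumes "smooth_on S f" "\<And>x. x \<in> S \<Longrightarrow> f x = g x"
  shows "smooth_on S g"
proof (rule smooth_onI)
  fix p assume "p \<in> S"
  then obtain U h where "open U" "p \<in> U" "\<And>n. higher_differentiable_on U h n"
      "\<And>q. q \<in> S \<Longrightarrow> q \<in> U \<Longrightarrow> f q = h q"
    using smooth_onE[OF assms(1)] by metis
  then show "\<exists>U h. open U \<and> p \<in> U \<and> (\<forall>n. higher_differentiable_on U h n) \<and>
      (\<forall>q\<in>S \<inter> U. g q = h q)"
    using assms(2) by (intro exI[of _ U] exI[of _ h]) auto
qed

text \<open>Derivatives at a point of an open set only depend on the values nearby, so that a local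
  extension can be replaced by the map itself.\<close>

lemma smooth_on_open_iff:
  assumes "open S"
  shows "smooth_on S f \<longleftrightarrow> (\<forall>n. higher_differentiable_on S f n)"
proof
  assume f: "smooth_on S f"
  show "\<forall>n. higher_differentiable_on S f n"
  proof (intro allI hdiff_on_local)
    fix n p assume "p \<in> S"
    then obtain U g where U: "open U" "p \<in> U" "\<And>n. higher_differentiable_on U g n"
        "\<And>q. q \<in> S \<Longrightarrow> q \<in> U \<Longrightarrow> f q = g q"
      using smooth_onE[OF f] by metis
    have "higher_differentiable_on (S \<inter> U) g n"
      using U(3) hdiff_on_subset by blast
    then have "higher_differentiable_on (S \<inter> U) f n"
      using U(4) hdiff_on_cong[of "S \<inter> U" f g] assms U(1) by auto
    then show "\<exists>U. open U \<and> p \<in> U \<and> higher_differentiable_on U f n"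
      using U assms \<open>p \<in> S\<close> by (intro exI[of _ "S \<inter> U"]) auto
  qed
next
  assume "\<forall>n. higher_differentiable_on S f n"
  then show "smooth_on S f"
    using assms by (intro smooth_onI exI[of _ S] exI[of _ f]) auto
qed

lemma smooth_on_local:
  assumes "\<And>p. p \<in> S \<Longrightarrow> \<exists>V. open V \<and> p \<in> V \<and> smooth_on (S \<inter> V) f"
  shows "smooth_on S f"
proof (rule smooth_onI)
  fix p assume p: "p \<in> S"
  then obtain V where V: "open V" "p \<in> V" "smooth_on (S \<inter> V) f"
    using assms by auto
  from V(3) p V(2) obtain U g where U: "open U" "p \<in> U" "\<And>n. higher_differentiable_on U g n"
      "\<And>q. q \<in> S \<inter> V \<Longrightarrow> q \<in> U \<Longrightarrow> f q = g q"
    using smooth_onE[OF V(3), of p] by (metis IntI)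
  have "higher_differentiable_on (U \<inter> V) g n" for n
    using hdiff_on_subset[OF U(3)] by simp
  then show "\<exists>U g. open U \<and> p \<in> U \<and> (\<forall>n. higher_differentiable_on U g n) \<and> (\<forall>q\<in>S \<inter> U. f q = g q)"
    using U(1,2,4) V(1,2) by (intro exI[of _ "U \<inter> V"] exI[of _ g]) auto
qed

lemma smooth_on_imp_continuous_on:
  assumes "smooth_on S f"
  shows "continuous_on S f"
  unfolding continuous_on_eq_continuous_within
proof
  fix p assume p: "p \<in> S"
  then obtain U g where U: "open U" "p \<in> U" "\<And>n. higher_differentiable_on U g n"
      "\<And>q. q \<in> S \<Longrightarrow> q \<in> U \<Longrightarrow> f q = g q"
    using smooth_onE[OF assms] by metis
  have "continuous (at p within S) g"
    using U(1,2) U(3)[of 0] by (auto simp: continuous_on_eq_continuous_at intro: continuous_at_imp_continuous_at_within)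
  then show "continuous (at p within S) f"
    by (rule continuous_transform_within_openin[where S = "S \<inter> U"])
      (use U p in \<open>auto intro: openin_open_Int\<close>)
qed

lemma smooth_on_compose:
  fixes f :: "'a::euclidean_space \<Rightarrow> 'b::euclidean_space" and g :: "'b \<Rightarrow> 'c::euclidean_space"
  assumes f: "smooth_on S f" and g: "smooth_on T g" and "f ` S \<subseteq> T"
  shows "smooth_on S (\<lambda>p. g (f p))"
proof (rule smooth_onI)
  fix p assume p: "p \<in> S"
  obtain U f' where U: "open U" "p \<in> U" "\<And>n. higher_differentiable_on U f' n"
      "\<And>q. q \<in> S \<Longrightarrow> q \<in> U \<Longrightarrow> f q = f' q"
    using smooth_onE[OF f p] by metis
  have "f p \<in> T" using p assms(3) by auto
  then obtain V g' where V: "open V" "f p \<in> V" "\<And>n. higher_differentiable_on V g' n"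
      "\<And>q. q \<in> T \<Longrightarrow> q \<in> V \<Longrightarrow> g q = g' q"
    using smooth_onE[OF g] by metis
  define W where "W = f' -` V \<inter> U"
  have "higher_differentiable_on U f' 0" by (rule U)
  then have W: "open W"
    unfolding W_def using U(1) V(1) continuous_on_open_vimage by auto
  have "higher_differentiable_on W (\<lambda>p. g' (f' p)) n" for n
  proof (rule hdiff_on_compose[OF W V(1)])
    show "f' ` W \<subseteq> V" by (auto simp: W_def)
    show "higher_differentiable_on W f' n"
      using U(3) hdiff_on_subset[of U f' n W] by (auto simp: W_def)
  qed (use V in auto)
  moreover have "p \<in> W" using U V p by (auto simp: W_def)
  moreover have "\<forall>q\<in>S \<inter> W. g (f q) = g' (f' q)"
    using U V assms(3) by (auto simp: W_def image_subset_iff)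
  ultimately show "\<exists>U h. open U \<and> p \<in> U \<and> (\<forall>n. higher_differentiable_on U h n) \<and>
        (\<forall>q\<in>S \<inter> U. g (f q) = h q)"
    using W by (intro exI[of _ W] exI[of _ "\<lambda>p. g' (f' p)"]) simp
qed

lemma smooth_on_Pair:
  assumes "smooth_on S f" "smooth_on S g"
  shows "smooth_on S (\<lambda>p. (f p, g p))"
proof (rule smooth_onI)
  fix p assume p: "p \<in> S"
  obtain U f' where U: "open U" "p \<in> U" "\<And>n. higher_differentiable_on U f' n"
      "\<And>q. q \<in> S \<Longrightarrow> q \<in> U \<Longrightarrow> f q = f' q"
    using smooth_onE[OF assms(1) p] by metis
  obtain V g' where V: "open V" "p \<in> V" "\<And>n. higher_differentiable_on V g' n"
      "\<And>q. q \<in> S \<Longrightarrow> q \<in> V \<Longrightarrow> g q = g' q"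
    using smooth_onE[OF assms(2) p] by metis
  have "higher_differentiable_on (U \<inter> V) (\<lambda>p. (f' p, g' p)) n" for n
    using U V hdiff_on_subset[of U f' n "U \<inter> V"]
      hdiff_on_subset[of V g' n "U \<inter> V"]
    by (intro hdiff_on_Pair) auto
  then show "\<exists>U h. open U \<and> p \<in> U \<and> (\<forall>n. higher_differentiable_on U h n) \<and>
        (\<forall>q\<in>S \<inter> U. (f q, g q) = h q)"
    using U V by (intro exI[of _ "U \<inter> V"] exI[of _ "\<lambda>p. (f' p, g' p)"]) auto
qed

lemma smooth_on_const: "smooth_on S (\<lambda>p. c)"
  by (rule smooth_onI) (auto intro!: exI[of _ UNIV] exI[of _ "\<lambda>p. c"] hdiff_on_const)

lemma smooth_on_bounded_linear: "bounded_linear L \<Longrightarrow> smooth_on S L"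
  by (rule smooth_onI) (auto intro!: exI[of _ UNIV] exI[of _ L] hdiff_on_bounded_linear)

lemma smooth_on_bounded_linear_compose:
  fixes f :: "'a::euclidean_space \<Rightarrow> 'b::euclidean_space" and L :: "'b \<Rightarrow> 'c::euclidean_space"
  assumes "bounded_linear L" "smooth_on S f"
  shows "smooth_on S (\<lambda>p. L (f p))"
  by (rule smooth_on_compose[OF assms(2) smooth_on_bounded_linear[OF assms(1), of UNIV]]) auto

lemmas smooth_on_ident = smooth_on_bounded_linear[OF bounded_linear_ident]

lemma smooth_on_add:
  assumes "smooth_on S f" "smooth_on S g"
  shows "smooth_on S (\<lambda>p. f p + g p)"
  using smooth_on_bounded_linear_compose[OF bounded_linear_add[OF bounded_linear_fst bounded_linear_snd]
      smooth_on_Pair[OF assms]] by simp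

lemma smooth_on_scaleR:
  fixes a :: "'a::euclidean_space \<Rightarrow> real" and b :: "'a \<Rightarrow> 'b::euclidean_space"
  assumes "smooth_on S a" "smooth_on S b"
  shows "smooth_on S (\<lambda>p. a p *\<^sub>R b p)"
proof -
  have "smooth_on UNIV (\<lambda>p::real \<times> 'b. fst p *\<^sub>R snd p)"
    by (simp add: smooth_on_open_iff hdiff_on_scaleR
       hdiff_on_bounded_linear bounded_linear_fst bounded_linear_snd)
  from smooth_on_compose[OF smooth_on_Pair[OF assms] this] show ?thesis by simp
qed

section \<open>Smooth functions of one real variable\<close>

lemma hdiff_on_derivative_sequence:
  fixes G :: "nat \<Rightarrow> real \<Rightarrow> 'a::euclidean_space"
  assumes "open U" and "\<And>k x. x \<in> U \<Longrightarrow> (G k has_vector_derivative G (Suc k) x) (at x)"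
  shows "higher_differentiable_on U (\<lambda>x. c *\<^sub>R G k x) n"
proof (induction n arbitrary: c k)
  case 0
  have "continuous_on U (G k)"
    using assms(2) by (meson continuous_at_imp_continuous_on has_vector_derivative_continuous)
  then show ?case by (simp add: continuous_on_scaleR)
next
  case (Suc n)
  have d: "((\<lambda>x. c *\<^sub>R G k x) has_derivative (\<lambda>v. (c * v) *\<^sub>R G (Suc k) x)) (at x)" if "x \<in> U" for x
    using has_derivative_scaleR_right[OF assms(2)[OF that, unfolded has_vector_derivative_def], of c]
    by simp
  show ?case
    by (rule hdiff_on_SucI[OF assms(1) d Suc.IH])
qed

definition nth_deriv :: "nat \<Rightarrow> (real \<Rightarrow> 'a::euclidean_space) \<Rightarrow> real \<Rightarrow> 'a" where
  "nth_deriv k f = ((\<lambda>g x. vector_derivative g (at x)) ^^ k) f"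

lemma nth_deriv_0 [simp]: "nth_deriv 0 f = f"
  by (simp add: nth_deriv_def)

lemma frechet_derivative_1_eq_vector_derivative:
  assumes "f differentiable (at x)"
  shows "frechet_derivative f (at x) 1 = vector_derivative f (at x)"
  using frechet_derivative_eq_vector_derivative[OF assms] by simp

lemma smooth_on_vector_derivative:
  fixes f :: "real \<Rightarrow> 'a::euclidean_space"
  assumes "open U" "smooth_on U f"
  shows "smooth_on U (\<lambda>x. vector_derivative f (at x))"
    and "x \<in> U \<Longrightarrow> (f has_vector_derivative vector_derivative f (at x)) (at x)"
proof -
  have f: "higher_differentiable_on U f (Suc n)" for n
    using assms smooth_on_open_iff by blast
  then have d: "f differentiable (at x)" if "x \<in> U" for x
    using that by simp
  then show "x \<in> U \<Longrightarrow> (f has_vector_derivative vector_derivative f (at x)) (at x)"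
    by (simp add: vector_derivative_works)
  have "higher_differentiable_on U (\<lambda>x. frechet_derivative f (at x) 1) n" for n
    using f by simp
  then have "higher_differentiable_on U (\<lambda>x. vector_derivative f (at x)) n" for n
    using d by (simp add: frechet_derivative_1_eq_vector_derivative
        cong: hdiff_on_cong[OF assms(1)])
  then show "smooth_on U (\<lambda>x. vector_derivative f (at x))"
    using smooth_on_open_iff[OF assms(1)] by blast
qed

lemma smooth_on_nth_deriv:
  fixes f :: "real \<Rightarrow> 'a::euclidean_space"
  assumes "open U" "smooth_on U f"
  shows "smooth_on U (nth_deriv k f)"
  by (induction k) (auto simp: nth_deriv_def assms(2) intro: smooth_on_vector_derivative[OF assms(1)])

lemma has_vector_derivative_nth_deriv:
  fixes f :: "real \<Rightarrow> 'a::euclidean_space"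
  assumes "open U" "smooth_on U f" "x \<in> U"
  shows "(nth_deriv k f has_vector_derivative nth_deriv (Suc k) f x) (at x)"
  using smooth_on_vector_derivative(2)[OF assms(1) smooth_on_nth_deriv[OF assms(1,2)] assms(3), of k]
  by (simp add: nth_deriv_def)

text \<open>A function on the open half-line all of whose derivatives tend to \<open>0\<close> at the end point is
  flat there: by the mean value inequality its extension by \<open>0\<close> again has derivative \<open>0\<close> at the end
  point, and the same applies to each derivative.\<close>

lemma smooth_on_flat_extension:
  fixes G :: "nat \<Rightarrow> real \<Rightarrow> 'a::euclidean_space"
  assumes d: "\<And>k x. 0 < x \<Longrightarrow> (G k has_vector_derivative G (Suc k) x) (at x)"
    and lim: "\<And>k. (G k \<longlongrightarrow> 0) (at_right 0)"
  shows "smooth_on UNIV (\<lambda>x. if 0 < x then G 0 x else 0)"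
proof -
  define H where "H k x = (if 0 < x then G k x else 0)" for k x
  have "(H k has_vector_derivative H (Suc k) x) (at x)" for k x
  proof (cases x "0::real" rule: linorder_cases)
    case less
    have "(H k has_vector_derivative 0) (at x)"
      by (rule has_vector_derivative_transform_within_open[where f = "\<lambda>_. 0" and S = "{..<0}"])
        (use less in \<open>auto simp: H_def\<close>)
    then show ?thesis using less by (simp add: H_def)
  next
    case greater
    have "(H k has_vector_derivative G (Suc k) x) (at x)"
      by (rule has_vector_derivative_transform_within_open[OF d[OF greater], where S = "{0<..}"])
        (use greater in \<open>auto simp: H_def\<close>)
    then show ?thesis using greater by (simp add: H_def)
  next
    case equal
    have "(H k has_derivative (\<lambda>h. 0)) (at 0)"
      unfolding has_derivative_within_alt
    proof (intro conjI allI impI bounded_linear_zero)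
      fix e :: real assume "0 < e"
      then have "eventually (\<lambda>x. norm (G (Suc k) x) < e) (at_right 0)"
        using tendstoD[OF lim[of "Suc k"]] by (simp add: dist_norm)
      then obtain \<delta> where \<delta>: "0 < \<delta>" "\<And>x. 0 < x \<Longrightarrow> x < \<delta> \<Longrightarrow> norm (G (Suc k) x) < e"
        unfolding eventually_at_right_field by auto
      have bound: "norm (G k x) \<le> e * x" if x: "0 < x" "x < \<delta>" for x
      proof -
        have "eventually (\<lambda>s. norm (G k x - G k s) \<le> e * x) (at_right 0)"
          unfolding eventually_at_right_field
        proof (intro exI conjI allI impI)
          fix s assume s: "0 < s" "s < x"
          have "norm (G k x - G k s) \<le> e * norm (x - s)"
          proof (rule differentiable_bound[where S = "{s..x}" and f' = "\<lambda>y h. h *\<^sub>R G (Suc k) y"])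
            fix y assume y: "y \<in> {s..x}"
            show "(G k has_derivative (\<lambda>h. h *\<^sub>R G (Suc k) y)) (at y within {s..x})"
              using d[of y k] y s by (auto simp: has_vector_derivative_def intro: has_derivative_at_withinI)
            have n: "norm (G (Suc k) y) \<le> e" using \<delta>(2)[of y] y s x by auto
            show "onorm (\<lambda>h. h *\<^sub>R G (Suc k) y) \<le> e"
              by (rule onorm_bound) (use n \<open>0 < e\<close> in \<open>auto simp: mult.commute[of e] intro!: mult_left_mono\<close>)
          qed (use s in auto)
          also have "\<dots> \<le> e * x"
            using s \<open>0 < e\<close> by simp
          finally show "norm (G k x - G k s) \<le> e * x" .
        qed (use x in auto)
        moreover have "((\<lambda>s. norm (G k x - G k s)) \<longlongrightarrow> norm (G k x - 0)) (at_right 0)"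
          by (intro tendsto_intros lim)
        ultimately show ?thesis
          using tendsto_upperbound[of "\<lambda>s. norm (G k x - G k s)" "norm (G k x - 0)" "at_right 0" "e * x"]
          by simp
      qed
      show "\<exists>d>0. \<forall>y\<in>UNIV. norm (y - 0) < d \<longrightarrow> norm (H k y - H k 0 - 0) \<le> e * norm (y - 0)"
        using \<delta>(1) bound \<open>0 < e\<close> by (intro exI[of _ \<delta>]) (auto simp: H_def mult_le_0_iff)
    qed
    then show ?thesis
      using equal by (simp add: H_def has_vector_derivative_def)
  qed
  then have "higher_differentiable_on UNIV (\<lambda>x. 1 *\<^sub>R H 0 x) n" for n
    by (intro hdiff_on_derivative_sequence) auto
  then show ?thesis
    by (simp add: smooth_on_open_iff H_def)
qed

lemma tendsto_poly_times_exp_minus: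
  fixes p :: "real poly"
  shows "((\<lambda>y. y ^ m * poly p y * exp (- y)) \<longlongrightarrow> 0) at_top"
proof (induction p arbitrary: m)
  case 0
  then show ?case by simp
next
  case (pCons a p)
  have "((\<lambda>y. a * (y ^ m / exp y) + y ^ Suc m * poly p y * exp (- y)) \<longlongrightarrow> a * 0 + 0) at_top"
    by (intro tendsto_intros tendsto_power_div_exp_0 pCons.IH)
  then show ?case
    by (simp add: algebra_simps exp_minus divide_inverse)
qed

text \<open>The \<open>k\<close>-th derivative of \<open>exp (- 1 / x)\<close> is \<open>exp (- 1 / x)\<close> times the value of the \<open>k\<close>-th of
  these polynomials at \<open>1 / x\<close>.\<close>

primrec exp_inverse_poly :: "nat \<Rightarrow> real poly" where
  "exp_inverse_poly 0 = 1"
| "exp_inverse_poly (Suc k) = monom 1 2 * (exp_inverse_poly k - pderiv (exp_inverse_poly k))"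

lemma smooth_on_exp_inverse: "smooth_on UNIV (\<lambda>x::real. if 0 < x then exp (- (1 / x)) else 0)"
proof -
  define G where "G k x = poly (exp_inverse_poly k) (1 / x) * exp (- (1 / x))" for k and x :: real
  have "(G k has_vector_derivative G (Suc k) x) (at x)" if "0 < x" for k x
  proof -
    let ?p = "exp_inverse_poly k"
    have i: "((\<lambda>x. 1 / x) has_real_derivative - (1 / x\<^sup>2)) (at x)"
      using DERIV_inverse[of x] that by (simp add: inverse_eq_divide power2_eq_square)
    have "((\<lambda>x. exp (- (1 / x))) has_real_derivative exp (- (1 / x)) * - (- (1 / x\<^sup>2))) (at x)"
      by (rule DERIV_chain2[OF DERIV_exp DERIV_minus[OF i]])
    from DERIV_mult[OF DERIV_chain2[OF poly_DERIV i] this, of ?p]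
    have "(G k has_real_derivative poly (pderiv ?p) (1 / x) * - (1 / x\<^sup>2) * exp (- (1 / x)) +
        exp (- (1 / x)) * - (- (1 / x\<^sup>2)) * poly ?p (1 / x)) (at x)"
      by (simp add: G_def[abs_def])
    also have "poly (pderiv ?p) (1 / x) * - (1 / x\<^sup>2) * exp (- (1 / x)) +
        exp (- (1 / x)) * - (- (1 / x\<^sup>2)) * poly ?p (1 / x) = G (Suc k) x"
      by (simp add: G_def poly_monom power_one_over algebra_simps)
    finally show ?thesis
      by (simp add: has_real_derivative_iff_has_vector_derivative)
  qed
  moreover have "(G k \<longlongrightarrow> 0) (at_right 0)" for k
  proof -
    have "filterlim (\<lambda>x::real. 1 / x) at_top (at_right 0)"
      using filterlim_inverse_at_top_right by (simp add: inverse_eq_divide)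
    from filterlim_compose[OF tendsto_poly_times_exp_minus[of 0 "exp_inverse_poly k"] this]
    show ?thesis by (simp add: G_def[abs_def])
  qed
  ultimately have "smooth_on UNIV (\<lambda>x. if 0 < x then G 0 x else 0)"
    by (rule smooth_on_flat_extension)
  then show ?thesis by (simp add: G_def cong: if_cong)
qed

lemma smooth_bump_exists:
  fixes a b :: real
  obtains f :: "real \<Rightarrow> real" where "smooth_on UNIV f" "\<And>x. f x \<noteq> 0 \<longleftrightarrow> a < x \<and> x < b"
proof
  let ?e = "\<lambda>x::real. if 0 < x then exp (- (1 / x)) else 0"
  have "smooth_on UNIV (\<lambda>x. x + (- a))"
    by (rule smooth_on_add[OF smooth_on_ident smooth_on_const])
  from smooth_on_compose[OF this smooth_on_exp_inverse]
  have 1: "smooth_on UNIV (\<lambda>x. ?e (x + (- a)))" by simp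
  have "smooth_on UNIV (\<lambda>x. (-1) *\<^sub>R x + b)"
    by (rule smooth_on_add[OF smooth_on_bounded_linear[OF bounded_linear_scaleR_right] smooth_on_const])
  from smooth_on_compose[OF this smooth_on_exp_inverse]
  have 2: "smooth_on UNIV (\<lambda>x. ?e ((-1) *\<^sub>R x + b))" by simp
  show "smooth_on UNIV (\<lambda>x. ?e (x + (- a)) *\<^sub>R ?e ((-1) *\<^sub>R x + b))"
    by (rule smooth_on_scaleR[OF 1 2])
  show "?e (x + (- a)) *\<^sub>R ?e ((-1) *\<^sub>R x + b) \<noteq> 0 \<longleftrightarrow> a < x \<and> x < b" for x
    by auto
qed

section \<open>Iterates of the holonomy and the deck group\<close>

lemma Bij_int_pow:
  assumes "f \<in> Bij S"
  shows "f [^]\<^bsub>BijGroup S\<^esub> (n::int) \<in> Bij S"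
    and "x \<in> S \<Longrightarrow> (f [^]\<^bsub>BijGroup S\<^esub> (0::int)) x = x"
    and "x \<in> S \<Longrightarrow> (f [^]\<^bsub>BijGroup S\<^esub> (1::int)) x = f x"
    and "x \<in> S \<Longrightarrow> (f [^]\<^bsub>BijGroup S\<^esub> (m + n)) x =
      (f [^]\<^bsub>BijGroup S\<^esub> m) ((f [^]\<^bsub>BijGroup S\<^esub> n) x)"
proof -
  interpret group "BijGroup S" by (rule group_BijGroup)
  have carrier: "carrier (BijGroup S) = Bij S"
    and one: "\<one>\<^bsub>BijGroup S\<^esub> = (\<lambda>x\<in>S. x)"
    by (simp_all add: BijGroup_def)
  have mult: "(g \<otimes>\<^bsub>BijGroup S\<^esub> h) x = g (h x)" if "g \<in> Bij S" "h \<in> Bij S" "x \<in> S" for g h x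
    using that by (simp add: BijGroup_def compose_def)
  have mem: "f [^]\<^bsub>BijGroup S\<^esub> n \<in> Bij S" for n :: int
    using int_pow_closed[of f n] assms by (simp only: carrier)
  then show "f [^]\<^bsub>BijGroup S\<^esub> (n::int) \<in> Bij S" .
  show "x \<in> S \<Longrightarrow> (f [^]\<^bsub>BijGroup S\<^esub> (0::int)) x = x"
    by (simp add: one)
  show "x \<in> S \<Longrightarrow> (f [^]\<^bsub>BijGroup S\<^esub> (1::int)) x = f x"
    using int_pow_1[of f] assms by (simp only: carrier)
  show "x \<in> S \<Longrightarrow> (f [^]\<^bsub>BijGroup S\<^esub> (m + n)) x =
      (f [^]\<^bsub>BijGroup S\<^esub> m) ((f [^]\<^bsub>BijGroup S\<^esub> n) x)"
    using int_pow_mult[of f m n] assms mult[OF mem mem, of x m n] by (simp only: carrier)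
qed

locale expanding_diffeo =
  fixes \<phi> :: "real \<Rightarrow> real"
  assumes phi: "\<phi> \<in> carrier Diff_halfline"
    and phi_gt: "\<forall>x>0. \<phi> x > x"
begin

abbreviation \<psi> :: "real \<Rightarrow> real" where "\<psi> \<equiv> inv_into {0..} \<phi>"

definition iter :: "int \<Rightarrow> real \<Rightarrow> real" where
  "iter n = \<phi> [^]\<^bsub>BijGroup {0..}\<^esub> n"

lemma phi_Bij: "\<phi> \<in> Bij {0..}"
  and smooth_phi: "smooth_on {0..} \<phi>"
  and smooth_psi: "smooth_on {0..} \<psi>"
  using phi by (auto simp: Diff_halfline_def)

lemma phi_bij: "bij_betw \<phi> {0..} {0..}"
  using phi_Bij by (simp add: Bij_def)

lemma phi_inj: "0 \<le> x \<Longrightarrow> 0 \<le> y \<Longrightarrow> \<phi> x = \<phi> y \<Longrightarrow> x = y"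
  using phi_bij by (auto simp: bij_betw_def inj_on_def)

lemma phi_nonneg: "0 \<le> x \<Longrightarrow> 0 \<le> \<phi> x"
  using phi_bij by (auto simp: bij_betw_def)

lemma phi_psi: "0 \<le> x \<Longrightarrow> \<phi> (\<psi> x) = x"
  and psi_phi: "0 \<le> x \<Longrightarrow> \<psi> (\<phi> x) = x"
  and psi_nonneg: "0 \<le> x \<Longrightarrow> 0 \<le> \<psi> x"
  using phi_bij bij_betw_inv_into_right[of \<phi> "{0..}" "{0..}" x]
    bij_betw_inv_into_left[of \<phi> "{0..}" "{0..}" x] bij_betw_inv_into[OF phi_bij]
  by (auto simp: bij_betw_def)

lemma phi_0: "\<phi> 0 = 0"
proof (rule ccontr)
  assume "\<phi> 0 \<noteq> 0"
  then have "\<psi> 0 > 0"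
    using phi_psi[of 0] psi_nonneg[of 0] by (cases "\<psi> 0 = 0") auto
  then show False
    using phi_gt phi_psi[of 0] by force
qed

lemma phi_pos: "0 < x \<Longrightarrow> 0 < \<phi> x"
  using phi_gt by force

lemma cont_phi: "continuous_on {0..} \<phi>"
  by (rule smooth_on_imp_continuous_on[OF smooth_phi])

lemma phi_strict_mono:
  assumes "0 \<le> x" "x < y"
  shows "\<phi> x < \<phi> y"
proof (rule ccontr)
  assume "\<not> \<phi> x < \<phi> y"
  then have less: "\<phi> y < \<phi> x"
    using phi_inj[of x y] assms by force
  \<comment> \<open>the value \<open>\<phi> y\<close> is then also attained between \<open>0\<close> and \<open>x\<close>\<close>
  have "\<exists>u. 0 \<le> u \<and> u \<le> x \<and> \<phi> u = \<phi> y"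
  proof (rule IVT')
    show "continuous_on {0..x} \<phi>"
      by (rule continuous_on_subset[OF cont_phi]) auto
  qed (use less assms phi_0 phi_nonneg[of y] in auto)
  then obtain u where "0 \<le> u" "u \<le> x" "\<phi> u = \<phi> y" by blast
  then show False
    using phi_inj[of u y] assms by simp
qed

lemma iter_nonneg: "0 \<le> x \<Longrightarrow> 0 \<le> iter n x"
  using Bij_imp_funcset[OF Bij_int_pow(1)[OF phi_Bij, of n]] by (auto simp: iter_def)

lemma iter_0: "0 \<le> x \<Longrightarrow> iter 0 x = x"
  and iter_1: "0 \<le> x \<Longrightarrow> iter 1 x = \<phi> x"
  and iter_add: "0 \<le> x \<Longrightarrow> iter (m + n) x = iter m (iter n x)"
  using Bij_int_pow[OF phi_Bij] by (simp_all add: iter_def)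

lemma iter_minus: "0 \<le> x \<Longrightarrow> iter (- n) (iter n x) = x" "0 \<le> x \<Longrightarrow> iter n (iter (- n) x) = x"
  using iter_add[of x "- n" n] iter_add[of x n "- n"] by (simp_all add: iter_0)

lemma iter_Suc: "0 \<le> x \<Longrightarrow> iter (n + 1) x = \<phi> (iter n x)"
  using iter_add[of x 1 n] by (simp add: iter_1 iter_nonneg add.commute)

lemma iter_Suc': "0 \<le> x \<Longrightarrow> iter (n + 1) x = iter n (\<phi> x)"
  using iter_add[of x n 1] by (simp add: iter_1)

lemma iter_pred: "0 \<le> x \<Longrightarrow> iter (n - 1) x = \<psi> (iter n x)"
  using iter_Suc[of x "n - 1"] by (simp add: psi_phi iter_nonneg)

lemma iter_at_0: "iter n 0 = 0"
proof (induction n rule: int_induct[where k = 0])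
  case (step2 i)
  then show ?case using psi_phi[of 0] by (simp add: iter_pred phi_0)
qed (simp_all add: iter_0 iter_Suc phi_0)

lemma iter_pos: "0 < x \<Longrightarrow> 0 < iter n x"
  using iter_minus(1)[of x n] iter_nonneg[of x n] iter_at_0[of "- n"]
  by (cases "iter n x = 0") auto

lemma smooth_iter: "smooth_on {0..} (iter n)"
proof (induction n rule: int_induct[where k = 0])
  case base
  show ?case by (rule smooth_on_cong[OF smooth_on_ident]) (simp add: iter_0)
next
  case (step1 i)
  have "smooth_on {0..} (\<lambda>x. \<phi> (iter i x))"
    by (rule smooth_on_compose[OF step1(2) smooth_phi]) (auto simp: iter_nonneg)
  then show ?case by (rule smooth_on_cong) (simp add: iter_Suc)
next
  case (step2 i)
  have "smooth_on {0..} (\<lambda>x. \<psi> (iter i x))"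
    by (rule smooth_on_compose[OF step2(2) smooth_psi]) (auto simp: iter_nonneg)
  then show ?case by (rule smooth_on_cong) (simp add: iter_pred)
qed

lemma cont_iter: "continuous_on {0..} (iter n)"
  by (rule smooth_on_imp_continuous_on[OF smooth_iter])

lemma phi_ge: "0 \<le> x \<Longrightarrow> x \<le> \<phi> x"
  using phi_gt phi_0 by (cases "x = 0") (simp_all add: less_imp_le)

lemma iter_ge: "0 \<le> x \<Longrightarrow> x \<le> iter (int n) x"
proof (induction n)
  case (Suc n)
  have "iter (int n) x \<le> \<phi> (iter (int n) x)"
    by (rule phi_ge[OF iter_nonneg[OF Suc.prems]])
  moreover have "iter (int (Suc n)) x = \<phi> (iter (int n) x)"
    using iter_Suc[OF Suc.prems, of "int n"] by (simp add: add.commute)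
  ultimately show ?case using Suc by simp
qed (simp add: iter_0)

lemma iter_ge_phi: "0 \<le> x \<Longrightarrow> 0 < n \<Longrightarrow> \<phi> x \<le> iter n x"
  using iter_ge[of "\<phi> x" "nat (n - 1)"] iter_Suc'[of x "n - 1"] by (simp add: phi_nonneg)

text \<open>A bounded orbit is monotone and would converge to a positive fixed point.\<close>

lemma iter_unbounded:
  assumes "0 < x"
  shows "\<exists>n. c < iter (int n) x"
proof (rule ccontr)
  assume "\<not> ?thesis"
  then have le: "iter (int n) x \<le> c" for n by (simp add: not_less)
  have Suc: "iter (int (Suc n)) x = \<phi> (iter (int n) x)" for n
    using iter_Suc[of x "int n"] assms by (simp add: add.commute)
  have "incseq (\<lambda>n. iter (int n) x)"
    by (rule incseq_SucI) (use Suc phi_gt iter_pos[OF assms] in \<open>simp add: less_imp_le\<close>)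
  then obtain l where l: "(\<lambda>n. iter (int n) x) \<longlonglongrightarrow> l" "\<And>n. iter (int n) x \<le> l"
    using incseq_convergent[of "\<lambda>n. iter (int n) x" c] le by auto
  have "0 < l" using l(2)[of 0] assms by (simp add: iter_0)
  have "(\<lambda>n. \<phi> (iter (int n) x)) \<longlonglongrightarrow> \<phi> l"
    by (rule continuous_on_tendsto_compose[OF cont_phi l(1)])
      (use assms \<open>0 < l\<close> in \<open>auto simp: iter_nonneg\<close>)
  moreover have "(\<lambda>n. \<phi> (iter (int n) x)) \<longlonglongrightarrow> l"
    using LIMSEQ_Suc[OF l(1)] by (simp add: Suc del: of_nat_Suc)
  ultimately have "\<phi> l = l" by (rule LIMSEQ_unique)
  then show False using phi_gt \<open>0 < l\<close> by force
qed

lemma iter_tendsto_0: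
  assumes "0 < x"
  shows "(\<lambda>n. iter (- int n) x) \<longlonglongrightarrow> 0"
proof -
  have Suc: "iter (- int n) x = \<phi> (iter (- int (Suc n)) x)" for n
    using iter_Suc[of x "- int (Suc n)"] assms by simp
  have "decseq (\<lambda>n. iter (- int n) x)"
    by (rule decseq_SucI, subst Suc) (use phi_gt iter_pos[OF assms] in \<open>simp add: less_imp_le\<close>)
  then obtain l where l: "(\<lambda>n. iter (- int n) x) \<longlonglongrightarrow> l"
    using decseq_convergent[of "\<lambda>n. iter (- int n) x" 0] iter_nonneg assms less_imp_le by metis
  have "0 \<le> l"
    by (rule LIMSEQ_le_const[OF l]) (use assms in \<open>auto simp: iter_nonneg\<close>)
  have "(\<lambda>n. \<phi> (iter (- int (Suc n)) x)) \<longlonglongrightarrow> \<phi> l"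
    by (rule continuous_on_tendsto_compose[OF cont_phi LIMSEQ_Suc[OF l]])
      (use assms \<open>0 \<le> l\<close> in \<open>auto simp: iter_nonneg\<close>)
  then have "(\<lambda>n. iter (- int n) x) \<longlonglongrightarrow> \<phi> l"
    by (simp add: Suc)
  from LIMSEQ_unique[OF l this] have "\<phi> l = l" by simp
  then have "\<not> 0 < l" using phi_gt by (metis less_irrefl)
  then have "l = 0" using \<open>0 \<le> l\<close> by simp
  then show ?thesis using l by simp
qed

lemma iter_arbitrarily_small:
  assumes "0 < x" "0 < \<delta>"
  shows "\<exists>n. iter (- int n) x < \<delta>"
  using order_tendstoD(2)[OF iter_tendsto_0[OF assms(1)] assms(2)]
  by (auto simp: eventually_sequentially)

text \<open>An orbit increases from \<open>0\<close> to infinity; the exponent is that of its first point above \<open>a\<close>.\<close>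

lemma fundamental_domain:
  assumes "0 < x" "0 < a"
  shows "\<exists>!n. a \<le> iter n x \<and> iter n x < \<phi> a"
proof -
  obtain k where k: "iter (- int k) x < a"
    using iter_arbitrarily_small[OF assms] by blast
  obtain m where m: "a < iter (int m) x"
    using iter_unbounded[OF assms(1)] by blast
  let ?P = "\<lambda>j. a \<le> iter (int j - int k) x"
  have "?P (m + k)" using m by simp
  define j where "j = (LEAST j. ?P j)"
  have j: "?P j" unfolding j_def by (rule LeastI[of ?P, OF \<open>?P (m + k)\<close>])
  have "j \<noteq> 0"
  proof
    assume "j = 0"
    then show False using j k by simp
  qed
  then have "\<not> ?P (j - 1)" unfolding j_def by (intro not_less_Least) simp
  then have "iter (int j - int k - 1) x < a"
    using \<open>j \<noteq> 0\<close> by (simp add: of_nat_diff algebra_simps)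
  then have "\<phi> (iter (int j - int k - 1) x) < \<phi> a"
    using assms(1) by (intro phi_strict_mono) (simp_all add: iter_nonneg)
  then have ex: "a \<le> iter (int j - int k) x \<and> iter (int j - int k) x < \<phi> a"
    using j iter_Suc[of x "int j - int k - 1"] assms(1) by simp
  have uniq: "\<not> m < n" if m: "a \<le> iter m x" and n: "iter n x < \<phi> a" for m n
  proof
    assume "m < n"
    have "\<phi> a \<le> \<phi> (iter m x)"
      using m phi_strict_mono[of a "iter m x"] assms by (cases "a = iter m x") auto
    also have "\<dots> \<le> iter (n - m) (iter m x)"
      using iter_ge_phi[of "iter m x" "n - m"] \<open>m < n\<close> assms by (simp add: iter_nonneg)
    also have "\<dots> = iter n x"
      using iter_add[of x "n - m" m] assms by simp
    finally show False using n by simp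
  qed
  show ?thesis
    using ex uniq by (intro ex1I[of _ "int j - int k"]) (auto intro: linorder_neqE)
qed

end

definition dilate :: "complex \<Rightarrow> complex \<times> complex \<Rightarrow> complex \<times> complex" where
  "dilate c z = (c * fst z, c * snd z)"

lemma dilate_simps [simp]:
  "dilate 1 z = z" "dilate c (dilate d z) = dilate (c * d) z" "dilate c 0 = 0" "dilate c (0, 0) = (0, 0)"
  "fst (dilate c z) = c * fst z" "snd (dilate c z) = c * snd z"
  by (auto simp: dilate_def zero_prod_def)

lemma dilate_add: "dilate c (z + w) = dilate c z + dilate c w"
  by (simp add: dilate_def algebra_simps)

lemma norm_dilate: "norm (dilate c z) = cmod c * norm z"
proof -
  have "norm (dilate c z) = sqrt ((cmod c)\<^sup>2 * ((cmod (fst z))\<^sup>2 + (cmod (snd z))\<^sup>2))"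
    by (simp add: dilate_def norm_Pair norm_mult power_mult_distrib algebra_simps)
  also have "\<dots> = cmod c * norm z"
    by (simp add: real_sqrt_mult norm_prod_def)
  finally show ?thesis .
qed

lemma bounded_linear_dilate: "bounded_linear (dilate c)"
  unfolding dilate_def
  by (intro bounded_linear_Pair bounded_linear_mult_right bounded_linear_compose[OF bounded_linear_mult_right]
      bounded_linear_fst bounded_linear_snd)

lemma Rtilde_iff: "(z, x) \<in> Rtilde \<longleftrightarrow> 0 \<le> x \<and> (z \<noteq> 0 \<or> 0 < x)"
  by (auto simp: Rtilde_def zero_prod_def)

lemma Htilde_iff: "(z, x) \<in> Htilde \<longleftrightarrow> z \<noteq> 0 \<and> x = 0"
  by (auto simp: Htilde_def zero_prod_def)

lemma Htilde_subset: "Htilde \<subseteq> Rtilde"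
  by (auto simp: Htilde_iff Rtilde_iff)

locale reeb = expanding_diffeo +
  fixes lam :: complex
  assumes lam: "cmod lam > 1"
begin

abbreviation \<T> :: "pt \<Rightarrow> pt" where "\<T> \<equiv> T_map lam \<phi>"

abbreviation q :: "pt \<Rightarrow> pt set" where "q \<equiv> proj lam \<phi>"

definition deck :: "int \<Rightarrow> pt \<Rightarrow> pt" where
  "deck n = \<T> [^]\<^bsub>BijGroup Rtilde\<^esub> n"

lemma lam_nz: "lam \<noteq> 0" using lam by auto

lemma dilate_eq_0: "c \<noteq> 0 \<Longrightarrow> dilate c z = 0 \<longleftrightarrow> z = 0"
  by (auto simp: dilate_def zero_prod_def prod_eq_iff)

lemma T_eq: "(z, x) \<in> Rtilde \<Longrightarrow> \<T> (z, x) = (dilate lam z, \<phi> x)"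
  by (cases z) (simp add: T_map_def dilate_def)

lemma T_Bij: "\<T> \<in> Bij Rtilde"
proof -
  let ?S = "\<lambda>p. (dilate (1 / lam) (fst p), \<psi> (snd p))"
  have S: "?S (z, x) \<in> Rtilde" if "(z, x) \<in> Rtilde" for z x
    using that psi_nonneg[of x] phi_psi[of x] phi_0 lam_nz
    by (cases "\<psi> x = 0") (auto simp: Rtilde_iff dilate_eq_0)
  have ST: "?S (\<T> (z, x)) = (z, x)" if "(z, x) \<in> Rtilde" for z x
    using that lam_nz by (simp add: T_eq Rtilde_iff psi_phi)
  have TS: "\<T> (?S (z, x)) = (z, x)" if "(z, x) \<in> Rtilde" for z x
    using that S[OF that] lam_nz by (simp add: T_eq phi_psi Rtilde_iff)
  have T: "\<T> (z, x) \<in> Rtilde" if "(z, x) \<in> Rtilde" for z x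
    using that by (auto simp: T_eq Rtilde_iff phi_nonneg phi_pos dilate_eq_0 lam_nz)
  have "bij_betw (\<T>) Rtilde Rtilde"
  proof (rule bij_betw_byWitness[where f' = ?S])
    show "\<forall>p\<in>Rtilde. ?S (\<T> p) = p"
      by (rule ballI) (metis ST surj_pair)
    show "\<forall>p\<in>Rtilde. \<T> (?S p) = p"
      by (rule ballI) (metis TS surj_pair)
    show "\<T> ` Rtilde \<subseteq> Rtilde"
      by (rule image_subsetI) (metis T surj_pair)
    show "?S ` Rtilde \<subseteq> Rtilde"
      by (rule image_subsetI) (metis S surj_pair)
  qed
  then show ?thesis by (simp add: Bij_def T_map_def)
qed

lemma deck_mem: "p \<in> Rtilde \<Longrightarrow> deck n p \<in> Rtilde"
  using Bij_imp_funcset[OF Bij_int_pow(1)[OF T_Bij, of n]] by (auto simp: deck_def)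

lemma deck_0: "p \<in> Rtilde \<Longrightarrow> deck 0 p = p"
  and deck_1: "p \<in> Rtilde \<Longrightarrow> deck 1 p = \<T> p"
  and deck_add: "p \<in> Rtilde \<Longrightarrow> deck (m + n) p = deck m (deck n p)"
  using Bij_int_pow[OF T_Bij] by (simp_all add: deck_def)

lemma deck_minus: "p \<in> Rtilde \<Longrightarrow> deck (- n) (deck n p) = p" "p \<in> Rtilde \<Longrightarrow> deck n (deck (- n) p) = p"
  using deck_add[of p "- n" n] deck_add[of p n "- n"] by (simp_all add: deck_0)

lemma deck_eq:
  assumes "(z, x) \<in> Rtilde"
  shows "deck n (z, x) = (dilate (lam powi n) z, iter n x)"
proof -
  \<comment> \<open>for negative exponents the formula follows from the injectivity of \<open>T\<close>\<close>
  let ?E = "\<lambda>n. (dilate (lam powi n) z, iter n x)"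
  have x: "0 \<le> x" using assms by (simp add: Rtilde_iff)
  have E: "?E n \<in> Rtilde" for n
    using assms lam_nz by (auto simp: Rtilde_iff iter_nonneg iter_pos dilate_eq_0)
  have T: "\<T> (?E n) = ?E (n + 1)" for n
    using E[of n] x lam_nz by (simp add: T_eq iter_Suc power_int_add mult.commute)
  have Suc: "deck (i + 1) (z, x) = \<T> (deck i (z, x))" for i
    using deck_add[OF assms, of 1 i] deck_1[OF deck_mem[OF assms], of i] by (simp add: add.commute)
  show ?thesis
  proof (induction n rule: int_induct[where k = 0])
    case base
    show ?case using assms x by (simp add: deck_0 iter_0)
  next
    case (step1 i)
    then show ?case using Suc[of i] T[of i] by simp
  next
    case (step2 i)
    have "\<T> (deck (i - 1) (z, x)) = \<T> (?E (i - 1))"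
      using Suc[of "i - 1"] T[of "i - 1"] step2 by simp
    then show ?case
      using T_Bij E[of "i - 1"] deck_mem[OF assms, of "i - 1"]
      by (auto simp: Bij_def bij_betw_def dest: inj_onD)
  qed
qed

lemma smooth_deck: "smooth_on Rtilde (deck n)"
proof -
  have "smooth_on Rtilde (\<lambda>p. (dilate (lam powi n) (fst p), iter n (snd p)))"
    by (intro smooth_on_Pair smooth_on_bounded_linear_compose[OF bounded_linear_dilate]
        smooth_on_compose[OF _ smooth_iter] smooth_on_bounded_linear bounded_linear_fst bounded_linear_snd)
      (auto simp: Rtilde_iff)
  then show ?thesis
    by (rule smooth_on_cong) (auto simp: deck_eq)
qed

lemma cont_deck: "continuous_on Rtilde (deck n)"
  by (rule smooth_on_imp_continuous_on[OF smooth_deck])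

lemma deck_free:
  assumes "p \<in> Rtilde" "deck n p = p"
  shows "n = 0"
proof (rule ccontr)
  assume "n \<noteq> 0"
  have pos: False if n: "0 < n" "deck n p = p" for n
  proof (cases p)
    case (Pair z x)
    with n assms(1) have e: "dilate (lam powi n) z = z" "iter n x = x" and x: "0 \<le> x"
      by (auto simp: deck_eq Rtilde_iff)
    have "x = 0"
      using iter_ge_phi[OF x n(1)] spec[OF phi_gt, of x] e(2) x by (cases "0 < x") auto
    then have "z \<noteq> 0" using assms(1) Pair by (simp add: Rtilde_iff)
    have "cmod (lam powi n) * norm z = norm z" by (metis e(1) norm_dilate)
    then have "cmod lam powi n = 1" using \<open>z \<noteq> 0\<close> by (simp add: norm_power_int)
    moreover have "cmod lam powi n > 1" using lam n(1) by (simp add: one_less_power_int)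
    ultimately show False by simp
  qed
  show False
  proof (cases "0 < n")
    case False
    have "deck (- n) p = p" using deck_minus(1)[OF assms(1), of n] assms(2) by simp
    then show False using pos[of "- n"] False \<open>n \<noteq> 0\<close> by simp
  next
    case True
    then show False using pos[of n] assms(2) by simp
  qed
qed

lemma q_def: "q p = {deck n p | n. True}"
  by (simp add: proj_def deck_def)

lemma q_eq_iff:
  assumes "p \<in> Rtilde" "p' \<in> Rtilde"
  shows "q p = q p' \<longleftrightarrow> (\<exists>n. p' = deck n p)"
proof
  assume "q p = q p'"
  moreover have "p' \<in> q p'" using deck_0[OF assms(2)] by (auto simp: q_def intro: exI[of _ 0])
  ultimately show "\<exists>n. p' = deck n p" by (auto simp: q_def)
next
  assume "\<exists>n. p' = deck n p"
  then obtain n where n: "p' = deck n p" by blast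
  show "q p = q p'"
    unfolding q_def n
  proof (intro equalityI subsetI)
    fix r assume "r \<in> {deck k p |k. True}"
    then obtain k where "r = deck k p" by blast
    then have "r = deck (k - n) (deck n p)" using deck_add[OF assms(1), of "k - n" n] by simp
    then show "r \<in> {deck k (deck n p) |k. True}" by blast
  next
    fix r assume "r \<in> {deck k (deck n p) |k. True}"
    then obtain k where "r = deck k (deck n p)" by blast
    then have "r = deck (k + n) p" using deck_add[OF assms(1)] by simp
    then show "r \<in> {deck k p |k. True}" by blast
  qed
qed

lemma q_deck: "p \<in> Rtilde \<Longrightarrow> q (deck n p) = q p"
  using q_eq_iff[of p "deck n p"] deck_mem by auto

text \<open>The deck group acts properly discontinuously: near an interior point \<open>\<phi>\<close> pushes the
  transverse coordinate past a fixed level, and near a boundary point scaling pushes the norm past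
  a fixed level.\<close>

lemma chart_exists:
  assumes "p \<in> Rtilde"
  shows "\<exists>V. is_chart q V \<and> p \<in> V"
proof -
  have inj: "inj_on q V" if V: "V \<subseteq> Rtilde" "\<And>n u. 0 < n \<Longrightarrow> u \<in> V \<Longrightarrow> deck n u \<notin> V" for V
  proof (rule inj_onI)
    fix u v assume uv: "u \<in> V" "v \<in> V" "q u = q v"
    then obtain n where n: "v = deck n u" using q_eq_iff V(1) by blast
    then have u: "u = deck (- n) v" using deck_minus(1)[of u n] uv V(1) by auto
    have "n = 0"
    proof (rule linorder_cases[of n 0])
      assume "n < 0"
      with V(2)[of "- n" v] uv(2) u[symmetric] have "u \<notin> V" by simp
      with uv(1) show ?thesis by simp
    next
      assume "0 < n"
      with V(2)[of n u] uv(1) n[symmetric] have "v \<notin> V" by simp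
      with uv(2) show ?thesis by simp
    qed
    then show "u = v" using n deck_0[of u] uv V(1) by auto
  qed
  obtain z x where p: "p = (z, x)" by (cases p)
  show ?thesis
  proof (cases "0 < x")
    case True
    obtain b where b: "x < b" "b < \<phi> x" using phi_gt True dense by blast
    define V where "V = {u \<in> Rtilde. snd u < b \<and> b < \<phi> (snd u)}"
    have c: "continuous_on Rtilde (\<lambda>u. \<phi> (snd u))"
      by (rule continuous_on_compose2[OF cont_phi]) (auto simp: Rtilde_iff continuous_on_snd)
    have "V = (Rtilde \<inter> snd -` {..<b}) \<inter> (Rtilde \<inter> (\<lambda>u. \<phi> (snd u)) -` {b<..})"
      by (auto simp: V_def)
    moreover have "openin (top_of_set Rtilde) \<dots>"
      by (intro openin_Int continuous_openin_preimage_gen c) (auto intro: continuous_on_snd)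
    ultimately have "openin (top_of_set Rtilde) V" by simp
    moreover have "inj_on q V"
    proof (rule inj)
      fix n :: int and u assume n: "0 < n" "u \<in> V"
      then have "snd (deck n u) = iter n (snd u)" by (cases u) (simp add: V_def deck_eq)
      then show "deck n u \<notin> V"
        using iter_ge_phi[of "snd u" n] n by (cases u) (auto simp: V_def Rtilde_iff)
    qed (auto simp: V_def)
    ultimately show ?thesis
      using b assms p by (intro exI[of _ V]) (auto simp: is_chart_def V_def)
  next
    case False
    then have z: "x = 0" "z \<noteq> 0" using assms p by (auto simp: Rtilde_iff)
    then have "norm z / cmod lam < norm z" using lam by (simp add: divide_less_eq)
    then obtain r where r: "norm z / cmod lam < r" "r < norm z" using dense by blast
    have r0: "0 < r" using r(1) z lam by (meson divide_pos_pos less_trans zero_less_norm_iff zero_less_one)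
    define V where "V = {u \<in> Rtilde. r < norm (fst u) \<and> norm (fst u) < cmod lam * r}"
    have "V = Rtilde \<inter> (\<lambda>u. norm (fst u)) -` {r<..<cmod lam * r}"
      by (auto simp: V_def)
    moreover have "openin (top_of_set Rtilde) \<dots>"
      by (intro continuous_openin_preimage_gen) (auto intro!: continuous_intros)
    ultimately have "openin (top_of_set Rtilde) V" by simp
    moreover have "inj_on q V"
    proof (rule inj)
      fix n :: int and u assume n: "0 < n" "u \<in> V"
      then have e: "norm (fst (deck n u)) = cmod lam powi n * norm (fst u)"
        by (cases u) (simp add: V_def deck_eq norm_dilate norm_power_int)
      have "cmod lam powi 1 \<le> cmod lam powi n"
        using n lam by (intro power_int_increasing) auto
      then have "cmod lam * r \<le> cmod lam powi n * norm (fst u)"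
        using n lam r0 by (intro mult_mono) (auto simp: V_def)
      then show "deck n u \<notin> V" using e by (auto simp: V_def)
    qed (auto simp: V_def)
    moreover have "norm z < cmod lam * r"
      using r(1) lam_nz pos_divide_less_eq[of "cmod lam" "norm z" r] by (simp add: mult.commute)
    then have "p \<in> V"
      using r(2) assms p by (simp add: V_def)
    ultimately show ?thesis
      by (intro exI[of _ V]) (auto simp: is_chart_def)
  qed
qed

end

section \<open>Flatness of equivariant functions\<close>

context expanding_diffeo
begin

lemma filterlim_phi: "filterlim \<phi> (at_right 0) (at_right 0)"
proof -
  have "(\<phi> \<longlongrightarrow> \<phi> 0) (at 0 within {0..})"
    using cont_phi by (simp add: continuous_on_def)
  then have "(\<phi> \<longlongrightarrow> 0) (at 0 within {0..})"
    by (simp only: phi_0)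
  then have "(\<phi> \<longlongrightarrow> 0) (at_right 0)"
    by (rule tendsto_mono[rotated]) (rule at_le, auto)
  moreover have "eventually (\<lambda>x. \<phi> x \<in> {0<..} \<and> \<phi> x \<noteq> 0) (at_right 0)"
    using eventually_at_right_less[of 0] by eventually_elim (auto dest: phi_pos)
  ultimately show ?thesis by (simp add: filterlim_at)
qed

text \<open>The inequality carries a bound for \<open>u\<close> on the compact interval from \<open>\<delta>\<close> to \<open>\<phi> \<delta>\<close> backwards
  along orbits to all smaller points. Once \<open>u\<close> is bounded near \<open>0\<close>, each further application, on a
  smaller neighbourhood of \<open>0\<close>, contracts the bound by \<open>\<theta>\<close> up to a small error.\<close>

lemma contraction_tendsto_0:
  fixes u v :: "real \<Rightarrow> real"
  assumes \<theta>: "0 \<le> \<theta>" "\<theta> < 1"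
    and ev: "eventually (\<lambda>x. u x \<le> \<theta> * u (\<phi> x) + v x) (at_right 0)"
    and v: "(v \<longlongrightarrow> 0) (at_right 0)"
    and cont: "continuous_on {0<..} u" and nonneg: "\<And>x. 0 \<le> u x"
  shows "(u \<longlongrightarrow> 0) (at_right 0)"
proof -
  have "eventually (\<lambda>x. v x < 1 - \<theta>) (at_right 0)"
    using order_tendstoD(2)[OF v, of "1 - \<theta>"] \<theta> by simp
  with ev have "eventually (\<lambda>x. u x \<le> \<theta> * u (\<phi> x) + (1 - \<theta>)) (at_right 0)"
    by eventually_elim simp
  then obtain \<delta> where \<delta>: "0 < \<delta>" "\<And>x. 0 < x \<Longrightarrow> x < \<delta> \<Longrightarrow> u x \<le> \<theta> * u (\<phi> x) + (1 - \<theta>)"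
    unfolding eventually_at_right_field by auto
  have "bounded (u ` {\<delta>..\<phi> \<delta>})"
    using \<delta>(1) by (intro compact_imp_bounded compact_continuous_image continuous_on_subset[OF cont]) auto
  then obtain C0 where C0: "\<forall>x\<in>{\<delta>..\<phi> \<delta>}. norm (u x) \<le> C0"
    by (auto simp: bounded_iff)
  define C where "C = max 1 C0"
  have K: "u x \<le> C" if "\<delta> \<le> x" "x \<le> \<phi> \<delta>" for x
    using C0[rule_format, of x] that by (auto simp: C_def)
  have C1: "1 \<le> C" by (simp add: C_def)
  have exit: "u x \<le> C" if "0 < x" "x < \<delta>" "\<delta> \<le> iter (int n) x" for n x
    using that
  proof (induction n arbitrary: x)
    case 0
    then show ?case by (simp add: iter_0)
  next
    case (Suc n)
    have "iter (int (Suc n)) x = iter (int n) (\<phi> x)"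
      using iter_Suc'[of x "int n"] Suc.prems(1) by (simp add: add.commute)
    then have "u (\<phi> x) \<le> C"
      using Suc.IH[of "\<phi> x"] Suc.prems K[of "\<phi> x"] phi_strict_mono[of x \<delta>] phi_pos[of x]
      by (cases "\<phi> x < \<delta>") auto
    then have "\<theta> * u (\<phi> x) \<le> \<theta> * C" using \<theta> by (simp add: mult_left_mono)
    then have "u x \<le> \<theta> * C + (1 - \<theta>) * 1" using \<delta>(2)[of x] Suc.prems by simp
    also have "\<dots> \<le> \<theta> * C + (1 - \<theta>) * C"
      using \<theta> C1 by (intro add_left_mono mult_left_mono) auto
    finally show ?case by (simp add: algebra_simps)
  qed
  have bound: "u x \<le> C" if "0 < x" "x < \<delta>" for x
    using iter_unbounded[OF that(1), of \<delta>] exit[OF that] by (meson less_imp_le)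
  have "eventually (\<lambda>x. u x \<le> \<theta> ^ N * C + e) (at_right 0)" if "0 < e" for e N
  proof (induction N)
    case 0
    show ?case
      unfolding eventually_at_right_field using \<delta>(1) bound that
      by (intro exI[of _ \<delta>]) force
  next
    case (Suc N)
    have "eventually (\<lambda>x. v x < (1 - \<theta>) * e) (at_right 0)"
      using order_tendstoD(2)[OF v, of "(1 - \<theta>) * e"] \<theta> that by simp
    moreover have "eventually (\<lambda>x. u (\<phi> x) \<le> \<theta> ^ N * C + e) (at_right 0)"
      using filterlim_phi Suc unfolding filterlim_iff by blast
    ultimately show ?case
      using ev
    proof eventually_elim
      case (elim x)
      have "\<theta> * u (\<phi> x) \<le> \<theta> * (\<theta> ^ N * C + e)"
        using elim(2) \<theta> by (simp add: mult_left_mono)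
      then show ?case using elim(1,3) by (simp add: algebra_simps)
    qed
  qed
  note iterate = this
  show ?thesis
  proof (rule tendstoI)
    fix e :: real assume "0 < e"
    have "(\<lambda>N. \<theta> ^ N * C) \<longlonglongrightarrow> 0 * C"
      using \<theta> by (intro tendsto_mult_right LIMSEQ_realpow_zero)
    then have "eventually (\<lambda>N. \<theta> ^ N * C < e / 2) sequentially"
      using \<open>0 < e\<close> order_tendstoD(2)[of _ "0::real" sequentially "e / 2"] by simp
    then obtain N where "\<theta> ^ N * C < e / 2"
      by (auto simp: eventually_sequentially)
    moreover have "eventually (\<lambda>x. u x \<le> \<theta> ^ N * C + e / 2) (at_right 0)"
      using iterate[of "e / 2" N] \<open>0 < e\<close> by simp
    ultimately show "eventually (\<lambda>x. dist (u x) 0 < e) (at_right 0)"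
      by (auto elim!: eventually_mono simp: nonneg)
  qed
qed

end

locale tangent_diffeo = expanding_diffeo +
  assumes deriv_phi_0: "halfline_deriv (\<lambda>x. \<phi> x - x) 0 = 0"
begin

text \<open>The extension across \<open>0\<close> gives two-sided derivatives, which are bounded near \<open>0\<close>.\<close>

lemma local_extension:
  obtains U g where "open U" "0 \<in> U" "smooth_on U g" "\<And>x. 0 \<le> x \<Longrightarrow> x \<in> U \<Longrightarrow> \<phi> x = g x"
    "vector_derivative g (at 0) = 1"
proof -
  obtain U g where U: "open U" "0 \<in> U" "\<And>n. higher_differentiable_on U g n"
      "\<And>x. x \<in> {0..} \<Longrightarrow> x \<in> U \<Longrightarrow> \<phi> x = g x"
    using smooth_onE[OF smooth_phi, of 0] by auto
  have g: "smooth_on U g" using U smooth_on_open_iff by blast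
  have "(g has_vector_derivative vector_derivative g (at 0)) (at 0 within {0..})"
    using smooth_on_vector_derivative(2)[OF U(1) g U(2)] by (rule has_vector_derivative_at_within)
  then have "((\<lambda>x. g x - x) has_vector_derivative vector_derivative g (at 0) - 1) (at 0 within {0..})"
    by (intro has_vector_derivative_diff has_vector_derivative_id)
  then have "((\<lambda>x. \<phi> x - x) has_vector_derivative vector_derivative g (at 0) - 1) (at 0 within {0..})"
    unfolding has_vector_derivative_def
  proof (rule has_derivative_transform_eventually)
    have "eventually (\<lambda>x. x \<in> U \<and> x \<in> {0..}) (at 0 within {0..})"
      using U(1,2) by (auto simp: eventually_at_topological)
    then show "eventually (\<lambda>x. g x - x = \<phi> x - x) (at 0 within {0..})"
      by eventually_elim (use U(4) in auto)
  qed (use U(2,4) in auto)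
  moreover have "at (0::real) within {0..} \<noteq> bot"
    by (simp add: at_within_Ici_at_right)
  ultimately have "halfline_deriv (\<lambda>x. \<phi> x - x) 0 = vector_derivative g (at 0) - 1"
    unfolding halfline_deriv_def by (metis vector_derivative_within)
  then show ?thesis
    using that[OF U(1,2) g] U(4) deriv_phi_0 by auto
qed

end

lemma infinitely_tangent_deriv_0:
  assumes "infinitely_tangent_to_id \<phi>"
  shows "halfline_deriv (\<lambda>x. \<phi> x - x) 0 = 0"
  using assms[unfolded infinitely_tangent_to_id_def, rule_format, of 1] by simp

text \<open>A solution on the open half-line. It is shown to extend smoothly to the end point.\<close>

locale equivariant = tangent_diffeo + 
  fixes lam :: complex and \<beta> :: "real \<Rightarrow> complex"
  assumes lam: "cmod lam > 1"
    and smooth_beta: "smooth_on {0<..} \<beta>"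
    and equiv: "\<And>x. 0 < x \<Longrightarrow> \<beta> (\<phi> x) = lam * \<beta> x"
begin

lemma deriv_beta: "0 < x \<Longrightarrow> (nth_deriv k \<beta> has_vector_derivative nth_deriv (Suc k) \<beta> x) (at x)"
  using has_vector_derivative_nth_deriv[OF _ smooth_beta, of x k] by simp

text \<open>Differentiating the functional equation \<open>k\<close> times expresses the \<open>k\<close>-th derivative of \<open>\<beta>\<close> at \<open>x\<close> by
  derivatives of order at most \<open>k\<close> at \<open>\<phi> x\<close>, with coefficients that are smooth across \<open>0\<close>; the
  leading one is \<open>\<phi>'\<^sup>k\<close>.\<close>

lemma differentiated_equation:
  assumes U: "open U" "smooth_on U g" "\<And>x. 0 \<le> x \<Longrightarrow> x \<in> U \<Longrightarrow> \<phi> x = g x"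
  shows "\<exists>c :: nat \<Rightarrow> real \<Rightarrow> real. (\<forall>j. smooth_on U (c j)) \<and>
     c k = (\<lambda>x. vector_derivative g (at x) ^ k) \<and>
     (\<forall>x\<in>U. 0 < x \<longrightarrow> lam * nth_deriv k \<beta> x = (\<Sum>j\<le>k. c j x *\<^sub>R nth_deriv j \<beta> (\<phi> x)))"
proof (induction k)
  case 0
  show ?case
    by (rule exI[of _ "\<lambda>j x. 1"]) (simp add: smooth_on_const equiv)
next
  case (Suc k)
  let ?g' = "\<lambda>x. vector_derivative g (at x)"
  let ?B = "\<lambda>j. nth_deriv j \<beta>"
  obtain c :: "nat \<Rightarrow> real \<Rightarrow> real" where c: "\<And>j. smooth_on U (c j)" "c k = (\<lambda>x. ?g' x ^ k)"
      "\<And>x. x \<in> U \<Longrightarrow> 0 < x \<Longrightarrow> lam * ?B k x = (\<Sum>j\<le>k. c j x *\<^sub>R ?B j (\<phi> x))"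
    using Suc by blast
  let ?c' = "\<lambda>j x. vector_derivative (c j) (at x)"
  \<comment> \<open>coefficients collected from the product rule and the chain rule; the derivative of \<open>c j\<close>
    enters only for \<open>j \<le> k\<close>\<close>
  define d where "d j = (case j of 0 \<Rightarrow> ?c' 0
      | Suc i \<Rightarrow> (\<lambda>x. (if i < k then ?c' j x else 0) + c i x *\<^sub>R ?g' x))" for j
  have "smooth_on U (d j)" for j
  proof (cases j)
    case 0
    then show ?thesis
      using smooth_on_vector_derivative(1)[OF U(1) c(1)] by (simp add: d_def)
  next
    case (Suc i)
    have 1: "smooth_on U (\<lambda>x. if i < k then ?c' j x else 0)"
      using smooth_on_vector_derivative(1)[OF U(1) c(1)] smooth_on_const
      by (cases "i < k") simp_all
    show ?thesis
      using smooth_on_add[OF 1 smooth_on_scaleR[OF c(1)[of i] smooth_on_vector_derivative(1)[OF U(1,2)]]]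
      unfolding d_def Suc by simp
  qed
  moreover have "d (Suc k) = (\<lambda>x. ?g' x ^ Suc k)"
    by (simp add: d_def c(2) mult.commute)
  moreover have "lam * ?B (Suc k) x = (\<Sum>j\<le>Suc k. d j x *\<^sub>R ?B j (\<phi> x))" if x: "x \<in> U" "0 < x" for x
  proof -
    have phi': "(\<phi> has_vector_derivative ?g' x) (at x)"
      by (rule has_vector_derivative_transform_within_open
          [OF smooth_on_vector_derivative(2)[OF U(1,2) x(1)], where S = "U \<inter> {0<..}"])
        (use x U in auto)
    have B: "((\<lambda>x. ?B j (\<phi> x)) has_vector_derivative ?g' x *\<^sub>R ?B (Suc j) (\<phi> x)) (at x)" for j
      using vector_diff_chain_at[OF phi' deriv_beta[OF phi_pos[OF x(2)], of j]] by (simp add: o_def)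
    have "((\<lambda>x. \<Sum>j\<le>k. c j x *\<^sub>R ?B j (\<phi> x)) has_vector_derivative
        (\<Sum>j\<le>k. c j x *\<^sub>R (?g' x *\<^sub>R ?B (Suc j) (\<phi> x)) + ?c' j x *\<^sub>R ?B j (\<phi> x))) (at x)"
      using smooth_on_vector_derivative(2)[OF U(1) c(1) x(1)]
      by (intro has_vector_derivative_sum has_vector_derivative_scaleR B)
        (simp add: has_real_derivative_iff_has_vector_derivative)
    then have "((\<lambda>x. lam * ?B k x) has_vector_derivative
        (\<Sum>j\<le>k. c j x *\<^sub>R (?g' x *\<^sub>R ?B (Suc j) (\<phi> x)) + ?c' j x *\<^sub>R ?B j (\<phi> x))) (at x)"
      by (rule has_vector_derivative_transform_within_open[where S = "U \<inter> {0<..}"])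
        (use x U c(3) in auto)
    moreover have "((\<lambda>x. lam * ?B k x) has_vector_derivative lam * ?B (Suc k) x) (at x)"
      by (rule has_vector_derivative_mult_right[OF deriv_beta[OF x(2)]])
    ultimately have "lam * ?B (Suc k) x =
        (\<Sum>j\<le>k. c j x *\<^sub>R (?g' x *\<^sub>R ?B (Suc j) (\<phi> x)) + ?c' j x *\<^sub>R ?B j (\<phi> x))"
      using vector_derivative_unique_at by blast
    also have "\<dots> = (\<Sum>j\<le>k. (c j x *\<^sub>R ?g' x) *\<^sub>R ?B (Suc j) (\<phi> x)) + (\<Sum>j\<le>k. ?c' j x *\<^sub>R ?B j (\<phi> x))"
      by (simp add: sum.distrib)
    also have "(\<Sum>j\<le>k. ?c' j x *\<^sub>R ?B j (\<phi> x)) =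
        (\<Sum>j\<le>Suc k. (if j \<le> k then ?c' j x else 0) *\<^sub>R ?B j (\<phi> x))"
      by simp
    also have "\<dots> = ?c' 0 x *\<^sub>R ?B 0 (\<phi> x) +
        (\<Sum>j\<le>k. (if j < k then ?c' (Suc j) x else 0) *\<^sub>R ?B (Suc j) (\<phi> x))"
      by (subst sum.atMost_Suc_shift) (simp add: Suc_le_eq)
    also have "(\<Sum>j\<le>k. (c j x *\<^sub>R ?g' x) *\<^sub>R ?B (Suc j) (\<phi> x)) + \<dots> =
        (\<Sum>j\<le>Suc k. d j x *\<^sub>R ?B j (\<phi> x))"
      unfolding sum.atMost_Suc_shift[of "\<lambda>j. d j x *\<^sub>R ?B j (\<phi> x)"]
      by (simp add: d_def sum.distrib scaleR_add_left)
    finally show ?thesis .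
  qed
  ultimately show ?case by blast
qed

text \<open>Division by \<open>\<lambda>\<close> makes the differentiated equation a contraction for the derivative of highest
  order; the lower order terms tend to \<open>0\<close> by induction.\<close>

lemma derivatives_tendsto_0: "(nth_deriv k \<beta> \<longlongrightarrow> 0) (at_right 0)"
proof (induction k rule: less_induct)
  case (less k)
  let ?B = "\<lambda>j. nth_deriv j \<beta>"
  obtain U g where U: "open U" "0 \<in> U" "smooth_on U g" "\<And>x. 0 \<le> x \<Longrightarrow> x \<in> U \<Longrightarrow> \<phi> x = g x"
    "vector_derivative g (at 0) = 1"
    using local_extension by blast
  obtain c :: "nat \<Rightarrow> real \<Rightarrow> real" where c: "\<And>j. smooth_on U (c j)"
      "c k = (\<lambda>x. vector_derivative g (at x) ^ k)"
      "\<And>x. x \<in> U \<Longrightarrow> 0 < x \<Longrightarrow> lam * ?B k x = (\<Sum>j\<le>k. c j x *\<^sub>R ?B j (\<phi> x))"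
    using differentiated_equation[OF U(1,3,4), of k] by blast
  have lim_c: "(c j \<longlongrightarrow> c j 0) (at_right 0)" for j
    using smooth_on_imp_continuous_on[OF c(1)[of j]] U(1,2)
    by (auto simp: continuous_on_eq_continuous_at isCont_def intro: tendsto_within_subset[of _ _ _ UNIV])
  define r where "r x = (\<Sum>j<k. \<bar>c j x\<bar> * norm (?B j (\<phi> x))) / cmod lam" for x
  have "(r \<longlongrightarrow> (\<Sum>j<k. \<bar>c j 0\<bar> * norm (0::complex)) / cmod lam) (at_right 0)"
    unfolding r_def using lam
    by (intro tendsto_intros lim_c filterlim_compose[OF less.IH filterlim_phi]) auto
  then have r: "(r \<longlongrightarrow> 0) (at_right 0)" by simp
  \<comment> \<open>the leading coefficient tends to \<open>1\<close>, hence is eventually below \<open>(1 + \<bar>\<lambda>\<bar>) / 2 < \<bar>\<lambda>\<bar>\<close>\<close>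
  define \<theta> where "\<theta> = (1 + cmod lam) / (2 * cmod lam)"
  have "0 < cmod lam" using lam by linarith
  then have \<theta>: "0 \<le> \<theta>" "\<theta> < 1" and lam_\<theta>: "cmod lam * \<theta> = (1 + cmod lam) / 2"
    using lam by (simp_all add: \<theta>_def pos_divide_less_eq)
  have "((\<lambda>x. norm (?B k x)) \<longlongrightarrow> 0) (at_right 0)"
  proof (rule contraction_tendsto_0[OF \<theta> _ r])
    have "((\<lambda>x. \<bar>c k x\<bar>) \<longlongrightarrow> \<bar>c k 0\<bar>) (at_right 0)"
      by (intro tendsto_intros lim_c)
    then have "eventually (\<lambda>x. \<bar>c k x\<bar> < (1 + cmod lam) / 2) (at_right 0)"
      by (rule order_tendstoD(2)) (use lam in \<open>simp add: c(2) U(5)\<close>)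
    moreover have "eventually (\<lambda>x. x \<in> U) (at_right 0)"
      using U(1,2) by (auto simp: eventually_at_topological)
    ultimately show "eventually (\<lambda>x. norm (?B k x) \<le> \<theta> * norm (?B k (\<phi> x)) + r x) (at_right 0)"
      using eventually_at_right_less[of 0]
    proof eventually_elim
      case (elim x)
      have "cmod lam * norm (?B k x) = norm (\<Sum>j\<le>k. c j x *\<^sub>R ?B j (\<phi> x))"
        using c(3)[OF elim(2,3)] by (metis norm_mult)
      also have "\<dots> \<le> (\<Sum>j\<le>k. \<bar>c j x\<bar> * norm (?B j (\<phi> x)))"
        by (rule sum_norm_le) simp
      also have "\<dots> = \<bar>c k x\<bar> * norm (?B k (\<phi> x)) + cmod lam * r x"
        using lam by (auto simp: r_def lessThan_Suc_atMost[symmetric])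
      also have "\<dots> \<le> (1 + cmod lam) / 2 * norm (?B k (\<phi> x)) + cmod lam * r x"
        using elim(1) by (intro add_right_mono mult_right_mono) auto
      also have "\<dots> = cmod lam * (\<theta> * norm (?B k (\<phi> x)) + r x)"
        by (simp add: distrib_left lam_\<theta> mult.assoc[symmetric])
      finally show ?case
        using lam by (simp only: mult_le_cancel_left_pos)
    qed
    have "continuous_on {0<..} (?B k)"
      using smooth_on_imp_continuous_on[OF smooth_on_nth_deriv[OF _ smooth_beta]] by simp
    then show "continuous_on {0<..} (\<lambda>x. norm (?B k x))"
      by (rule continuous_on_norm)
  qed simp
  then show ?case
    by (rule tendsto_norm_zero_cancel)
qed

lemma smooth_extension_by_0: "smooth_on UNIV (\<lambda>x. if 0 < x then \<beta> x else 0)"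
  using smooth_on_flat_extension[of "\<lambda>k. nth_deriv k \<beta>", OF deriv_beta derivatives_tendsto_0]
  by (simp cong: if_cong)

end

section \<open>The space of equivariant functions\<close>

locale tangent_reeb = tangent_diffeo + reeb
begin

definition exponent :: "real \<Rightarrow> int" where
  "exponent x = (THE n. 1 \<le> iter n x \<and> iter n x < \<phi> 1)"

lemma exponent_eqI: "0 < x \<Longrightarrow> 1 \<le> iter n x \<Longrightarrow> iter n x < \<phi> 1 \<Longrightarrow> exponent x = n"
  unfolding exponent_def using fundamental_domain[of x 1] by (intro the1_equality) auto

lemma exponent_bounds:
  assumes "0 < x"
  shows "1 \<le> iter (exponent x) x" "iter (exponent x) x < \<phi> 1"
  using theI'[OF fundamental_domain[OF assms zero_less_one]] by (simp_all add: exponent_def)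

lemma exponent_iter: "0 < x \<Longrightarrow> exponent (iter n x) = exponent x - n"
  using exponent_bounds[of x] iter_add[of x "exponent x - n" n]
  by (intro exponent_eqI) (simp_all add: iter_pos)

definition equivariant_extension :: "(real \<Rightarrow> real) \<Rightarrow> real \<Rightarrow> complex" where
  "equivariant_extension b x =
     (if 0 < x then lam powi (- exponent x) * of_real (b (iter (exponent x) x)) else 0)"

lemma equivariant_extension_iter:
  assumes "0 < x"
  shows "equivariant_extension b (iter n x) = lam powi n * equivariant_extension b x"
proof -
  have "iter (exponent x - n) (iter n x) = iter (exponent x) x"
    using iter_add[of x "exponent x - n" n] assms by simp
  moreover have "lam powi (n - exponent x) = lam powi n * lam powi (- exponent x)"
    using lam_nz by (simp add: power_int_add[symmetric])
  ultimately show ?thesis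
    using assms by (simp add: equivariant_extension_def exponent_iter iter_pos)
qed

lemma equivariant_extension_eq:
  "1 \<le> x \<Longrightarrow> x < \<phi> 1 \<Longrightarrow> equivariant_extension b x = of_real (b x)"
  using exponent_eqI[of x 0] by (simp add: equivariant_extension_def iter_0)

lemma equivariant_extension_equation: "0 \<le> x \<Longrightarrow> equivariant_extension b (\<phi> x) = lam * equivariant_extension b x"
  using equivariant_extension_iter[of x b 1]
  by (cases "x = 0") (simp_all add: phi_0 iter_1 equivariant_extension_def)

text \<open>Near the fundamental domain the extension agrees with \<open>b\<close>, and an iterate of \<open>\<phi>\<close> carries every
  positive point there. At \<open>0\<close> smoothness comes from flatness.\<close>

lemma smooth_equivariant_extension:
  assumes b: "smooth_on UNIV b" and supp: "\<And>x. b x \<noteq> 0 \<Longrightarrow> 1 \<le> x \<and> x < d" and d: "d < \<phi> 1"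
  shows "smooth_on UNIV (equivariant_extension b)"
proof -
  let ?\<beta> = "equivariant_extension b"
  \<comment> \<open>the support avoids a neighbourhood of \<open>\<phi> 1\<close>, so no gluing takes place at the end points\<close>
  define W where "W = {y. 0 < y \<and> d < \<phi> y \<and> y < \<phi> 1}"
  have near: "?\<beta> y = of_real (b y)" if "y \<in> W" for y
  proof (cases "1 \<le> y")
    case True
    then show ?thesis using that equivariant_extension_eq by (auto simp: W_def)
  next
    case False
    then have y: "0 < y" "y < 1" "d < \<phi> y" using that by (auto simp: W_def)
    have "1 \<le> \<phi> y \<Longrightarrow> ?\<beta> (\<phi> y) = 0"
      using equivariant_extension_eq[of "\<phi> y" b] phi_strict_mono[of y 1] y supp[of "\<phi> y"] by force
    moreover have "?\<beta> (\<phi> y) = lam * ?\<beta> y"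
      using equivariant_extension_equation[of y b] y by simp
    moreover have "b y = 0" using supp[of y] y by force
    moreover have "?\<beta> y = 0" if "\<phi> y < 1"
    proof -
      have "exponent y \<noteq> 0" using exponent_bounds(1)[of y] y by (auto simp: iter_0)
      have "b z = 0" if "1 \<le> z" for z using supp[of z] that y \<open>\<phi> y < 1\<close> by force
      then show ?thesis using exponent_bounds(1)[of y] y by (simp add: equivariant_extension_def)
    qed
    ultimately show ?thesis using lam_nz by (cases "1 \<le> \<phi> y") auto
  qed
  have 1: "1 \<le> y \<Longrightarrow> y < \<phi> 1 \<Longrightarrow> y \<in> W" for y
    using d phi_strict_mono[of 1 y] by (cases "y = 1") (auto simp: W_def)
  have contp: "continuous_on {0<..} \<phi>"
    by (rule continuous_on_subset[OF cont_phi]) auto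
  have "W = ({0<..} \<inter> \<phi> -` {d<..}) \<inter> {..<\<phi> 1}"
    by (auto simp: W_def)
  also have "open \<dots>"
    by (intro open_Int continuous_open_preimage[OF contp]) auto
  finally have "open W" .
  have "smooth_on {0<..} ?\<beta>"
  proof (rule smooth_on_local)
    fix x :: real assume "x \<in> {0<..}"
    then have x: "0 < x" by simp
    define n where "n = exponent x"
    have conti: "continuous_on {0<..} (iter n)"
      by (rule continuous_on_subset[OF cont_iter]) auto
    define V where "V = {0<..} \<inter> iter n -` W"
    have "open V"
      unfolding V_def by (rule continuous_open_preimage[OF conti _ \<open>open W\<close>]) auto
    moreover have "x \<in> V"
      using x exponent_bounds[OF x] 1[of "iter n x"] by (auto simp: V_def n_def)
    moreover have "smooth_on ({0<..} \<inter> V) ?\<beta>"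
    proof (rule smooth_on_cong)
      have L: "bounded_linear (\<lambda>r. lam powi (- n) * of_real r :: complex)"
        by (rule bounded_linear_compose[OF bounded_linear_mult_right bounded_linear_of_real])
      have "smooth_on {0..} (\<lambda>x. b (iter n x))"
        by (rule smooth_on_compose[OF smooth_iter b]) simp
      from smooth_on_bounded_linear_compose[OF L this]
      show "smooth_on ({0<..} \<inter> V) (\<lambda>x. lam powi (- n) * of_real (b (iter n x)))"
        by (rule smooth_on_subset) auto
    next
      fix y assume "y \<in> {0<..} \<inter> V"
      then have y: "0 < y" "iter n y \<in> W" by (auto simp: V_def)
      have "?\<beta> y = lam powi (- n) * (lam powi n * ?\<beta> y)"
        using lam_nz by (simp add: power_int_minus)
      also have "\<dots> = lam powi (- n) * of_real (b (iter n y))"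
        using near[OF y(2)] equivariant_extension_iter[OF y(1), of b n] by simp
      finally show "lam powi (- n) * of_real (b (iter n y)) = ?\<beta> y" by simp
    qed
    ultimately show "\<exists>V. open V \<and> x \<in> V \<and> smooth_on ({0<..} \<inter> V) ?\<beta>" by blast
  qed
  then interpret equivariant \<phi> lam ?\<beta>
    using lam equivariant_extension_equation by unfold_locales auto
  show ?thesis
    by (rule smooth_on_cong[OF smooth_extension_by_0]) (simp add: equivariant_extension_def)
qed

lemma equivariant_extension_mem:
  assumes "smooth_on UNIV b" "\<And>x. b x \<noteq> 0 \<Longrightarrow> 1 \<le> x \<and> x < d" "d < \<phi> 1"
  shows "equivariant_extension b \<in> equivariant_functions \<phi> lam"
  using smooth_on_subset[OF smooth_equivariant_extension[OF assms], of "{0..}"]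
  by (auto simp: equivariant_functions_def equivariant_extension_equation)
    (simp add: equivariant_extension_def)

lemma subspace_equivariant_functions: "complex_fun.subspace (equivariant_functions \<phi> lam)"
proof (rule complex_fun.subspaceI)
  show "0 \<in> equivariant_functions \<phi> lam"
    by (simp add: equivariant_functions_def zero_fun_def smooth_on_const)
  fix f g :: "real \<Rightarrow> complex" and c :: complex
  assume f: "f \<in> equivariant_functions \<phi> lam"
  show "(\<lambda>x. c * f x) \<in> equivariant_functions \<phi> lam"
    using f smooth_on_bounded_linear_compose[OF bounded_linear_mult_right, of "{0..}" f c]
    by (simp add: equivariant_functions_def)
  assume g: "g \<in> equivariant_functions \<phi> lam"
  show "f + g \<in> equivariant_functions \<phi> lam"
    using f g smooth_on_add[of "{0..}" f g]
    by (simp add: equivariant_functions_def plus_fun_def distrib_left)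
qed

text \<open>Bump functions supported in infinitely many disjoint intervals of one fundamental domain
  extend to linearly independent solutions.\<close>

lemma equivariant_functions_infinite_dim:
  "\<not> (\<exists>B. finite B \<and> complex_fun.span B = equivariant_functions \<phi> lam)"
proof
  assume "\<exists>B. finite B \<and> complex_fun.span B = equivariant_functions \<phi> lam"
  then obtain B where B: "finite B" "complex_fun.span B = equivariant_functions \<phi> lam"
    by blast
  define d where "d = \<phi> 1 - 1"
  have d: "0 < d" using phi_gt by (simp add: d_def)
  \<comment> \<open>the offset \<open>2\<close> keeps all points \<open>t i\<close> strictly below \<open>\<phi> 1\<close>\<close>
  define t where "t i = 1 + d / (real i + 2)" for i :: nat
  have t_less: "t i < t j" if "j < i" for i j
    using that d by (auto simp: t_def intro!: divide_strict_left_mono)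
  have t_bounds: "1 < t i" "t i < \<phi> 1" for i
  proof -
    show "1 < t i" using d by (simp add: t_def)
    have "d < d * (real i + 2)" using d mult_strict_left_mono[of 1 "real i + 2" d] by simp
    then have "d / (real i + 2) < d" by (simp add: pos_divide_less_eq)
    then show "t i < \<phi> 1" by (simp add: t_def d_def)
  qed
  have "\<exists>b. \<forall>i::nat. smooth_on UNIV (b i) \<and> (\<forall>x. b i x \<noteq> (0::real) \<longleftrightarrow> t (Suc i) < x \<and> x < t i)"
    by (rule choice) (metis smooth_bump_exists)
  then obtain b where b: "\<And>i. smooth_on UNIV (b i)"
      "\<And>i x. b i x \<noteq> (0::real) \<longleftrightarrow> t (Suc i) < x \<and> x < t i"
    by blast
  define \<beta> where "\<beta> i = equivariant_extension (b i)" for i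
  define p where "p i = (t (Suc i) + t i) / 2" for i
  have p: "t (Suc i) < p i" "p i < t i" for i
    using t_less[of i "Suc i"] by (simp_all add: p_def)
  have at_p: "\<beta> i (p j) \<noteq> 0 \<longleftrightarrow> i = j" for i j
  proof -
    have "\<beta> i (p j) = of_real (b i (p j))"
      unfolding \<beta>_def using p[of j] t_bounds[of j] t_bounds[of "Suc j"]
      by (intro equivariant_extension_eq) auto
    moreover have "b i (p j) \<noteq> 0 \<longleftrightarrow> i = j"
    proof (cases i j rule: linorder_cases)
      case less
      then have "t j \<le> t (Suc i)" using t_less[of "Suc i" j] by (cases "Suc i = j") auto
      then show ?thesis using less b(2)[of i "p j"] p[of j] by auto
    next
      case greater
      then have "t i \<le> t (Suc j)" using t_less[of "Suc j" i] by (cases "Suc j = i") auto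
      then show ?thesis using greater b(2)[of i "p j"] p[of j] by auto
    next
      case equal
      then show ?thesis using b(2)[of i "p j"] p[of j] by auto
    qed
    ultimately show ?thesis by simp
  qed
  have "inj \<beta>"
    using at_p by (intro injI) metis
  then have "infinite (range \<beta>)"
    using finite_imageD infinite_UNIV_nat by blast
  moreover have "range \<beta> \<subseteq> complex_fun.span B"
  proof
    fix f assume "f \<in> range \<beta>"
    then obtain i where i: "f = \<beta> i" by blast
    have "1 \<le> x \<and> x < t i" if "b i x \<noteq> 0" for x
      using that b(2)[of i x] t_bounds[of "Suc i"] by auto
    from equivariant_extension_mem[OF b(1) this t_bounds(2)]
    show "f \<in> complex_fun.span B" by (simp add: i \<beta>_def B(2))
  qed
  moreover have "complex_fun.independent (range \<beta>)"
    unfolding complex_fun.dependent_def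
  proof (intro notI, elim bexE)
    fix f assume "f \<in> range \<beta>" and f: "f \<in> complex_fun.span (range \<beta> - {f})"
    then obtain i where i: "f = \<beta> i" by blast
    have "complex_fun.span (range \<beta> - {f}) \<subseteq> {g. g (p i) = 0}"
    proof (rule complex_fun.span_minimal)
      show "range \<beta> - {f} \<subseteq> {g. g (p i) = 0}"
        using at_p i by auto
      show "complex_fun.subspace {g. g (p i) = 0}"
        by (rule complex_fun.subspaceI) auto
    qed
    then have "\<beta> i (p i) = 0" using f i by auto
    then show False using at_p by blast
  qed
  ultimately show False
    using complex_fun.independent_span_bound[OF B(1)] by blast
qed

end

section \<open>Lifting automorphisms to the universal cover\<close>

lemma connected_Htilde: "connected Htilde"
proof -
  have "connected (- {0 :: complex \<times> complex})"
    by (rule connected_punctured_universe) simp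
  then have "connected ((- {0 :: complex \<times> complex}) \<times> {0::real})"
    by (intro connected_Times) simp_all
  also have "(- {0 :: complex \<times> complex}) \<times> {0::real} = Htilde"
    by (auto simp: Htilde_def zero_prod_def)
  finally show ?thesis .
qed

text \<open>The removed point lies on the boundary, so no segment from the interior point \<open>(O, 1)\<close> meets it
  unless it ends there.\<close>

lemma starlike_Rtilde: "starlike Rtilde"
  unfolding starlike_def
proof (rule bexI[of _ "(0, 1)"], intro ballI subsetI)
  fix p r assume p: "p \<in> Rtilde" and r: "r \<in> closed_segment ((0::complex \<times> complex), 1::real) p"
  obtain z x where zx: "p = (z, x)" by (cases p)
  obtain u where u: "0 \<le> u" "u \<le> 1" "r = (1 - u) *\<^sub>R (0, 1) + u *\<^sub>R p"
    using r by (auto simp: closed_segment_def)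
  then have r: "r = (u *\<^sub>R z, (1 - u) + u * x)" by (simp add: zx)
  have x: "0 \<le> x" using p zx by (simp add: Rtilde_iff)
  show "r \<in> Rtilde"
  proof (cases "u = 1")
    case True
    then show ?thesis using p zx r by simp
  next
    case False
    then have "0 < (1 - u) + u * x" using u x by (intro add_pos_nonneg) auto
    then show ?thesis by (simp add: r Rtilde_iff)
  qed
qed (simp add: Rtilde_iff)

lemma simply_connected_Rtilde: "simply_connected Rtilde"
  by (rule starlike_imp_simply_connected[OF starlike_Rtilde])

lemma connected_Rtilde: "connected Rtilde"
  using simply_connected_imp_connected[OF simply_connected_Rtilde] .

lemma locally_path_connected_Rtilde: "locally path_connected Rtilde"
proof (rule locally_open_subset)
  show "locally path_connected (UNIV \<times> {0..} :: pt set)"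
    by (intro convex_imp_locally_path_connected convex_Times) auto
  have "openin (top_of_set (UNIV \<times> {0..})) (UNIV \<times> {0..} \<inter> - {((0, 0), 0)} :: pt set)"
    by (intro openin_open_Int) auto
  then show "openin (top_of_set (UNIV \<times> {0..})) Rtilde"
    by (simp add: Rtilde_def Diff_eq)
qed

context reeb
begin

text \<open>Nearby values of both maps lie in a common open set on which \<open>q\<close> is injective.\<close>

lemma lifts_agree_locally:
  fixes g1 g2 :: "'a::topological_space \<Rightarrow> pt"
  assumes c: "continuous_on S g1" "continuous_on S g2"
    and R: "\<And>s. s \<in> S \<Longrightarrow> g1 s \<in> Rtilde" "\<And>s. s \<in> S \<Longrightarrow> g2 s \<in> Rtilde"
    and qeq: "\<And>s. s \<in> S \<Longrightarrow> q (g1 s) = q (g2 s)" and p: "p \<in> S" "g1 p = g2 p"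
  shows "\<exists>A. open A \<and> p \<in> A \<and> (\<forall>s\<in>S \<inter> A. g1 s = g2 s)"
proof -
  obtain V where V: "is_chart q V" "g1 p \<in> V" using chart_exists[OF R(1)[OF p(1)]] by blast
  then obtain B where B: "open B" "V = Rtilde \<inter> B" and inj: "inj_on q V"
    by (auto simp: is_chart_def openin_open)
  obtain A1 where A1: "open A1" "A1 \<inter> S = g1 -` B \<inter> S"
    using c(1) B(1) unfolding continuous_on_open_invariant by blast
  obtain A2 where A2: "open A2" "A2 \<inter> S = g2 -` B \<inter> S"
    using c(2) B(1) unfolding continuous_on_open_invariant by blast
  have "g1 s = g2 s" if "s \<in> S \<inter> (A1 \<inter> A2)" for s
  proof (rule inj_onD[OF inj])
    show "q (g1 s) = q (g2 s)" using qeq that by simp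
    show "g1 s \<in> V" "g2 s \<in> V" using that A1(2) A2(2) R B(2) by blast+
  qed
  moreover have "p \<in> A1 \<inter> A2" using p A1(2) A2(2) V(2) B(2) by auto
  ultimately show ?thesis using A1(1) A2(1) by (intro exI[of _ "A1 \<inter> A2"]) auto
qed

lemma lifts_agree:
  fixes g1 g2 :: "'a::topological_space \<Rightarrow> pt"
  assumes c: "continuous_on S g1" "continuous_on S g2" and conn: "connected S"
    and R: "\<And>s. s \<in> S \<Longrightarrow> g1 s \<in> Rtilde" "\<And>s. s \<in> S \<Longrightarrow> g2 s \<in> Rtilde"
    and qeq: "\<And>s. s \<in> S \<Longrightarrow> q (g1 s) = q (g2 s)" and p: "p \<in> S" "g1 p = g2 p"
    and s: "s \<in> S"
  shows "g1 s = g2 s"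
proof -
  let ?T = "{s \<in> S. g1 s - g2 s = 0}"
  have "closedin (top_of_set S) ?T"
    by (intro continuous_closedin_preimage_constant continuous_on_diff c)
  moreover have "openin (top_of_set S) ?T"
  proof (subst openin_subopen, intro ballI)
    fix t assume "t \<in> ?T"
    then have t: "t \<in> S" "g1 t = g2 t" by auto
    obtain A where A: "open A" "t \<in> A" "\<forall>s\<in>S \<inter> A. g1 s = g2 s"
      using lifts_agree_locally[OF c R qeq t] by blast
    show "\<exists>U. openin (top_of_set S) U \<and> t \<in> U \<and> U \<subseteq> ?T"
      by (rule exI[of _ "S \<inter> A"]) (use A t in auto)
  qed
  ultimately have "?T = {} \<or> ?T = S"
    using conn unfolding connected_clopen by blast
  then have "?T = S" using p by auto
  then show ?thesis using s by auto
qed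

text \<open>Continuity is enough to make the lift unique; that it is smooth and leafwise holomorphic is a
  consequence of the corresponding properties of \<open>f\<close>.\<close>

definition is_cont_lift :: "(pt set \<Rightarrow> pt set) \<Rightarrow> (pt \<Rightarrow> pt) \<Rightarrow> bool" where
  "is_cont_lift f F \<longleftrightarrow> continuous_on Rtilde F \<and> (\<forall>p\<in>Rtilde. F p \<in> Rtilde) \<and>
     (\<forall>p\<in>Rtilde. q (F p) = f (q p)) \<and> (\<forall>p\<in>Htilde. F p = p)"

lemma is_cont_liftD:
  assumes "is_cont_lift f F"
  shows "continuous_on Rtilde F" "\<And>p. p \<in> Rtilde \<Longrightarrow> F p \<in> Rtilde"
    "\<And>p. p \<in> Rtilde \<Longrightarrow> q (F p) = f (q p)" "\<And>p. p \<in> Htilde \<Longrightarrow> F p = p"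
  using assms by (auto simp: is_cont_lift_def)

lemma base_point: "((1, 0), 0) \<in> Htilde" "((1, 0), 0) \<in> Rtilde"
  by (auto simp: Htilde_def Rtilde_def)

lemma cont_lift_unique:
  assumes F: "is_cont_lift f F" and G: "is_cont_lift f G" and "p \<in> Rtilde"
  shows "F p = G p"
  by (rule lifts_agree[where S = Rtilde and p = "((1, 0), 0)"])
    (use is_cont_liftD[OF F] is_cont_liftD[OF G] assms(3) base_point in \<open>simp_all add: connected_Rtilde\<close>)

lemma T_mem: "p \<in> Rtilde \<Longrightarrow> \<T> p \<in> Rtilde"
  and cont_T: "continuous_on Rtilde (\<T>)"
  and q_T: "p \<in> Rtilde \<Longrightarrow> q (\<T> p) = q p"
  using deck_mem[of p 1] q_deck[of p 1] cont_deck[of 1] deck_1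
  by (simp_all cong: continuous_on_cong)

lemma T_Htilde: "p \<in> Htilde \<Longrightarrow> \<T> p \<in> Htilde"
  by (cases p) (auto simp: Htilde_iff T_eq Rtilde_iff phi_0 dilate_eq_0 lam_nz)

lemma cont_lift_commutes:
  assumes F: "is_cont_lift f F" and "p \<in> Rtilde"
  shows "F (\<T> p) = \<T> (F p)"
proof (rule lifts_agree[where S = Rtilde and p = "((1, 0), 0)"
      and ?g1.0 = "\<lambda>p. F (\<T> p)" and ?g2.0 = "\<lambda>p. \<T> (F p)"])
  note F' = is_cont_liftD[OF F]
  show "continuous_on Rtilde (\<lambda>p. F (\<T> p))"
    by (rule continuous_on_compose2[OF F'(1) cont_T]) (auto simp: T_mem)
  show "continuous_on Rtilde (\<lambda>p. \<T> (F p))"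
    by (rule continuous_on_compose2[OF cont_T F'(1)]) (auto simp: F'(2))
  show "F (\<T> ((1, 0), 0)) = \<T> (F ((1, 0), 0))"
    using F'(4) T_Htilde base_point by simp
  fix s assume s: "s \<in> Rtilde"
  show "q (F (\<T> s)) = q (\<T> (F s))"
    using s by (simp add: F'(2,3) q_T T_mem)
  show "F (\<T> s) \<in> Rtilde" "\<T> (F s) \<in> Rtilde"
    using s F'(2) T_mem by auto
qed (use assms base_point in \<open>simp_all add: connected_Rtilde\<close>)

lemma local_lift:
  assumes f: "smooth_map q f" and p: "p \<in> Rtilde"
  shows "\<exists>U V h. openin (top_of_set Rtilde) U \<and> p \<in> U \<and> is_chart q V \<and> smooth_on U h \<and>
    (\<forall>u\<in>U. h u \<in> V) \<and> (\<forall>u\<in>U. q (h u) = f (q u))"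
proof -
  obtain U V where UV: "is_chart q U" "is_chart q V" "p \<in> U" "f ` q ` U \<subseteq> q ` V"
      "smooth_on U (\<lambda>u. inv_into V q (f (q u)))"
    using f[unfolded smooth_map_def, rule_format, OF p] by blast
  have im: "f (q u) \<in> q ` V" if "u \<in> U" for u using UV(4) that by blast
  have "openin (top_of_set Rtilde) U" using UV(1) by (simp add: is_chart_def)
  moreover have "\<forall>u\<in>U. inv_into V q (f (q u)) \<in> V"
    using inv_into_into[OF im] by blast
  moreover have "\<forall>u\<in>U. q (inv_into V q (f (q u))) = f (q u)"
    using f_inv_into_f[OF im] by blast
  ultimately show ?thesis
    using UV(2,3,5) by (intro exI[of _ U] exI[of _ V] exI[of _ "\<lambda>u. inv_into V q (f (q u))"]) simp
qed

lemma is_chart_subset: "is_chart q V \<Longrightarrow> V \<subseteq> Rtilde"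
  unfolding is_chart_def using openin_imp_subset by blast

text \<open>The pairs \<open>(p, p')\<close> with \<open>p'\<close> over \<open>f (q p)\<close> form a covering of the simply connected space
  \<^term>\<open>Rtilde\<close>: over the domain of a local lift it is the disjoint union of the graphs of the
  translates of this local lift. A lift is a section of this covering.\<close>

lemma covering_space_lift_graph:
  assumes f: "smooth_map q f"
  shows "covering_space {(p, p'). p \<in> Rtilde \<and> p' \<in> Rtilde \<and> q p' = f (q p)} fst Rtilde"
    (is "covering_space ?C fst Rtilde")
proof (rule covering_spaceI)
  show "continuous_on ?C fst" by (intro continuous_on_fst continuous_on_id)
  show "fst ` ?C = Rtilde"
  proof (intro equalityI subsetI)
    fix p assume p: "p \<in> Rtilde"
    obtain U V h where h: "p \<in> U" "is_chart q V" "\<forall>u\<in>U. h u \<in> V" "\<forall>u\<in>U. q (h u) = f (q u)"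
      using local_lift[OF f p] by blast
    then have "(p, h p) \<in> ?C" using p is_chart_subset by blast
    then show "p \<in> fst ` ?C" using image_eqI[of p fst "(p, h p)" ?C] by simp
  qed auto
  fix p assume p: "p \<in> Rtilde"
  obtain U V h where UV: "openin (top_of_set Rtilde) U" "p \<in> U" "is_chart q V" "smooth_on U h"
    and hV: "\<forall>u\<in>U. h u \<in> V" and hq: "\<forall>u\<in>U. q (h u) = f (q u)"
    using local_lift[OF f p] by blast
  have U: "U \<subseteq> Rtilde" using UV(1) by (rule openin_imp_subset)
  have V: "V \<subseteq> Rtilde" using UV(3) by (rule is_chart_subset)
  have hR: "h u \<in> Rtilde" if "u \<in> U" for u using bspec[OF hV that] V by blast
  have h: "continuous_on U h" using UV(4) by (rule smooth_on_imp_continuous_on)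
  define G where "G n = (\<lambda>u. (u, deck n (h u))) ` U" for n
  show "\<exists>T. p \<in> T \<and> openin (top_of_set Rtilde) T \<and>
      (\<exists>v. \<Union>v = ?C \<inter> fst -` T \<and> (\<forall>u\<in>v. openin (top_of_set ?C) u) \<and> pairwise disjnt v \<and>
         (\<forall>u\<in>v. \<exists>q. homeomorphism u T fst q))"
  proof (intro exI[of _ U] conjI exI[of _ "range G"])
    show "\<Union> (range G) = ?C \<inter> fst -` U"
    proof (intro equalityI subsetI)
      fix c assume "c \<in> \<Union> (range G)"
      then obtain n u where "u \<in> U" "c = (u, deck n (h u))" by (auto simp: G_def)
      then show "c \<in> ?C \<inter> fst -` U"
        using U hR hq q_deck deck_mem by auto
    next
      fix c assume "c \<in> ?C \<inter> fst -` U"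
      then obtain u p' where c: "c = (u, p')" "u \<in> U" "p' \<in> Rtilde" "q p' = f (q u)" by auto
      then have "q (h u) = q p'" using hq by simp
      then obtain n where "p' = deck n (h u)" using q_eq_iff[OF hR[OF c(2)] c(3)] by blast
      then have "c \<in> G n" using c by (simp add: G_def)
      then show "c \<in> \<Union> (range G)" by blast
    qed
    show "\<forall>u\<in>range G. openin (top_of_set ?C) u"
    proof clarify
      fix n
      obtain A where A: "open A" "U = Rtilde \<inter> A" using UV(1) by (auto simp: openin_open)
      obtain B where B: "open B" "V = Rtilde \<inter> B" using UV(3) by (auto simp: is_chart_def openin_open)
      have c: "continuous_on ?C (\<lambda>c. deck (- n) (snd c))"
        by (rule continuous_on_compose2[OF cont_deck]) (auto intro: continuous_on_snd)
      have "G n = (?C \<inter> fst -` A) \<inter> (?C \<inter> (\<lambda>c. deck (- n) (snd c)) -` B)"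
      proof (intro equalityI subsetI)
        fix c assume "c \<in> G n"
        then obtain u where u: "u \<in> U" "c = (u, deck n (h u))" by (auto simp: G_def)
        then have "c \<in> ?C" using U hR hq q_deck deck_mem by auto
        moreover have "deck (- n) (snd c) \<in> B"
          using u bspec[OF hV u(1)] B(2) deck_minus(1)[OF hR[OF u(1)]] by simp
        ultimately show "c \<in> (?C \<inter> fst -` A) \<inter> (?C \<inter> (\<lambda>c. deck (- n) (snd c)) -` B)"
          using u A(2) by auto
      next
        fix c assume c: "c \<in> (?C \<inter> fst -` A) \<inter> (?C \<inter> (\<lambda>c. deck (- n) (snd c)) -` B)"
        then obtain u p' where c': "c = (u, p')" "u \<in> Rtilde" "p' \<in> Rtilde" "q p' = f (q u)" by auto
        have u: "u \<in> U" using c c' A(2) by auto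
        have "deck (- n) p' \<in> V" using c c' B(2) deck_mem by auto
        moreover have "q (deck (- n) p') = q (h u)" using c' bspec[OF hq u] q_deck by simp
        ultimately have "deck (- n) p' = h u"
          using UV(3) bspec[OF hV u] by (auto simp: is_chart_def dest: inj_onD)
        then have "p' = deck n (h u)" using deck_minus(2)[OF c'(3), of n] by simp
        then show "c \<in> G n" using u c' by (simp add: G_def)
      qed
      moreover have "openin (top_of_set ?C) \<dots>"
        by (intro openin_Int continuous_openin_preimage_gen c A(1) B(1) continuous_on_fst continuous_on_id)
      ultimately show "openin (top_of_set ?C) (G n)" by simp
    qed
    show "pairwise disjnt (range G)"
    proof (rule pairwiseI)
      fix X Y assume "X \<in> range G" "Y \<in> range G" "X \<noteq> Y"
      then obtain n m where nm: "X = G n" "Y = G m" "n \<noteq> m" by blast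
      have False if c: "c \<in> G n" "c \<in> G m" for c
      proof -
        obtain u where u: "u \<in> U" "deck n (h u) = deck m (h u)"
          using c by (auto simp: G_def)
        have "deck (- m + n) (h u) = h u"
          using deck_add[OF hR[OF u(1)], of "- m" n] u(2) deck_minus(1)[OF hR[OF u(1)], of m] by simp
        then have "- m + n = 0" by (rule deck_free[OF hR[OF u(1)]])
        then show False using nm(3) by simp
      qed
      then show "disjnt X Y" using nm by (auto simp: disjnt_def)
    qed
    show "\<forall>u\<in>range G. \<exists>q. homeomorphism u U fst q"
    proof clarify
      fix n
      have "continuous_on U (\<lambda>u. (u, deck n (h u)))"
        by (intro continuous_on_Pair continuous_on_id continuous_on_compose2[OF cont_deck h])
          (auto simp: hR)
      then have "homeomorphism (G n) U fst (\<lambda>u. (u, deck n (h u)))"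
        by (intro homeomorphismI continuous_on_fst continuous_on_id) (auto simp: G_def)
      then show "\<exists>q. homeomorphism (G n) U fst q" by blast
    qed
  qed (use UV in auto)
qed

text \<open>Two lifts differ by a deck transformation, which is chosen so that a point of the boundary leaf is
  fixed. Then the whole boundary leaf is fixed, as it is connected.\<close>

lemma cont_lift_exists:
  assumes f: "smooth_map q f" and H: "\<forall>h\<in>Hopf lam \<phi>. f h = h"
  shows "\<exists>F. is_cont_lift f F"
proof -
  let ?C = "{(p, p'). p \<in> Rtilde \<and> p' \<in> Rtilde \<and> q p' = f (q p)}"
  have id_R: "(\<lambda>p. p) \<in> Rtilde \<rightarrow> Rtilde" by simp
  obtain g where g: "continuous_on Rtilde g" "g \<in> Rtilde \<rightarrow> ?C" "\<And>y. y \<in> Rtilde \<Longrightarrow> fst (g y) = y"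
  proof (rule covering_space_lift[OF covering_space_lift_graph[OF f] simply_connected_Rtilde
      locally_path_connected_Rtilde continuous_on_id id_R])
    fix g assume g: "continuous_on Rtilde g" "g \<in> Rtilde \<rightarrow> ?C" "\<And>y. y \<in> Rtilde \<Longrightarrow> fst (g y) = y"
    show thesis by (rule that[OF g])
  qed
  define F0 where "F0 p = snd (g p)" for p
  have F0: "F0 p \<in> Rtilde" "q (F0 p) = f (q p)" if "p \<in> Rtilde" for p
  proof -
    have "g p = (p, F0 p)"
      using prod.collapse[of "g p", symmetric] unfolding F0_def g(3)[OF that] .
    then have "(p, F0 p) \<in> ?C"
      using funcset_mem[OF g(2) that] by (simp only:)
    then show "F0 p \<in> Rtilde" "q (F0 p) = f (q p)" by simp_all
  qed
  have contF0: "continuous_on Rtilde F0"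
    unfolding F0_def by (rule continuous_on_snd[OF g(1)])
  have fH: "f (q p) = q p" if "p \<in> Htilde" for p
    using H that by (simp add: Hopf_def)
  obtain n where n: "((1, 0), 0) = deck n (F0 ((1, 0), 0))"
    using q_eq_iff[OF F0(1)[OF base_point(2)] base_point(2)] F0(2)[OF base_point(2)] fH[OF base_point(1)]
    by auto
  define F where "F p = deck n (F0 p)" for p
  have contF: "continuous_on Rtilde F"
    unfolding F_def by (rule continuous_on_compose2[OF cont_deck contF0]) (auto simp: F0)
  have F: "F p \<in> Rtilde" "q (F p) = f (q p)" if "p \<in> Rtilde" for p
    using F0[OF that] by (simp_all add: F_def deck_mem q_deck)
  have "F p = p" if "p \<in> Htilde" for p
  proof (rule lifts_agree[where S = Htilde and p = "((1, 0), 0)"])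
    show "continuous_on Htilde F" by (rule continuous_on_subset[OF contF Htilde_subset])
    show "q (F s) = q s" if "s \<in> Htilde" for s
      using F(2)[of s] fH[OF that] that Htilde_subset by auto
    show "F ((1, 0), 0) = ((1, 0), 0)" using n by (simp add: F_def)
  qed (use that F Htilde_subset connected_Htilde base_point in auto)
  then have "is_cont_lift f F" using contF F by (simp add: is_cont_lift_def)
  then show ?thesis by blast
qed

text \<open>Near each point the lift is a deck translate of a representative of \<open>f\<close> in charts.\<close>

lemma cont_lift_smooth:
  assumes f: "smooth_map q f" and F: "is_cont_lift f F"
  shows "smooth_on Rtilde F"
proof (rule smooth_on_local)
  note F' = is_cont_liftD[OF F]
  fix p assume p: "p \<in> Rtilde"
  obtain U V h where UV: "openin (top_of_set Rtilde) U" "p \<in> U" "is_chart q V" "smooth_on U h"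
    and hV: "\<forall>u\<in>U. h u \<in> V" and hq: "\<forall>u\<in>U. q (h u) = f (q u)"
    using local_lift[OF f p] by blast
  obtain A where A: "open A" "U = Rtilde \<inter> A" using UV(1) by (auto simp: openin_open)
  have hR: "h u \<in> Rtilde" if "u \<in> U" for u using bspec[OF hV that] is_chart_subset[OF UV(3)] by blast
  have "q (h p) = q (F p)" using UV(2) hq F'(3)[OF p] by simp
  then obtain n where n: "F p = deck n (h p)"
    using q_eq_iff[OF hR[OF UV(2)] F'(2)[OF p]] by blast
  have s: "smooth_on U (\<lambda>u. deck n (h u))"
    by (rule smooth_on_compose[OF UV(4) smooth_deck]) (auto simp: hR)
  have "\<exists>B. open B \<and> p \<in> B \<and> (\<forall>u\<in>U \<inter> B. F u = deck n (h u))"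
  proof (rule lifts_agree_locally)
    show "continuous_on U F" using continuous_on_subset[OF F'(1)] A(2) by simp
    show "continuous_on U (\<lambda>u. deck n (h u))" using s by (rule smooth_on_imp_continuous_on)
  qed (use UV(2) n F'(2,3) A(2) hR deck_mem q_deck hq in auto)
  then obtain B where B: "open B" "p \<in> B" "\<forall>u\<in>U \<inter> B. F u = deck n (h u)" by blast
  have "smooth_on (Rtilde \<inter> (A \<inter> B)) F"
    by (rule smooth_on_cong[OF smooth_on_subset[OF s]]) (use B(3) A(2) in auto)
  then show "\<exists>V. open V \<and> p \<in> V \<and> smooth_on (Rtilde \<inter> V) F"
    using A B UV(2) by (intro exI[of _ "A \<inter> B"]) auto
qed

text \<open>The same comparison within a leaf, where a representative of \<open>f\<close> has values in a single leaf.\<close>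

lemma cont_lift_leafwise:
  assumes F: "is_cont_lift f F"
    and f: "\<And>L. L \<in> leaves q \<Longrightarrow> \<exists>L'. leaf_holomorphic q L L' f" and zx: "(z, x) \<in> Rtilde"
  shows "\<exists>W h y. open W \<and> z \<in> W \<and> holomorphic2_on W h \<and> (\<forall>w\<in>W. F (w, x) = (h w, y))"
proof -
  note F' = is_cont_liftD[OF F]
  obtain L where L: "L \<in> leaves q" "q (z, x) \<in> L"
  proof (cases "0 < x")
    case True
    then show ?thesis by (intro that[of "q ` (UNIV \<times> {x})"]) (auto simp: leaves_def)
  next
    case False
    then have "(z, x) \<in> Htilde" using zx by (auto simp: Htilde_iff Rtilde_iff)
    then show ?thesis by (intro that[of "q ` Htilde"]) (auto simp: leaves_def)
  qed
  obtain L' where hol: "leaf_holomorphic q L L' f" using f[OF L(1)] by blast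
  obtain W W' x' where W: "is_leaf_chart q L W x" "is_leaf_chart q L' W' x'" "z \<in> W"
      "f ` q ` (W \<times> {x}) \<subseteq> q ` (W' \<times> {x'})"
      "holomorphic2_on W (\<lambda>w. fst (inv_into (W' \<times> {x'}) q (f (q (w, x)))))"
    using hol[unfolded leaf_holomorphic_def, rule_format, OF conjI[OF zx L(2)]] by blast
  define h where "h w = fst (inv_into (W' \<times> {x'}) q (f (q (w, x))))" for w
  have WR: "open W" "W \<times> {x} \<subseteq> Rtilde" "W' \<times> {x'} \<subseteq> Rtilde"
    using W(1,2) by (auto simp: is_leaf_chart_def)
  have wR: "(w, x) \<in> Rtilde" if "w \<in> W" for w using WR(2) that by blast
  have h: "(h w, x') \<in> Rtilde" "q (h w, x') = f (q (w, x))" if w: "w \<in> W" for w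
  proof -
    have im: "f (q (w, x)) \<in> q ` (W' \<times> {x'})" using W(4) w by blast
    have mem: "inv_into (W' \<times> {x'}) q (f (q (w, x))) \<in> W' \<times> {x'}" by (rule inv_into_into[OF im])
    then obtain v where v: "inv_into (W' \<times> {x'}) q (f (q (w, x))) = (v, x')" "v \<in> W'"
      by blast
    then have e: "inv_into (W' \<times> {x'}) q (f (q (w, x))) = (h w, x')" "h w \<in> W'"
      by (simp_all only: h_def fst_conv)
    show "(h w, x') \<in> Rtilde" using e(2) WR(3) by blast
    show "q (h w, x') = f (q (w, x))" using f_inv_into_f[OF im] e(1) by simp
  qed
  have holo: "holomorphic2_on W h" using W(5) by (simp only: h_def[abs_def])
  then have conth: "continuous_on W h"
    unfolding holomorphic2_on_def
    by (meson continuous_at_imp_continuous_on has_derivative_continuous)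
  have "q (h z, x') = q (F (z, x))" using h(2)[OF W(3)] F'(3)[OF zx] by simp
  then obtain n where n: "F (z, x) = deck n (h z, x')"
    using q_eq_iff[OF h(1)[OF W(3)] F'(2)[OF zx]] by blast
  have "\<exists>B. open B \<and> z \<in> B \<and> (\<forall>w\<in>W \<inter> B. F (w, x) = deck n (h w, x'))"
  proof (rule lifts_agree_locally)
    show "continuous_on W (\<lambda>w. F (w, x))"
      by (rule continuous_on_compose2[OF F'(1)])
        (use wR in \<open>auto intro!: continuous_on_Pair continuous_on_id continuous_on_const\<close>)
    show "continuous_on W (\<lambda>w. deck n (h w, x'))"
      by (rule continuous_on_compose2[OF cont_deck])
        (use h(1) in \<open>auto intro!: continuous_on_Pair conth continuous_on_const\<close>)
  qed (use W(3) n F'(2,3) wR h deck_mem q_deck in auto)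
  then obtain B where B: "open B" "z \<in> B" "\<forall>w\<in>W \<inter> B. F (w, x) = deck n (h w, x')" by blast
  have "holomorphic2_on (W \<inter> B) (\<lambda>w. dilate (lam powi n) (h w))"
    unfolding holomorphic2_on_def
  proof
    fix w assume "w \<in> W \<inter> B"
    then obtain D where D: "(h has_derivative D) (at w)"
        "\<And>c a b. D (c * a, c * b) = (c * fst (D (a, b)), c * snd (D (a, b)))"
      using holo unfolding holomorphic2_on_def by blast
    have "((\<lambda>w. dilate (lam powi n) (h w)) has_derivative (\<lambda>v. dilate (lam powi n) (D v))) (at w)"
      by (rule bounded_linear.has_derivative[OF bounded_linear_dilate D(1)])
    moreover have "dilate (lam powi n) (D (c * a, c * b)) =
        (c * fst (dilate (lam powi n) (D (a, b))), c * snd (dilate (lam powi n) (D (a, b))))" for c a b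
      by (simp add: D(2) dilate_def)
    ultimately show "\<exists>D. ((\<lambda>w. dilate (lam powi n) (h w)) has_derivative D) (at w) \<and>
        (\<forall>c a b. D (c * a, c * b) = (c * fst (D (a, b)), c * snd (D (a, b))))"
      by blast
  qed
  moreover have "\<forall>w\<in>W \<inter> B. F (w, x) = (dilate (lam powi n) (h w), iter n x')"
    using B(3) h(1) by (auto simp: deck_eq)
  ultimately show ?thesis
    using WR(1) B(1,2) W(3) by (intro exI[of _ "W \<inter> B"]) auto
qed

end

section \<open>Rigidity of equivariant families of entire functions\<close>

text \<open>The maximum principle bounds \<open>f\<close> on the unit disc, which contains the disc of radius \<open>1 / 2\<close>
  about \<open>s\<close>; then Cauchy's inequality applies.\<close>

lemma cmod_deriv_le:
  fixes f :: "complex \<Rightarrow> complex"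
  assumes f: "f holomorphic_on UNIV" and B: "\<And>t. cmod t = 1 \<Longrightarrow> cmod (f t) \<le> B"
    and s: "cmod s \<le> 1 / 2"
  shows "cmod (deriv f s) \<le> 2 * B"
proof -
  have cont: "continuous_on S f" for S
    using holomorphic_on_imp_continuous_on[OF f] continuous_on_subset by blast
  have hol: "f holomorphic_on S" for S
    using f holomorphic_on_subset by blast
  have disc: "cmod (f t) \<le> B" if "cmod t \<le> 1" for t
  proof (rule maximum_modulus_frontier[where S = "cball 0 1" and f = f])
    show "cmod (f z) \<le> B" if "z \<in> frontier (cball 0 1)" for z
      using B[of z] that by (simp add: frontier_cball)
  qed (use that hol cont in auto)
  have "cmod ((deriv ^^ 1) f s) \<le> fact 1 * B / (1 / 2) ^ 1"
  proof (rule Cauchy_inequality[OF hol cont])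
    fix x assume "cmod (s - x) = 1 / 2"
    then have "cmod x \<le> 1"
      using norm_triangle_sub[of x s] s by (simp add: norm_minus_commute)
    then show "cmod (f x) \<le> B" by (rule disc)
  qed simp
  then show ?thesis by simp
qed

context reeb
begin

text \<open>The derivative \<open>h' x\<close> of an equivariant family satisfies \<open>h' x t = h' x\<^sub>n (t / \<lambda>\<^sup>n)\<close>, where
  \<open>x\<^sub>n = \<phi>\<^sup>-\<^sup>n x\<close> tends to \<open>0\<close>. A family that tends to \<open>0\<close> on the unit circle is thus independent
  of \<open>t\<close>, by Cauchy's estimate on the unit disc.\<close>

lemma equivariant_entire_constant:
  fixes h :: "real \<Rightarrow> complex \<Rightarrow> complex"
  assumes hol: "\<And>x. 0 < x \<Longrightarrow> h x holomorphic_on UNIV"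
    and eq: "\<And>x t. 0 < x \<Longrightarrow> h (\<phi> x) (lam * t) = lam * h x t"
    and small: "\<And>e. 0 < e \<Longrightarrow> \<exists>\<delta>>0. \<forall>x t. 0 < x \<longrightarrow> x < \<delta> \<longrightarrow> cmod t = 1 \<longrightarrow> cmod (h x t) \<le> e"
    and x: "0 < x"
  shows "h x t = h x 0"
proof -
  have iterate: "h (iter (int n) y) (lam ^ n * s) = lam ^ n * h y s" if y: "0 < y" for n y s
  proof (induction n)
    case 0
    then show ?case using y by (simp add: iter_0)
  next
    case (Suc n)
    have "iter (int (Suc n)) y = \<phi> (iter (int n) y)"
      using iter_Suc[of y "int n"] y by (simp add: add.commute)
    then show ?case
      using eq[OF iter_pos[OF y], of "int n" "lam ^ n * s"] Suc by (simp add: mult.assoc)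
  qed
  have "(h x has_field_derivative 0) (at s)" for s
  proof -
    have zero: "deriv (h x) s = 0"
    proof (rule ccontr)
      assume nz: "deriv (h x) s \<noteq> 0"
      define e where "e = cmod (deriv (h x) s) / 4"
      have "0 < e" using nz by (simp add: e_def)
      then obtain \<delta> where \<delta>: "0 < \<delta>" "\<And>x t. 0 < x \<Longrightarrow> x < \<delta> \<Longrightarrow> cmod t = 1 \<Longrightarrow> cmod (h x t) \<le> e"
        using small by blast
      have "eventually (\<lambda>n. iter (- int n) x < \<delta>) sequentially"
        using order_tendstoD(2)[OF iter_tendsto_0[OF x] \<delta>(1)] .
      moreover have "eventually (\<lambda>n. cmod (s / lam ^ n) < 1 / 2) sequentially"
      proof -
        have "(\<lambda>n. s * (1 / lam) ^ n) \<longlonglongrightarrow> s * 0"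
          using lam lam_nz
          by (intro tendsto_intros LIMSEQ_power_zero) (simp add: norm_divide divide_less_eq_1)
        then have "(\<lambda>n. s / lam ^ n) \<longlonglongrightarrow> 0"
          by (simp add: power_one_over)
        from tendstoD[OF this, of "1 / 2"] show ?thesis by simp
      qed
      ultimately have "eventually (\<lambda>n. iter (- int n) x < \<delta> \<and> cmod (s / lam ^ n) < 1 / 2) sequentially"
        by (rule eventually_conj)
      then obtain n where n: "iter (- int n) x < \<delta>" "cmod (s / lam ^ n) < 1 / 2"
        unfolding eventually_sequentially by blast
      define y where "y = iter (- int n) x"
      have y: "0 < y" "y < \<delta>" using n(1) iter_pos[OF x] by (simp_all add: y_def)
      have xy: "iter (int n) y = x" using iter_minus(2)[of x "int n"] x by (simp add: y_def)
      have heq: "h x = (\<lambda>t. lam ^ n * h y (t / lam ^ n))"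
      proof
        fix t
        show "h x t = lam ^ n * h y (t / lam ^ n)"
          using iterate[OF y(1), of n "t / lam ^ n"] xy lam_nz by simp
      qed
      have dy: "(h y has_field_derivative deriv (h y) (s / lam ^ n)) (at (s / lam ^ n))"
        by (rule holomorphic_derivI[OF hol[OF y(1)]]) auto
      have "((\<lambda>t. h y (t / lam ^ n)) has_field_derivative deriv (h y) (s / lam ^ n) * (1 / lam ^ n)) (at s)"
        by (rule DERIV_chain2[where f = "h y" and g = "\<lambda>t. t / lam ^ n"])
          (rule dy, rule DERIV_cdivide[OF DERIV_ident])
      from DERIV_cmult[OF this, of "lam ^ n"]
      have "(h x has_field_derivative deriv (h y) (s / lam ^ n)) (at s)"
        unfolding heq using lam_nz by simp
      then have "deriv (h x) s = deriv (h y) (s / lam ^ n)"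
        by (rule DERIV_imp_deriv)
      moreover have "cmod (deriv (h y) (s / lam ^ n)) \<le> 2 * e"
      proof (rule cmod_deriv_le[OF hol[OF y(1)]])
        show "cmod (h y t) \<le> e" if "cmod t = 1" for t using \<delta>(2)[OF y that] .
      qed (use n(2) in simp)
      ultimately show False using \<open>0 < e\<close> by (simp add: e_def)
    qed
    show ?thesis
      using holomorphic_derivI[OF hol[OF x], of s] unfolding zero by simp
  qed
  then have "\<exists>c. \<forall>s\<in>UNIV. h x s = c"
    by (intro has_field_derivative_zero_constant) auto
  then show ?thesis by auto
qed

text \<open>A lift moves each leaf by a translation. Restrict the displacement \<open>\<xi>(z, x) - z\<close> to complex
  lines through the origin: it vanishes for \<open>x = 0\<close>, so that it is small on the unit circle for small
  \<open>x\<close>, and its equivariance makes it constant along each line.\<close>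

lemma cont_lift_affine:
  assumes F: "is_cont_lift f F"
    and f: "\<And>L. L \<in> leaves q \<Longrightarrow> \<exists>L'. leaf_holomorphic q L L' f"
    and x: "0 < x"
  shows "F (z, x) = (z + fst (F (0, x)), snd (F (0, x)))"
proof -
  note F' = is_cont_liftD[OF F]
  have R: "(z, x) \<in> Rtilde" if "0 < x" for z x using that by (simp add: Rtilde_iff)
  have loc: "\<exists>W h y. open W \<and> z \<in> W \<and> holomorphic2_on W h \<and> (\<forall>w\<in>W. F (w, x) = (h w, y))"
    if "0 < x" for z x
    by (rule cont_lift_leafwise[OF F f R[OF that]])
  \<comment> \<open>the transverse coordinate is locally constant on the leaf\<close>
  have snd: "snd (F (z, x)) = snd (F (0, x))"
  proof (rule connected_local_const[where A = UNIV and f = "\<lambda>z. snd (F (z, x))"])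
    show "\<forall>a\<in>UNIV. eventually (\<lambda>b. snd (F (a, x)) = snd (F (b, x))) (at a within UNIV)"
    proof
      fix a
      obtain W h y where W: "open W" "a \<in> W" "\<forall>w\<in>W. F (w, x) = (h w, y)"
        using loc[OF x, of a] by blast
      show "eventually (\<lambda>b. snd (F (a, x)) = snd (F (b, x))) (at a within UNIV)"
        unfolding eventually_at_topological
        using W by (intro exI[of _ W]) simp
    qed
  qed auto
  define D where "D z x = fst (F (z, x)) - z" for z x
  have line: "\<pi> (D v x) = \<pi> (D 0 x)"
    if v: "v \<noteq> 0" and \<pi>: "bounded_linear \<pi>" "\<And>c z. \<pi> (dilate c z) = c * \<pi> z" for v and \<pi> :: "complex \<times> complex \<Rightarrow> complex"
  proof -
    define h where "h x t = \<pi> (D (dilate t v) x)" for x t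
    have "h x 1 = h x 0"
    proof (rule equivariant_entire_constant[OF _ _ _ x])
      fix x :: real assume x: "0 < x"
      show "h x holomorphic_on UNIV"
      proof (rule holomorphic_on_open[THEN iffD2], simp, intro ballI)
        fix t :: complex
        obtain W g y where W: "open W" "dilate t v \<in> W" "holomorphic2_on W g"
            "\<forall>w\<in>W. F (w, x) = (g w, y)"
          using loc[OF x, of "dilate t v"] by blast
        obtain E where E: "(g has_derivative E) (at (dilate t v))"
            "\<And>c a b. E (c * a, c * b) = (c * fst (E (a, b)), c * snd (E (a, b)))"
          using W(2,3) unfolding holomorphic2_on_def by blast
        have Ed: "E (dilate c z) = dilate c (E z)" for c z
          using E(2)[of c "fst z" "snd z"] by (simp add: dilate_def)
        have dil: "bounded_linear (\<lambda>t. dilate t v)"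
          unfolding dilate_def
          by (intro bounded_linear_Pair bounded_linear_mult_left)
        have d1: "((\<lambda>w. fst (F (w, x))) has_derivative E) (at (dilate t v))"
          by (rule has_derivative_transform_within_open[OF E(1) W(1,2)]) (use W(4) in simp)
        have "((\<lambda>t. D (dilate t v) x) has_derivative (\<lambda>s. E (dilate s v) - dilate s v)) (at t)"
          unfolding D_def
          by (intro has_derivative_diff bounded_linear_imp_has_derivative[OF dil]
              has_derivative_compose[OF bounded_linear_imp_has_derivative[OF dil] d1])
        from bounded_linear.has_derivative[OF \<pi>(1) this]
        have "(h x has_derivative (\<lambda>s. \<pi> (E (dilate s v) - dilate s v))) (at t)"
          unfolding h_def[abs_def] .
        moreover have "\<pi> (E (dilate s v) - dilate s v) = (\<pi> (E v) - \<pi> v) * s" for s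
          unfolding Ed linear_diff[OF bounded_linear.linear[OF \<pi>(1)]] \<pi>(2)
          by (simp add: algebra_simps)
        ultimately have "(h x has_field_derivative (\<pi> (E v) - \<pi> v)) (at t)"
          by (simp add: has_field_derivative_def)
        then show "\<exists>f'. (h x has_field_derivative f') (at t)" by blast
      qed
    next
      fix x :: real and t :: complex assume x: "0 < x"
      have T: "\<T> (dilate t v, x) = (dilate (lam * t) v, \<phi> x)"
        using R[OF x] by (simp add: T_eq)
      obtain w y where wy: "F (dilate t v, x) = (w, y)" by (cases "F (dilate t v, x)")
      have "F (dilate (lam * t) v, \<phi> x) = (dilate lam w, \<phi> y)"
        using cont_lift_commutes[OF F R[OF x], of "dilate t v"] F'(2)[OF R[OF x], of "dilate t v"]
        by (simp only: T wy T_eq)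
      then have "D (dilate (lam * t) v) (\<phi> x) = dilate lam (D (dilate t v) x)"
        using wy by (simp add: D_def dilate_def algebra_simps)
      then show "h (\<phi> x) (lam * t) = lam * h x t"
        by (simp only: h_def \<pi>(2))
    next
      fix e :: real assume e: "0 < e"
      let ?K = "sphere (0::complex) 1 \<times> {0..1::real}"
      have KR: "(dilate t v, x) \<in> Rtilde" if "(t, x) \<in> ?K" for t x
      proof -
        have "t \<noteq> 0" using that by auto
        then show ?thesis using that v by (simp add: Rtilde_iff dilate_eq_0)
      qed
      have dil: "continuous_on ?K (\<lambda>k. dilate (fst k) v)"
        unfolding dilate_def by (intro continuous_intros)
      have "continuous_on ?K (\<lambda>k. F (dilate (fst k) v, snd k))"
        by (rule continuous_on_compose2[OF F'(1)]) (use KR in \<open>auto intro!: continuous_on_Pair dil continuous_on_snd\<close>)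
      then have "continuous_on ?K (\<lambda>k. h (snd k) (fst k))"
        unfolding h_def D_def
        by (intro bounded_linear.continuous_on[OF \<pi>(1)] continuous_on_diff continuous_on_fst dil)
      moreover have "compact ?K" by (intro compact_Times) auto
      ultimately have "uniformly_continuous_on ?K (\<lambda>k. h (snd k) (fst k))"
        by (rule compact_uniformly_continuous)
      then obtain \<delta> where \<delta>: "0 < \<delta>"
          "\<And>k k'. k \<in> ?K \<Longrightarrow> k' \<in> ?K \<Longrightarrow> dist k' k < \<delta> \<Longrightarrow> dist (h (snd k') (fst k')) (h (snd k) (fst k)) < e"
        using e unfolding uniformly_continuous_on_def by blast
      have "cmod (h x t) \<le> e" if x: "0 < x" "x < min \<delta> 1" and t: "cmod t = 1" for x t
      proof -
        have "t \<noteq> 0" using t by auto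
        then have "(dilate t v, 0) \<in> Htilde"
          using \<open>t \<noteq> 0\<close> v by (simp add: Htilde_iff dilate_eq_0)
        then have "D (dilate t v) 0 = 0" using F'(4) by (simp add: D_def)
        then have "h 0 t = 0"
          using linear_0[OF bounded_linear.linear[OF \<pi>(1)]] by (simp add: h_def)
        moreover have "dist (t, x) (t, 0) < \<delta>" "(t, x) \<in> ?K" "(t, 0) \<in> ?K"
          using x t by (auto simp: dist_Pair_Pair)
        then have "dist (h x t) (h 0 t) < e"
          using \<delta>(2)[of "(t, 0)" "(t, x)"] by simp
        ultimately show ?thesis by simp
      qed
      then show "\<exists>\<delta>>0. \<forall>x t. 0 < x \<longrightarrow> x < \<delta> \<longrightarrow> cmod t = 1 \<longrightarrow> cmod (h x t) \<le> e"
        using \<delta>(1) by (intro exI[of _ "min \<delta> 1"]) auto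
    qed
    then show ?thesis by (simp add: h_def dilate_def zero_prod_def)
  qed
  have "D z x = D 0 x"
  proof (cases "z = 0")
    case False
    have "fst (D z x) = fst (D 0 x)"
      by (rule line[OF False bounded_linear_fst]) simp
    moreover have "snd (D z x) = snd (D 0 x)"
      by (rule line[OF False bounded_linear_snd]) simp
    ultimately show ?thesis by (rule prod_eqI)
  qed simp
  then have "fst (F (z, x)) = z + fst (F (0, x))"
    by (simp add: D_def algebra_simps)
  then show ?thesis using snd by (metis prod.collapse)
qed

definition affine_map :: "(real \<Rightarrow> complex \<times> complex) \<Rightarrow> (real \<Rightarrow> real) \<Rightarrow> pt \<Rightarrow> pt" where
  "affine_map \<beta> \<eta> p = (fst p + \<beta> (snd p), \<eta> (snd p))"

text \<open>The components of an affine map are read off at \<open>z = (1, 0)\<close>, since at the origin the lift is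
  undefined for \<open>x = 0\<close>.\<close>

definition translation_part :: "(pt \<Rightarrow> pt) \<Rightarrow> real \<Rightarrow> complex \<times> complex" where
  "translation_part F x = (if 0 \<le> x then fst (F ((1, 0), x)) - (1, 0) else 0)"

definition transverse_part :: "(pt \<Rightarrow> pt) \<Rightarrow> real \<Rightarrow> real" where
  "transverse_part F = (\<lambda>x\<in>{0..}. snd (F ((1, 0), x)))"

lemma cont_lift_structure:
  assumes F: "is_cont_lift f F" and f: "smooth_map q f"
    and leaf: "\<And>L. L \<in> leaves q \<Longrightarrow> \<exists>L'. leaf_holomorphic q L L' f"
  defines "\<beta> \<equiv> translation_part F" and "\<eta> \<equiv> transverse_part F"
  shows "p \<in> Rtilde \<Longrightarrow> F p = affine_map \<beta> \<eta> p"
    and "smooth_on {0..} \<beta>" and "smooth_on {0..} \<eta>"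
    and "0 \<le> x \<Longrightarrow> \<beta> (\<phi> x) = dilate lam (\<beta> x)" and "x < 0 \<Longrightarrow> \<beta> x = 0"
    and "0 \<le> x \<Longrightarrow> 0 \<le> \<eta> x" and "0 \<le> x \<Longrightarrow> \<eta> (\<phi> x) = \<phi> (\<eta> x)"
proof -
  note F' = is_cont_liftD[OF F]
  have R: "((1, 0), x) \<in> Rtilde" if "0 \<le> x" for x
    using that by (simp add: Rtilde_iff zero_prod_def)
  have aff: "F p = affine_map \<beta> \<eta> p" if "p \<in> Rtilde" for p
  proof (cases p)
    case (Pair z x)
    show ?thesis
    proof (cases "0 < x")
      case True
      show ?thesis
        using cont_lift_affine[OF F leaf True, of z] cont_lift_affine[OF F leaf True, of "(1, 0)"] True
        by (simp add: Pair affine_map_def \<beta>_def \<eta>_def translation_part_def transverse_part_def)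
    next
      case False
      then have "(z, x) \<in> Htilde" "x = 0" using that Pair by (auto simp: Htilde_iff Rtilde_iff)
      then show ?thesis
        using F'(4)[of p] F'(4)[OF base_point(1)] Pair
        by (simp add: affine_map_def \<beta>_def \<eta>_def translation_part_def transverse_part_def)
    qed
  qed
  then show "p \<in> Rtilde \<Longrightarrow> F p = affine_map \<beta> \<eta> p" .
  have "smooth_on {0..} (\<lambda>x. ((1, 0) :: complex \<times> complex, x))"
    by (rule smooth_on_Pair[OF smooth_on_const smooth_on_ident])
  from smooth_on_compose[OF this cont_lift_smooth[OF f F]]
  have s: "smooth_on {0..} (\<lambda>x. F ((1, 0), x))"
    using R by (simp add: image_subset_iff)
  have "smooth_on {0..} (\<lambda>x. fst (F ((1, 0), x)) + - (1, 0))"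
    by (rule smooth_on_add[OF smooth_on_bounded_linear_compose[OF bounded_linear_fst s] smooth_on_const])
  then show "smooth_on {0..} \<beta>"
    by (rule smooth_on_cong) (simp add: \<beta>_def translation_part_def)
  show "smooth_on {0..} \<eta>"
    by (rule smooth_on_cong[OF smooth_on_bounded_linear_compose[OF bounded_linear_snd s]])
      (simp add: \<eta>_def transverse_part_def)
  show "x < 0 \<Longrightarrow> \<beta> x = 0" by (simp add: \<beta>_def translation_part_def)
  assume x: "0 \<le> x"
  have "affine_map \<beta> \<eta> ((1, 0), x) \<in> Rtilde"
    using F'(2)[OF R[OF x]] aff[OF R[OF x]] by simp
  then show "0 \<le> \<eta> x" by (simp add: affine_map_def Rtilde_iff)
  have "F (dilate lam (1, 0), \<phi> x) = \<T> (affine_map \<beta> \<eta> ((1, 0), x))"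
    using cont_lift_commutes[OF F R[OF x]] T_eq[OF R[OF x]] aff[OF R[OF x]] by simp
  moreover have "(dilate lam (1, 0), \<phi> x) \<in> Rtilde"
    using T_mem[OF R[OF x]] T_eq[OF R[OF x]] by simp
  ultimately have "affine_map \<beta> \<eta> (dilate lam (1, 0), \<phi> x) = (dilate lam ((1, 0) + \<beta> x), \<phi> (\<eta> x))"
    using aff T_eq \<open>affine_map \<beta> \<eta> ((1, 0), x) \<in> Rtilde\<close> by (simp add: affine_map_def)
  then show "\<beta> (\<phi> x) = dilate lam (\<beta> x)" "\<eta> (\<phi> x) = \<phi> (\<eta> x)"
    by (simp_all add: affine_map_def dilate_add)
qed

end

section \<open>Semidirect products and the centralizer of the holonomy\<close>

lemma group_semidirect_product:
  assumes N: "group N" and Q: "group Q"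
    and hom: "\<And>e. e \<in> carrier Q \<Longrightarrow> act e \<in> hom N N"
    and one: "\<And>b. b \<in> carrier N \<Longrightarrow> act \<one>\<^bsub>Q\<^esub> b = b"
    and mult: "\<And>e e' b. e \<in> carrier Q \<Longrightarrow> e' \<in> carrier Q \<Longrightarrow> b \<in> carrier N \<Longrightarrow>
      act (e \<otimes>\<^bsub>Q\<^esub> e') b = act e' (act e b)"
  shows "group (semidirect_product N Q act)"
proof -
  let ?G = "semidirect_product N Q act"
  interpret N: group N by fact
  interpret Q: group Q by fact
  have mem: "act e b \<in> carrier N" if "e \<in> carrier Q" "b \<in> carrier N" for e b
    using hom_in_carrier[OF hom[OF that(1)] that(2)] .
  have am: "act e (b \<otimes>\<^bsub>N\<^esub> b') = act e b \<otimes>\<^bsub>N\<^esub> act e b'"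
    if "e \<in> carrier Q" "b \<in> carrier N" "b' \<in> carrier N" for e b b'
    using hom_mult[OF hom[OF that(1)] that(2,3)] .
  have aone: "act e \<one>\<^bsub>N\<^esub> = \<one>\<^bsub>N\<^esub>" if "e \<in> carrier Q" for e
    using hom_one[OF hom[OF that] N N] .
  show ?thesis
  proof (rule groupI)
    fix x y z
    assume "x \<in> carrier ?G" "y \<in> carrier ?G"
      "z \<in> carrier ?G"
    then show "x \<otimes>\<^bsub>?G\<^esub> y \<otimes>\<^bsub>?G\<^esub> z =
        x \<otimes>\<^bsub>?G\<^esub> (y \<otimes>\<^bsub>?G\<^esub> z)"
      by (cases x, cases y, cases z)
        (simp add: semidirect_product_def mem am mult N.m_assoc Q.m_assoc)
  next
    fix x assume "x \<in> carrier ?G"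
    then obtain b e where x: "x = (b, e)" "b \<in> carrier N" "e \<in> carrier Q"
      by (auto simp: semidirect_product_def)
    show "\<exists>y\<in>carrier ?G.
        y \<otimes>\<^bsub>?G\<^esub> x = \<one>\<^bsub>?G\<^esub>"
    proof (rule bexI)
      have "act e (act (inv\<^bsub>Q\<^esub> e) (inv\<^bsub>N\<^esub> b)) = inv\<^bsub>N\<^esub> b"
        using mult[of "inv\<^bsub>Q\<^esub> e" e "inv\<^bsub>N\<^esub> b"] x by (simp add: one)
      then show "(act (inv\<^bsub>Q\<^esub> e) (inv\<^bsub>N\<^esub> b), inv\<^bsub>Q\<^esub> e) \<otimes>\<^bsub>?G\<^esub> x =
          \<one>\<^bsub>?G\<^esub>"
        using x by (simp add: semidirect_product_def)
      show "(act (inv\<^bsub>Q\<^esub> e) (inv\<^bsub>N\<^esub> b), inv\<^bsub>Q\<^esub> e) \<in> carrier ?G"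
        using x by (simp add: semidirect_product_def mem)
    qed
  qed (auto simp: semidirect_product_def mem aone)
qed

context expanding_diffeo
begin

abbreviation Z :: "(real \<Rightarrow> real) monoid" where "Z \<equiv> centralizer \<phi>"

lemma centralizer_eq: "Z = (BijGroup {0..})\<lparr>carrier := carrier Z\<rparr>"
  by (simp add: centralizer_def Diff_halfline_def)

lemma centralizerD:
  assumes "\<eta> \<in> carrier Z"
  shows "\<eta> \<in> Bij {0..}" "smooth_on {0..} \<eta>" "smooth_on {0..} (inv_into {0..} \<eta>)"
    "\<And>x. 0 \<le> x \<Longrightarrow> \<phi> (\<eta> x) = \<eta> (\<phi> x)"
proof -
  show \<eta>: "\<eta> \<in> Bij {0..}" "smooth_on {0..} \<eta>" "smooth_on {0..} (inv_into {0..} \<eta>)"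
    using assms by (auto simp: centralizer_def Diff_halfline_def)
  have "compose {0..} \<phi> \<eta> = compose {0..} \<eta> \<phi>"
    using assms phi_Bij \<eta>(1) by (auto simp: centralizer_def Diff_halfline_def BijGroup_def)
  then show "\<phi> (\<eta> x) = \<eta> (\<phi> x)" if "0 \<le> x" for x
    using that by (metis atLeast_iff compose_eq)
qed

lemma Bij_halfline_nonneg: "\<eta> \<in> Bij {0..} \<Longrightarrow> 0 \<le> x \<Longrightarrow> 0 \<le> \<eta> (x::real)"
  using Bij_imp_funcset by fastforce

lemma centralizerI:
  assumes "\<eta> \<in> extensional {0..}" and s: "smooth_on {0..} \<eta>" "smooth_on {0..} \<zeta>"
    and n: "\<And>x. 0 \<le> x \<Longrightarrow> 0 \<le> \<eta> x" "\<And>x. 0 \<le> x \<Longrightarrow> 0 \<le> \<zeta> x"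
    and i: "\<And>x. 0 \<le> x \<Longrightarrow> \<zeta> (\<eta> x) = x" "\<And>x. 0 \<le> x \<Longrightarrow> \<eta> (\<zeta> x) = x"
    and c: "\<And>x. 0 \<le> x \<Longrightarrow> \<phi> (\<eta> x) = \<eta> (\<phi> x)"
  shows "\<eta> \<in> carrier Z"
proof -
  have bij: "bij_betw \<eta> {0..} {0..}"
    by (rule bij_betw_byWitness[where f' = \<zeta>]) (use n i in auto)
  then have B: "\<eta> \<in> Bij {0..}" using assms(1) by (simp add: Bij_def)
  have "inv_into {0..} \<eta> x = \<zeta> x" if "0 \<le> x" for x
    using inv_into_f_eq[of \<eta> "{0..}" "\<zeta> x" x] bij n(2)[OF that] i(2)[OF that]
    by (auto simp: bij_betw_def)
  then have "smooth_on {0..} (inv_into {0..} \<eta>)"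
    by (intro smooth_on_cong[OF s(2)]) auto
  moreover have "compose {0..} \<phi> \<eta> = compose {0..} \<eta> \<phi>"
    using c by (auto simp: compose_def fun_eq_iff)
  ultimately show ?thesis
    using B s(1) phi_Bij by (simp add: centralizer_def Diff_halfline_def BijGroup_def)
qed

lemma subgroup_centralizer: "subgroup (carrier Z) (BijGroup {0..})"
proof (rule group.subgroupI[OF group_BijGroup])
  show "carrier Z \<subseteq> carrier (BijGroup {0..})"
    using centralizerD(1) by (auto simp: BijGroup_def)
  have "(\<lambda>x\<in>{0..}. x) \<in> carrier Z"
    by (rule centralizerI[where \<zeta> = "\<lambda>x. x"])
      (auto simp: phi_nonneg smooth_on_ident intro: smooth_on_cong[OF smooth_on_ident])
  then show "carrier Z \<noteq> {}" by blast
next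
  fix \<eta> assume \<eta>: "\<eta> \<in> carrier Z"
  note D = centralizerD[OF \<eta>]
  let ?\<zeta> = "inv_into {0..} \<eta>"
  have bij: "bij_betw \<eta> {0..} {0..}" using D(1) by (simp add: Bij_def)
  have z: "0 \<le> ?\<zeta> x" "\<eta> (?\<zeta> x) = x" "?\<zeta> (\<eta> x) = x" if "0 \<le> x" for x
    using that bij_betw_inv_into_right[OF bij, of x] bij_betw_inv_into_left[OF bij, of x]
      Bij_inv_into_mem[OF D(1), of x] by auto
  have com: "\<phi> (?\<zeta> x) = ?\<zeta> (\<phi> x)" if "0 \<le> x" for x
    using D(4)[OF z(1)[OF that]] z(2)[OF that] z(3)[OF phi_nonneg[OF z(1)[OF that]]] by simp
  have "(\<lambda>x\<in>{0..}. ?\<zeta> x) \<in> carrier Z"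
    by (rule centralizerI[where \<zeta> = \<eta>])
      (use z com D(2) Bij_halfline_nonneg[OF D(1)] in \<open>auto simp: phi_nonneg intro: smooth_on_cong[OF D(3)]\<close>)
  then show "inv\<^bsub>BijGroup {0..}\<^esub> \<eta> \<in> carrier Z"
    by (simp add: inv_BijGroup[OF D(1)])
next
  fix \<eta> \<eta>' assume \<eta>: "\<eta> \<in> carrier Z" and \<eta>': "\<eta>' \<in> carrier Z"
  note D = centralizerD[OF \<eta>] and D' = centralizerD[OF \<eta>']
  have bij: "bij_betw \<eta> {0..} {0..}" "bij_betw \<eta>' {0..} {0..}" using D(1) D'(1) by (simp_all add: Bij_def)
  note n = Bij_halfline_nonneg[OF D(1)] Bij_halfline_nonneg[OF D'(1)]
  have z: "0 \<le> inv_into {0..} \<eta> x" "\<eta> (inv_into {0..} \<eta> x) = x" "inv_into {0..} \<eta> (\<eta> x) = x"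
      "0 \<le> inv_into {0..} \<eta>' x" "\<eta>' (inv_into {0..} \<eta>' x) = x" "inv_into {0..} \<eta>' (\<eta>' x) = x"
    if "0 \<le> x" for x
    using that bij_betw_inv_into_right[OF bij(1), of x] bij_betw_inv_into_left[OF bij(1), of x]
      Bij_inv_into_mem[OF D(1), of x] bij_betw_inv_into_right[OF bij(2), of x]
      bij_betw_inv_into_left[OF bij(2), of x] Bij_inv_into_mem[OF D'(1), of x] by auto
  have "compose {0..} \<eta> \<eta>' \<in> carrier Z"
  proof (rule centralizerI[where \<zeta> = "\<lambda>x. inv_into {0..} \<eta>' (inv_into {0..} \<eta> x)"])
    show "smooth_on {0..} (compose {0..} \<eta> \<eta>')"
      by (rule smooth_on_cong[OF smooth_on_compose[OF D'(2) D(2)]]) (auto simp: n compose_def)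
    show "smooth_on {0..} (\<lambda>x. inv_into {0..} \<eta>' (inv_into {0..} \<eta> x))"
      by (rule smooth_on_compose[OF D(3) D'(3)]) (auto simp: z)
    show "\<phi> (compose {0..} \<eta> \<eta>' x) = compose {0..} \<eta> \<eta>' (\<phi> x)" if "0 \<le> x" for x
      using that by (simp add: compose_def phi_nonneg n D(4) D'(4))
  qed (simp_all add: compose_def n z)
  then show "\<eta> \<otimes>\<^bsub>BijGroup {0..}\<^esub> \<eta>' \<in> carrier Z"
    using D(1) D'(1) by (simp add: BijGroup_def)
qed

lemma group_centralizer: "group Z"
  using subgroup.subgroup_is_group[OF subgroup_centralizer group_BijGroup] centralizer_eq by simp

lemma mult_centralizer:
  assumes "\<eta> \<in> carrier Z" "\<eta>' \<in> carrier Z"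
  shows "\<eta> \<otimes>\<^bsub>Z\<^esub> \<eta>' = compose {0..} \<eta> \<eta>'"
  using centralizerD(1)[OF assms(1)] centralizerD(1)[OF assms(2)]
  by (simp add: centralizer_def Diff_halfline_def BijGroup_def)

lemma one_centralizer: "\<one>\<^bsub>Z\<^esub> = (\<lambda>x\<in>{0..}. x)"
  by (simp add: centralizer_def Diff_halfline_def BijGroup_def)

lemma centralizer_at_0:
  assumes "\<eta> \<in> carrier Z"
  shows "\<eta> 0 = 0"
proof -
  have "\<phi> (\<eta> 0) = \<eta> 0" using centralizerD(4)[OF assms, of 0] by (simp add: phi_0)
  moreover have "0 \<le> \<eta> 0" using Bij_halfline_nonneg[OF centralizerD(1)[OF assms]] by simp
  ultimately show ?thesis using spec[OF phi_gt, of "\<eta> 0"] by (cases "\<eta> 0 = 0") auto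
qed

lemma centralizer_pos:
  assumes "\<eta> \<in> carrier Z" "0 < x"
  shows "0 < \<eta> x"
proof -
  have "\<eta> x \<noteq> \<eta> 0"
    using centralizerD(1)[OF assms(1)] assms(2) by (auto simp: Bij_def bij_betw_def inj_on_def)
  moreover have "0 \<le> \<eta> x" using Bij_halfline_nonneg[OF centralizerD(1)[OF assms(1)]] assms(2) by simp
  ultimately show ?thesis by (simp add: centralizer_at_0[OF assms(1)])
qed

end

lemma group_equivariant_group: "group (equivariant_group \<phi> \<nu>)"
proof (rule groupI)
  let ?G = "equivariant_group \<phi> \<nu>"
  show "f \<otimes>\<^bsub>?G\<^esub> g \<in> carrier ?G"
    if "f \<in> carrier ?G" "g \<in> carrier ?G" for f g
    using that smooth_on_add[of "{0..}" f g]
    by (simp add: equivariant_group_def equivariant_functions_def plus_fun_def distrib_left)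
  show "\<one>\<^bsub>?G\<^esub> \<in> carrier ?G"
    by (simp add: equivariant_group_def equivariant_functions_def zero_fun_def smooth_on_const)
  show "\<exists>g\<in>carrier ?G. g \<otimes>\<^bsub>?G\<^esub> f = \<one>\<^bsub>?G\<^esub>"
    if "f \<in> carrier ?G" for f
  proof (rule bexI[of _ "- f"])
    show "- f \<in> carrier ?G"
      using that smooth_on_bounded_linear_compose[OF bounded_linear_minus[OF bounded_linear_ident], of "{0..}" f]
      by (simp add: equivariant_group_def equivariant_functions_def fun_Compl_def)
  qed (simp add: equivariant_group_def)
qed (auto simp: equivariant_group_def add.assoc)

section \<open>The automorphisms induced by affine maps\<close>

context reeb
begin

abbreviation \<Z> :: "(real \<Rightarrow> complex) set" where "\<Z> \<equiv> equivariant_functions \<phi> lam"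

abbreviation translation_group :: "((real \<Rightarrow> complex) \<times> (real \<Rightarrow> complex)) monoid" where
  "translation_group \<equiv> equivariant_group \<phi> lam \<times>\<times> equivariant_group \<phi> lam"

abbreviation affine_group :: "(((real \<Rightarrow> complex) \<times> (real \<Rightarrow> complex)) \<times> (real \<Rightarrow> real)) monoid" where
  "affine_group \<equiv> semidirect_product translation_group Z pullback_pair"

lemma group_translation_group: "group translation_group"
  by (rule DirProd_group[OF group_equivariant_group group_equivariant_group])

lemma pullback_mem:
  assumes \<eta>: "\<eta> \<in> carrier Z" and f: "f \<in> \<Z>"
  shows "pullback \<eta> f \<in> \<Z>"
proof -
  note D = centralizerD[OF \<eta>]
  have n: "0 \<le> \<eta> x" if "0 \<le> x" for x using Bij_halfline_nonneg[OF D(1) that] .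
  have "smooth_on {0..} (\<lambda>x. f (\<eta> x))"
    using f by (intro smooth_on_compose[OF D(2), of "{0..}"]) (auto simp: equivariant_functions_def n)
  then have "smooth_on {0..} (pullback \<eta> f)"
    by (rule smooth_on_cong) (simp add: pullback_def)
  then show ?thesis
    using f by (simp add: equivariant_functions_def pullback_def phi_nonneg n D(4)[symmetric])
qed

lemma group_affine_group: "group affine_group"
proof (rule group_semidirect_product[OF group_translation_group group_centralizer])
  fix e assume e: "e \<in> carrier Z"
  show "pullback_pair e \<in> hom translation_group translation_group"
    by (rule homI)
      (auto simp: pullback_pair_def equivariant_group_def pullback_mem[OF e], auto simp: pullback_def fun_eq_iff)
next
  fix b assume "b \<in> carrier translation_group"
  then show "pullback_pair \<one>\<^bsub>Z\<^esub> b = b"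
    by (cases b) (auto simp: pullback_pair_def pullback_def one_centralizer fun_eq_iff
        equivariant_group_def equivariant_functions_def)
next
  fix e e' b assume e: "e \<in> carrier Z" "e' \<in> carrier Z"
    and "b \<in> carrier translation_group"
  show "pullback_pair (e \<otimes>\<^bsub>Z\<^esub> e') b = pullback_pair e' (pullback_pair e b)"
    using Bij_halfline_nonneg[OF centralizerD(1)[OF e(2)]]
    by (cases b) (auto simp: pullback_pair_def pullback_def mult_centralizer[OF e] compose_def fun_eq_iff)
qed

definition act :: "((real \<Rightarrow> complex) \<times> (real \<Rightarrow> complex)) \<times> (real \<Rightarrow> real) \<Rightarrow> pt \<Rightarrow> pt" where
  "act g = affine_map (\<lambda>x. (fst (fst g) x, snd (fst g) x)) (snd g)"

lemma act_eq: "act ((b1, b2), \<eta>) (z, x) = (z + (b1 x, b2 x), \<eta> x)"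
  by (simp add: act_def affine_map_def)

lemma affine_groupE:
  assumes "g \<in> carrier affine_group"
  obtains b1 b2 \<eta> where "g = ((b1, b2), \<eta>)" "b1 \<in> \<Z>"
    "b2 \<in> \<Z>" "\<eta> \<in> carrier Z"
  using assms by (auto simp: semidirect_product_def equivariant_group_def)

text \<open>The functional equation at the fixed point \<open>0\<close> of \<open>\<phi>\<close> reads \<open>f 0 = \<lambda> f 0\<close>.\<close>

lemma equivariant_function_at_0:
  assumes "f \<in> \<Z>"
  shows "f 0 = 0"
proof -
  have "f (\<phi> 0) = lam * f 0" using assms by (simp add: equivariant_functions_def)
  then have "(lam - 1) * f 0 = 0" by (simp add: phi_0 algebra_simps)
  moreover have "lam \<noteq> 1" using lam by auto
  ultimately show ?thesis by simp
qed

lemma act_mem: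
  assumes "g \<in> carrier affine_group" "p \<in> Rtilde"
  shows "act g p \<in> Rtilde"
proof -
  obtain b1 b2 \<eta> where g: "g = ((b1, b2), \<eta>)" "b1 \<in> \<Z>"
    "b2 \<in> \<Z>" "\<eta> \<in> carrier Z"
    using affine_groupE[OF assms(1)] .
  obtain z x where p: "p = (z, x)" by (cases p)
  show ?thesis
  proof (cases "0 < x")
    case True
    then show ?thesis using centralizer_pos[OF g(4) True] by (simp add: g(1) p act_eq Rtilde_iff)
  next
    case False
    then have "x = 0" "z \<noteq> 0" using assms(2) p by (auto simp: Rtilde_iff)
    then show ?thesis
      using equivariant_function_at_0[OF g(2)] equivariant_function_at_0[OF g(3)] centralizer_at_0[OF g(4)]
      by (simp add: g(1) p act_eq Rtilde_iff zero_prod_def[symmetric])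
  qed
qed

lemma act_Htilde:
  assumes "g \<in> carrier affine_group" "p \<in> Htilde"
  shows "act g p = p"
proof -
  obtain b1 b2 \<eta> where g: "g = ((b1, b2), \<eta>)" "b1 \<in> \<Z>"
    "b2 \<in> \<Z>" "\<eta> \<in> carrier Z"
    using affine_groupE[OF assms(1)] .
  obtain z where p: "p = (z, 0)" using assms(2) by (cases p) (simp add: Htilde_iff)
  show ?thesis
    using equivariant_function_at_0[OF g(2)] equivariant_function_at_0[OF g(3)] centralizer_at_0[OF g(4)]
    by (simp add: g(1) p act_eq zero_prod_def[symmetric])
qed

text \<open>The composition is \<open>(z, x) \<mapsto> (z + b' x + b (\<eta>' x), \<eta> (\<eta>' x))\<close>: this is why \<open>\<eta>'\<close> acts on \<open>b\<close> from
  the right in the semidirect product.\<close>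

lemma act_mult:
  assumes "g \<in> carrier affine_group" "h \<in> carrier affine_group" "p \<in> Rtilde"
  shows "act (g \<otimes>\<^bsub>affine_group\<^esub> h) p = act g (act h p)"
proof -
  obtain b1 b2 \<eta> where g: "g = ((b1, b2), \<eta>)" "\<eta> \<in> carrier Z"
    using affine_groupE[OF assms(1)] by metis
  obtain c1 c2 \<zeta> where h: "h = ((c1, c2), \<zeta>)" "\<zeta> \<in> carrier Z"
    using affine_groupE[OF assms(2)] by metis
  obtain z x where p: "p = (z, x)" "0 \<le> x" using assms(3) by (cases p) (simp add: Rtilde_iff)
  show ?thesis
    using p(2) by (simp add: g h p(1) act_eq semidirect_product_def equivariant_group_def pullback_pair_def
        pullback_def mult_centralizer compose_def)
qed

lemma act_one:
  assumes "p \<in> Rtilde"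
  shows "act \<one>\<^bsub>affine_group\<^esub> p = p"
  using assms by (cases p)
    (simp add: act_def affine_map_def semidirect_product_def equivariant_group_def one_centralizer
      Rtilde_iff zero_prod_def[symmetric])

lemma act_inv:
  assumes "g \<in> carrier affine_group" "p \<in> Rtilde"
  shows "act (inv\<^bsub>affine_group\<^esub> g) (act g p) = p" "act g (act (inv\<^bsub>affine_group\<^esub> g) p) = p"
proof -
  interpret group affine_group by (rule group_affine_group)
  show "act (inv\<^bsub>affine_group\<^esub> g) (act g p) = p"
    using act_mult[OF inv_closed[OF assms(1)] assms] l_inv[OF assms(1)] act_one[OF assms(2)] by simp
  show "act g (act (inv\<^bsub>affine_group\<^esub> g) p) = p"
    using act_mult[OF assms(1) inv_closed[OF assms(1)] assms(2)] r_inv[OF assms(1)] act_one[OF assms(2)] by simp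
qed

lemma act_T:
  assumes "g \<in> carrier affine_group" "p \<in> Rtilde"
  shows "act g (\<T> p) = \<T> (act g p)"
proof -
  obtain b1 b2 \<eta> where g: "g = ((b1, b2), \<eta>)" "b1 \<in> \<Z>"
    "b2 \<in> \<Z>" "\<eta> \<in> carrier Z"
    using affine_groupE[OF assms(1)] .
  obtain z x where p: "p = (z, x)" "0 \<le> x" using assms(2) by (cases p) (simp add: Rtilde_iff)
  have "b1 (\<phi> x) = lam * b1 x" "b2 (\<phi> x) = lam * b2 x"
    using g(2,3) p(2) by (simp_all add: equivariant_functions_def)
  moreover have "(z + (b1 x, b2 x), \<eta> x) \<in> Rtilde"
    using act_mem[OF assms] by (simp add: g(1) p(1) act_eq)
  ultimately show ?thesis
    using assms(2) p(2) centralizerD(4)[OF g(4) p(2)]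
    by (simp add: g(1) p(1) T_eq act_eq) (simp add: dilate_def algebra_simps)
qed

lemma smooth_act:
  assumes "g \<in> carrier affine_group"
  shows "smooth_on Rtilde (act g)"
proof -
  obtain b1 b2 \<eta> where g: "g = ((b1, b2), \<eta>)" "b1 \<in> \<Z>"
    "b2 \<in> \<Z>" "\<eta> \<in> carrier Z"
    using affine_groupE[OF assms(1)] .
  have b: "smooth_on {0..} b1" "smooth_on {0..} b2" using g(2,3) by (simp_all add: equivariant_functions_def)
  have sn: "snd ` Rtilde \<subseteq> {0..}" by (auto simp: Rtilde_iff)
  have s: "smooth_on Rtilde (\<lambda>p. snd p)" by (rule smooth_on_bounded_linear[OF bounded_linear_snd])
  have f: "smooth_on Rtilde (\<lambda>p. fst p)" by (rule smooth_on_bounded_linear[OF bounded_linear_fst])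
  have "smooth_on Rtilde (\<lambda>p. (fst p + (b1 (snd p), b2 (snd p)), \<eta> (snd p)))"
    by (rule smooth_on_Pair[OF smooth_on_add[OF f smooth_on_Pair[OF smooth_on_compose[OF s b(1) sn]
        smooth_on_compose[OF s b(2) sn]]] smooth_on_compose[OF s centralizerD(2)[OF g(4)] sn]])
  then show ?thesis
    by (rule smooth_on_cong) (auto simp: g(1) act_eq)
qed

text \<open>The two quotients to which the definition of the automorphism group is applied, \<^term>\<open>Rtilde\<close>
  and the Reeb component, are treated together: it only matters that the projection \<open>\<pi>\<close> is
  locally injective and that its leaves are saturated.\<close>

definition good_projection :: "(pt \<Rightarrow> 'q) \<Rightarrow> bool" where
  "good_projection \<pi> \<longleftrightarrow> (\<forall>p\<in>Rtilde. \<exists>V. is_chart \<pi> V \<and> p \<in> V) \<and>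
     (\<forall>L\<in>leaves \<pi>. \<forall>z w x. (z, x) \<in> Rtilde \<longrightarrow> (w, x) \<in> Rtilde \<longrightarrow> \<pi> (z, x) \<in> L \<longrightarrow> \<pi> (w, x) \<in> L)"

lemma good_projection_id: "good_projection id"
  unfolding good_projection_def
proof (intro conjI ballI allI impI)
  show "\<exists>V. is_chart id V \<and> p \<in> V" if "p \<in> Rtilde" for p
    using that by (intro exI[of _ Rtilde]) (simp add: is_chart_def)
  show "id (w, x) \<in> L" if "L \<in> leaves id" "(z, x) \<in> Rtilde" "(w, x) \<in> Rtilde" "id (z, x) \<in> L" for L z w x
    using that by (auto simp: leaves_def Htilde_iff Rtilde_iff)
qed

text \<open>Deck transformations map slices \<open>\<complex>\<^sup>2 \<times> {x}\<close> to slices, so the preimage of a leaf is a union of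
  slices.\<close>

lemma good_projection_q: "good_projection q"
  unfolding good_projection_def
proof (intro conjI ballI allI impI)
  show "\<exists>V. is_chart q V \<and> p \<in> V" if "p \<in> Rtilde" for p
    by (rule chart_exists[OF that])
  fix L z w x assume L: "L \<in> leaves q" and R: "(z, x) \<in> Rtilde" "(w, x) \<in> Rtilde" and zL: "q (z, x) \<in> L"
  obtain S where S: "L = q ` S" "S \<subseteq> Rtilde" "\<And>z w y. (z, y) \<in> S \<Longrightarrow> (w, y) \<in> Rtilde \<Longrightarrow> (w, y) \<in> S"
  proof (cases "L = q ` Htilde")
    case True
    then show ?thesis by (intro that[of Htilde]) (auto simp: Htilde_iff Rtilde_iff)
  next
    case False
    then obtain y where "0 < y" "L = q ` (UNIV \<times> {y})" using L by (auto simp: leaves_def)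
    then show ?thesis by (intro that[of "UNIV \<times> {y}"]) (auto simp: Rtilde_iff)
  qed
  obtain u where u: "u \<in> S" "q (z, x) = q u" using zL S(1) by blast
  then obtain n where n: "u = deck n (z, x)" using q_eq_iff[OF R(1), of u] S(2) by blast
  have "deck n (w, x) \<in> S"
    using S(3)[of "dilate (lam powi n) z" "iter n x"] u(1) deck_mem[OF R(2), of n]
    by (simp add: n deck_eq[OF R(1)] deck_eq[OF R(2)])
  moreover have "q (deck n (w, x)) = q (w, x)" by (rule q_deck[OF R(2)])
  ultimately show "q (w, x) \<in> L" unfolding S(1) by (metis imageI)
qed

text \<open>On a domain that \<open>F\<close> maps into a single chart, \<open>F\<close> itself represents \<open>f\<close>.\<close>

lemma smooth_map_of_cover:
  assumes \<pi>: "good_projection \<pi>" and F: "smooth_on Rtilde F" "\<And>p. p \<in> Rtilde \<Longrightarrow> F p \<in> Rtilde"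
    and f: "\<And>p. p \<in> Rtilde \<Longrightarrow> f (\<pi> p) = \<pi> (F p)"
  shows "smooth_map \<pi> f"
  unfolding smooth_map_def
proof
  fix p assume p: "p \<in> Rtilde"
  obtain U where U: "is_chart \<pi> U" "p \<in> U" using \<pi> p unfolding good_projection_def by blast
  obtain V where V: "is_chart \<pi> V" "F p \<in> V" using \<pi> F(2)[OF p] unfolding good_projection_def by blast
  obtain A where A: "open A" "V = Rtilde \<inter> A" using V(1) by (auto simp: is_chart_def openin_open)
  define U' where "U' = U \<inter> (Rtilde \<inter> F -` A)"
  have UR: "U' \<subseteq> Rtilde" by (auto simp: U'_def)
  have FV: "F u \<in> V" if "u \<in> U'" for u using that F(2) A(2) by (auto simp: U'_def)
  have "is_chart \<pi> U'"
    unfolding is_chart_def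
  proof
    show "openin (top_of_set Rtilde) U'"
      unfolding U'_def using U(1) A(1) smooth_on_imp_continuous_on[OF F(1)]
      by (intro openin_Int continuous_openin_preimage_gen) (auto simp: is_chart_def)
    show "inj_on \<pi> U'" using U(1) by (auto simp: is_chart_def U'_def intro: inj_on_subset)
  qed
  moreover have "f ` \<pi> ` U' \<subseteq> \<pi> ` V"
    using f UR FV by (auto simp: subset_iff)
  moreover have "smooth_on U' (\<lambda>u. inv_into V \<pi> (f (\<pi> u)))"
  proof (rule smooth_on_cong[OF smooth_on_subset[OF F(1) UR]])
    fix u assume u: "u \<in> U'"
    then have "f (\<pi> u) = \<pi> (F u)" using UR f by blast
    then show "F u = inv_into V \<pi> (f (\<pi> u))"
      using V(1) FV[OF u] by (simp add: is_chart_def)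
  qed
  ultimately show "\<exists>U V. is_chart \<pi> U \<and> is_chart \<pi> V \<and> p \<in> U \<and> f ` \<pi> ` U \<subseteq> \<pi> ` V \<and>
      smooth_on U (\<lambda>u. inv_into V \<pi> (f (\<pi> u)))"
    using U(2) V p A by (intro exI[of _ U'] exI[of _ V]) (simp add: U'_def)
qed

text \<open>In a leaf the map is the translation by a constant. The translated chart domain is again mapped
  injectively by \<open>\<pi>\<close> because \<open>f\<close> is injective.\<close>

lemma leaf_holomorphic_affine:
  assumes \<pi>: "good_projection \<pi>" and g: "g \<in> carrier affine_group" and L: "L \<in> leaves \<pi>"
    and f: "\<And>p. p \<in> Rtilde \<Longrightarrow> \<pi> p \<in> L \<Longrightarrow> f (\<pi> p) = \<pi> (act g p)"
    and L': "\<And>p. p \<in> Rtilde \<Longrightarrow> \<pi> p \<in> L \<Longrightarrow> \<pi> (act g p) \<in> L'" and inj: "inj_on f L"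
  shows "leaf_holomorphic \<pi> L L' f"
  unfolding leaf_holomorphic_def
proof (intro allI impI, elim conjE)
  fix z x assume R: "(z, x) \<in> Rtilde" and zL: "\<pi> (z, x) \<in> L"
  obtain b1 b2 \<eta> where gb: "g = ((b1, b2), \<eta>)" using affine_groupE[OF g] by metis
  let ?c = "(b1 x, b2 x)"
  obtain V where V: "is_chart \<pi> V" "(z, x) \<in> V" using \<pi> R unfolding good_projection_def by blast
  obtain A where A: "open A" "V = Rtilde \<inter> A" using V(1) by (auto simp: is_chart_def openin_open)
  define W where "W = {w. (w, x) \<in> V}"
  define W' where "W' = (\<lambda>w. ?c + w) ` W"
  have WR: "(w, x) \<in> Rtilde" if "w \<in> W" for w using that A(2) by (simp add: W_def)
  have WL: "\<pi> (w, x) \<in> L" if "w \<in> W" for w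
    using \<pi> L R WR[OF that] zL unfolding good_projection_def by blast
  have act: "act g (w, x) = (?c + w, \<eta> x)" for w
    by (simp add: gb act_eq add.commute)
  have "W = (\<lambda>w. (w, x)) -` A \<inter> (if 0 < x then UNIV else - {0})"
    using R by (auto simp: W_def A(2) Rtilde_iff)
  moreover have "open \<dots>"
    using A(1) by (intro open_Int open_vimage) (auto intro: continuous_on_Pair continuous_on_id continuous_on_const)
  ultimately have oW: "open W" by simp
  have inj_W: "inj_on \<pi> (W \<times> {x})"
    using V(1) by (auto simp: is_chart_def W_def intro: inj_on_subset)
  have inj_W': "inj_on \<pi> (W' \<times> {\<eta> x})"
  proof (rule inj_onI)
    fix u v assume "u \<in> W' \<times> {\<eta> x}" "v \<in> W' \<times> {\<eta> x}" and eq: "\<pi> u = \<pi> v"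
    then obtain a b where ab: "a \<in> W" "b \<in> W" "u = act g (a, x)" "v = act g (b, x)"
      by (auto simp: W'_def act)
    have "f (\<pi> (a, x)) = f (\<pi> (b, x))"
      using f[OF WR[OF ab(1)] WL[OF ab(1)]] f[OF WR[OF ab(2)] WL[OF ab(2)]] eq ab by simp
    then have "\<pi> (a, x) = \<pi> (b, x)" using inj WL[OF ab(1)] WL[OF ab(2)] by (simp add: inj_on_eq_iff)
    then have "(a, x) = (b, x)" using inj_W ab(1,2) by (auto dest: inj_onD)
    then show "u = v" using ab by simp
  qed
  have fW: "f (\<pi> (w, x)) = \<pi> (?c + w, \<eta> x)" if "w \<in> W" for w
    using f[OF WR[OF that] WL[OF that]] by (simp add: act)
  have "is_leaf_chart \<pi> L W x"
    unfolding is_leaf_chart_def using oW WR WL inj_W by auto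
  moreover have "is_leaf_chart \<pi> L' W' (\<eta> x)"
    unfolding is_leaf_chart_def
  proof (intro conjI)
    show "open W'" unfolding W'_def by (rule open_translation[OF oW])
    show "W' \<times> {\<eta> x} \<subseteq> Rtilde"
    proof clarify
      fix a b assume "(a, b) \<in> W'"
      then obtain w where "w \<in> W" "(a, b) = ?c + w" by (auto simp: W'_def)
      then show "((a, b), \<eta> x) \<in> Rtilde"
        using act_mem[OF g WR[of w]] act[of w] by simp
    qed
    show "\<pi> ` (W' \<times> {\<eta> x}) \<subseteq> L'"
    proof (rule image_subsetI)
      fix u assume "u \<in> W' \<times> {\<eta> x}"
      then obtain w where "w \<in> W" "u = act g (w, x)" by (auto simp: W'_def act)
      then show "\<pi> u \<in> L'" using L'[OF WR WL] by simp
    qed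
  qed (rule inj_W')
  moreover have "f ` \<pi> ` (W \<times> {x}) \<subseteq> \<pi> ` (W' \<times> {\<eta> x})"
    using fW by (auto simp: W'_def)
  moreover have "holomorphic2_on W (\<lambda>w. fst (inv_into (W' \<times> {\<eta> x}) \<pi> (f (\<pi> (w, x)))))"
    unfolding holomorphic2_on_def
  proof
    fix w assume w: "w \<in> W"
    have inv: "fst (inv_into (W' \<times> {\<eta> x}) \<pi> (f (\<pi> (v, x)))) = ?c + v" if v: "v \<in> W" for v
    proof -
      have "(?c + v, \<eta> x) \<in> W' \<times> {\<eta> x}" using v by (simp add: W'_def)
      from inv_into_f_f[OF inj_W' this] show ?thesis by (simp add: fW[OF v])
    qed
    have "((\<lambda>v. ?c + v) has_derivative (\<lambda>v. v)) (at w)"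
      by (auto intro!: derivative_eq_intros)
    then have "((\<lambda>w. fst (inv_into (W' \<times> {\<eta> x}) \<pi> (f (\<pi> (w, x))))) has_derivative (\<lambda>v. v)) (at w)"
      by (rule has_derivative_transform_within_open[OF _ oW w]) (simp add: inv)
    then show "\<exists>D. ((\<lambda>w. fst (inv_into (W' \<times> {\<eta> x}) \<pi> (f (\<pi> (w, x))))) has_derivative D) (at w) \<and>
        (\<forall>c a b. D (c * a, c * b) = (c * fst (D (a, b)), c * snd (D (a, b))))"
      by (intro exI[of _ "\<lambda>v. v"]) simp
  qed
  moreover have "z \<in> W" using V(2) by (simp add: W_def)
  ultimately show "\<exists>W W' x'. is_leaf_chart \<pi> L W x \<and> is_leaf_chart \<pi> L' W' x' \<and> z \<in> W \<and>
      f ` \<pi> ` (W \<times> {x}) \<subseteq> \<pi> ` (W' \<times> {x'}) \<and>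
      holomorphic2_on W (\<lambda>w. fst (inv_into (W' \<times> {x'}) \<pi> (f (\<pi> (w, x)))))"
    by blast
qed

lemma leaves_subset: "L \<in> leaves \<pi> \<Longrightarrow> L \<subseteq> \<pi> ` Rtilde"
  using Htilde_subset by (auto simp: leaves_def Rtilde_iff)

text \<open>Boundary points are fixed, and an interior leaf is mapped onto the leaf at the level \<open>\<eta> x\<close>.\<close>

lemma act_leaf:
  assumes g: "g \<in> carrier affine_group" and L: "L \<in> leaves \<pi>"
    and f: "\<And>p. p \<in> Rtilde \<Longrightarrow> f (\<pi> p) = \<pi> (act g p)"
  shows "f ` L \<in> leaves \<pi>"
proof (cases "L = \<pi> ` Htilde")
  case True
  have "f ` L = (\<lambda>p. \<pi> (act g p)) ` Htilde"
    unfolding True image_image using f Htilde_subset by (intro image_cong) auto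
  also have "\<dots> = L"
    unfolding True by (intro image_cong) (simp_all add: act_Htilde[OF g])
  finally show ?thesis using L by simp
next
  case False
  then obtain x where x: "0 < x" "L = \<pi> ` (UNIV \<times> {x})" using L by (auto simp: leaves_def)
  obtain b1 b2 \<eta> where gb: "g = ((b1, b2), \<eta>)" "\<eta> \<in> carrier Z"
    using affine_groupE[OF g] by metis
  have "act g ` (UNIV \<times> {x}) = UNIV \<times> {\<eta> x}"
  proof (intro equalityI subsetI)
    fix p :: pt assume "p \<in> UNIV \<times> {\<eta> x}"
    then have "p = act g (fst p - (b1 x, b2 x), x)"
      by (cases p) (simp add: gb(1) act_eq)
    then show "p \<in> act g ` (UNIV \<times> {x})" by blast
  qed (auto simp: gb(1) act_eq)
  moreover have "f ` L = \<pi> ` act g ` (UNIV \<times> {x})"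
    unfolding x(2) image_image using f x(1) by (intro image_cong) (auto simp: Rtilde_iff)
  ultimately show ?thesis
    using centralizer_pos[OF gb(2) x(1)] by (auto simp: leaves_def)
qed

lemma affine_in_Aut:
  assumes \<pi>: "good_projection \<pi>" and g: "g \<in> carrier affine_group"
    and f: "\<And>p. p \<in> Rtilde \<Longrightarrow> f (\<pi> p) = \<pi> (act g p)" and B: "f \<in> Bij (\<pi> ` Rtilde)"
  shows "f \<in> carrier (Aut \<pi>)"
proof -
  let ?g' = "inv\<^bsub>affine_group\<^esub> g"
  have g': "?g' \<in> carrier affine_group"
    by (rule group.inv_closed[OF group_affine_group g])
  have inj: "inj_on f (\<pi> ` Rtilde)" using B by (simp add: Bij_def bij_betw_def)
  have smooth: "smooth_map \<pi> f"
    by (rule smooth_map_of_cover[OF \<pi> smooth_act[OF g] act_mem[OF g] f])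
  have inv: "inv_into (\<pi> ` Rtilde) f (\<pi> p) = \<pi> (act ?g' p)" if p: "p \<in> Rtilde" for p
  proof (rule inv_into_f_eq[OF inj])
    show "\<pi> (act ?g' p) \<in> \<pi> ` Rtilde" using act_mem[OF g' p] by blast
    show "f (\<pi> (act ?g' p)) = \<pi> p" using f[OF act_mem[OF g' p]] act_inv(2)[OF g p] by simp
  qed
  have smooth': "smooth_map \<pi> (inv_into (\<pi> ` Rtilde) f)"
    by (rule smooth_map_of_cover[OF \<pi> smooth_act[OF g'] act_mem[OF g'] inv])
  have "\<exists>L'\<in>leaves \<pi>. leaf_biholomorphic \<pi> L L' f" if L: "L \<in> leaves \<pi>" for L
  proof (rule bexI[of _ "f ` L"])
    show fL: "f ` L \<in> leaves \<pi>" by (rule act_leaf[OF g L f])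
    have injL: "inj_on f L" using inj leaves_subset[OF L] by (rule inj_on_subset)
    have inv: "inv_into L f (\<pi> p) = \<pi> (act ?g' p)" "\<pi> (act ?g' p) \<in> L" if p: "p \<in> Rtilde" "\<pi> p \<in> f ` L" for p
    proof -
      obtain r where r: "r \<in> L" "\<pi> p = f r" using p(2) by blast
      have "f (\<pi> (act ?g' p)) = f r"
        using f[OF act_mem[OF g' p(1)]] act_inv(2)[OF g p(1)] r(2) by simp
      then have "\<pi> (act ?g' p) = r"
        using inj act_mem[OF g' p(1)] r(1) leaves_subset[OF L] by (auto dest: inj_onD)
      then show "inv_into L f (\<pi> p) = \<pi> (act ?g' p)" "\<pi> (act ?g' p) \<in> L"
        using r inv_into_f_f[OF injL r(1)] by simp_all
    qed
    show "leaf_biholomorphic \<pi> L (f ` L) f"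
      unfolding leaf_biholomorphic_def
    proof (intro conjI)
      show "bij_betw f L (f ` L)" using injL by (simp add: bij_betw_def)
      show "leaf_holomorphic \<pi> L (f ` L) f"
      proof (rule leaf_holomorphic_affine[OF \<pi> g L f _ injL])
        show "\<pi> (act g p) \<in> f ` L" if "p \<in> Rtilde" "\<pi> p \<in> L" for p
          using f[OF that(1)] that(2) by (metis imageI)
      qed
      show "leaf_holomorphic \<pi> (f ` L) L (inv_into L f)"
        by (rule leaf_holomorphic_affine[OF \<pi> g' fL inv]) (auto intro: inj_on_inv_into)
    qed
  qed
  then show ?thesis
    using B smooth smooth' by (simp add: Aut_def)
qed

end

section \<open>The automorphism group as a semidirect product\<close>

context reeb
begin

lemma q_commuting_map_deck:
  assumes F: "\<And>p. p \<in> Rtilde \<Longrightarrow> F p \<in> Rtilde"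
      "\<And>p. p \<in> Rtilde \<Longrightarrow> F (\<T> p) = \<T> (F p)"
    and p: "p \<in> Rtilde"
  shows "q (F (deck n p)) = q (F p)"
proof -
  have step: "q (F (deck (i + 1) p)) = q (F (deck i p))" for i
  proof -
    have "deck (i + 1) p = \<T> (deck i p)"
      using deck_add[OF p, of 1 i] deck_1[OF deck_mem[OF p], of i] by (simp add: add.commute)
    then show ?thesis
      using F(2)[OF deck_mem[OF p], of i] q_T[OF F(1)[OF deck_mem[OF p]], of i] by simp
  qed
  show ?thesis
  proof (induction n rule: int_induct[where k = 0])
    case base
    show ?case by (simp add: deck_0[OF p])
  next
    case (step1 i)
    then show ?case using step[of i] by simp
  next
    case (step2 i)
    then show ?case using step[of "i - 1"] by simp
  qed
qed

text \<open>A map commuting with \<open>T\<close> sends an orbit into a single orbit.\<close>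

lemma induced_q:
  assumes F: "\<And>p. p \<in> Rtilde \<Longrightarrow> F p \<in> Rtilde"
      "\<And>p. p \<in> Rtilde \<Longrightarrow> F (\<T> p) = \<T> (F p)"
    and p: "p \<in> Rtilde"
  shows "induced lam \<phi> F (q p) = q (F p)"
proof -
  have "(\<lambda>r. q (F r)) ` q p = {q (F p)}"
  proof (intro equalityI subsetI)
    fix s assume "s \<in> (\<lambda>r. q (F r)) ` q p"
    then obtain n where "s = q (F (deck n p))" by (auto simp: q_def)
    then show "s \<in> {q (F p)}" using q_commuting_map_deck[where F = F, OF F p] by simp
  next
    fix s assume "s \<in> {q (F p)}"
    moreover have "p \<in> q p" using deck_0[OF p] by (auto simp: q_def intro: exI[of _ 0])
    ultimately show "s \<in> (\<lambda>r. q (F r)) ` q p" by blast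
  qed
  then show ?thesis
    using p by (simp add: induced_def Reeb_def)
qed

definition induced_aut :: "((real \<Rightarrow> complex) \<times> (real \<Rightarrow> complex)) \<times> (real \<Rightarrow> real) \<Rightarrow> pt set \<Rightarrow> pt set" where
  "induced_aut g = induced lam \<phi> (act g)"

lemma induced_aut_q:
  assumes "g \<in> carrier affine_group" "p \<in> Rtilde"
  shows "induced_aut g (q p) = q (act g p)"
  unfolding induced_aut_def
  by (rule induced_q[where F = "act g", OF act_mem[OF assms(1)] act_T[OF assms(1)] assms(2)])

lemma induced_extensional: "induced lam \<phi> F \<in> extensional (Reeb lam \<phi>)"
  by (simp add: induced_def)

lemma eq_on_Reeb:
  assumes "f \<in> extensional (Reeb lam \<phi>)" "f' \<in> extensional (Reeb lam \<phi>)"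
    and "\<And>p. p \<in> Rtilde \<Longrightarrow> f (q p) = f' (q p)"
  shows "f = f'"
  by (rule extensionalityI[OF assms(1,2)]) (use assms(3) in \<open>auto simp: Reeb_def\<close>)

lemma induced_aut_mult:
  assumes g: "g \<in> carrier affine_group" and h: "h \<in> carrier affine_group"
  shows "induced_aut (g \<otimes>\<^bsub>affine_group\<^esub> h) = compose (Reeb lam \<phi>) (induced_aut g) (induced_aut h)"
proof (rule eq_on_Reeb)
  interpret group affine_group by (rule group_affine_group)
  fix p assume p: "p \<in> Rtilde"
  have "q p \<in> Reeb lam \<phi>" using p by (simp add: Reeb_def)
  then show "induced_aut (g \<otimes>\<^bsub>affine_group\<^esub> h) (q p) =
      compose (Reeb lam \<phi>) (induced_aut g) (induced_aut h) (q p)"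
    using induced_aut_q[OF m_closed[OF g h] p] act_mult[OF g h p] induced_aut_q[OF h p]
      induced_aut_q[OF g act_mem[OF h p]] by (simp add: compose_def)
qed (simp_all add: induced_aut_def induced_extensional compose_extensional)

lemma induced_aut_Bij:
  assumes g: "g \<in> carrier affine_group"
  shows "induced_aut g \<in> Bij (Reeb lam \<phi>)"
proof -
  interpret group affine_group by (rule group_affine_group)
  let ?g' = "inv\<^bsub>affine_group\<^esub> g"
  have g': "?g' \<in> carrier affine_group" by (rule inv_closed[OF g])
  have "bij_betw (induced_aut g) (q ` Rtilde) (q ` Rtilde)"
  proof (rule bij_betw_byWitness[where f' = "induced_aut ?g'"])
    show "\<forall>r\<in>q ` Rtilde. induced_aut ?g' (induced_aut g r) = r"
      by (rule ballI, erule imageE)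
        (simp add: induced_aut_q[OF g] induced_aut_q[OF g'] act_mem[OF g] act_inv(1)[OF g])
    show "\<forall>r\<in>q ` Rtilde. induced_aut g (induced_aut ?g' r) = r"
      by (rule ballI, erule imageE)
        (simp add: induced_aut_q[OF g] induced_aut_q[OF g'] act_mem[OF g'] act_inv(2)[OF g])
    show "induced_aut g ` (q ` Rtilde) \<subseteq> q ` Rtilde"
      using induced_aut_q[OF g] act_mem[OF g] by (simp add: image_subset_iff)
    show "induced_aut ?g' ` (q ` Rtilde) \<subseteq> q ` Rtilde"
      using induced_aut_q[OF g'] act_mem[OF g'] by (simp add: image_subset_iff)
  qed
  then show ?thesis
    by (simp add: Bij_def Reeb_def) (simp add: induced_aut_def induced_extensional[unfolded Reeb_def])
qed

lemma induced_aut_Aut_rel: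
  assumes g: "g \<in> carrier affine_group"
  shows "induced_aut g \<in> carrier (Aut_rel lam \<phi>)"
proof -
  have "induced_aut g \<in> carrier (Aut q)"
    by (rule affine_in_Aut[OF good_projection_q g induced_aut_q[OF g]])
      (use induced_aut_Bij[OF g] in \<open>simp_all add: Reeb_def\<close>)
  moreover have "induced_aut g (q p) = q p" if "p \<in> Htilde" for p
    using induced_aut_q[OF g, of p] act_Htilde[OF g that] that Htilde_subset by auto
  ultimately show ?thesis
    by (auto simp: Aut_rel_def Hopf_def)
qed

lemma is_cont_lift_act:
  assumes g: "g \<in> carrier affine_group"
  shows "is_cont_lift (induced_aut g) (act g)"
  unfolding is_cont_lift_def
  using smooth_on_imp_continuous_on[OF smooth_act[OF g]] act_mem[OF g] induced_aut_q[OF g] act_Htilde[OF g]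
  by simp

lemma affine_group_eqI:
  assumes g: "g \<in> carrier affine_group" and h: "h \<in> carrier affine_group"
    and eq: "\<And>p. p \<in> Rtilde \<Longrightarrow> act g p = act h p"
  shows "g = h"
proof -
  obtain b1 b2 \<eta> where g': "g = ((b1, b2), \<eta>)" "b1 \<in> \<Z>"
    "b2 \<in> \<Z>" "\<eta> \<in> carrier Z"
    using affine_groupE[OF g] .
  obtain c1 c2 \<zeta> where h': "h = ((c1, c2), \<zeta>)" "c1 \<in> \<Z>"
    "c2 \<in> \<Z>" "\<zeta> \<in> carrier Z"
    using affine_groupE[OF h] .
  have e: "b1 x = c1 x \<and> b2 x = c2 x \<and> \<eta> x = \<zeta> x" if "0 \<le> x" for x
    using eq[of "((1, 0), x)"] that by (simp add: g'(1) h'(1) act_eq Rtilde_iff zero_prod_def)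
  have "b1 x = c1 x" "b2 x = c2 x" for x
    using e[of x] g'(2,3) h'(2,3) by (cases "0 \<le> x"; simp add: equivariant_functions_def)+
  moreover have "\<eta> = \<zeta>"
    by (rule extensionalityI[of _ "{0..}"])
      (use e centralizerD(1)[OF g'(4)] centralizerD(1)[OF h'(4)] in \<open>auto simp: Bij_def\<close>)
  ultimately show ?thesis by (auto simp: g'(1) h'(1))
qed

text \<open>The automorphism determines its lift, and the lift determines \<open>g\<close>.\<close>

lemma inj_induced_aut: "inj_on induced_aut (carrier affine_group)"
proof (rule inj_onI)
  fix g h assume g: "g \<in> carrier affine_group" and h: "h \<in> carrier affine_group"
    and eq: "induced_aut g = induced_aut h"
  have "is_cont_lift (induced_aut g) (act h)"
    unfolding eq by (rule is_cont_lift_act[OF h])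
  from cont_lift_unique[OF is_cont_lift_act[OF g] this] show "g = h"
    by (rule affine_group_eqI[OF g h])
qed

lemma cont_lift_inverse:
  assumes F: "is_cont_lift f F" and G: "is_cont_lift f' G"
    and inv: "\<And>r. r \<in> q ` Rtilde \<Longrightarrow> f' (f r) = r" and p: "p \<in> Rtilde"
  shows "G (F p) = p"
proof (rule lifts_agree[where S = Rtilde and p = "((1, 0), 0)" and ?g1.0 = "\<lambda>p. G (F p)" and ?g2.0 = "\<lambda>p. p"])
  note F' = is_cont_liftD[OF F] and G' = is_cont_liftD[OF G]
  show "continuous_on Rtilde (\<lambda>p. G (F p))"
    by (rule continuous_on_compose2[OF G'(1) F'(1)]) (auto simp: F'(2))
  show "q (G (F s)) = q s" if "s \<in> Rtilde" for s
    using G'(3)[OF F'(2)[OF that]] F'(3)[OF that] inv[of "q s"] that by simp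
  show "G (F ((1, 0), 0)) = ((1, 0), 0)"
    using F'(4)[OF base_point(1)] G'(4)[OF base_point(1)] by simp
  show "G (F s) \<in> Rtilde" if "s \<in> Rtilde" for s
    using G'(2)[OF F'(2)[OF that]] .
qed (simp_all add: p connected_Rtilde base_point continuous_on_id)

text \<open>Every automorphism fixing the boundary leaf is induced by an affine map: the lift of the inverse
  automorphism provides a smooth inverse of \<open>\<eta>\<close>.\<close>

lemma induced_aut_surj:
  assumes f: "f \<in> carrier (Aut_rel lam \<phi>)"
  shows "\<exists>g\<in>carrier affine_group. induced_aut g = f"
proof -
  let ?f' = "inv_into (q ` Rtilde) f"
  have B: "f \<in> Bij (q ` Rtilde)" and s: "smooth_map q f" "smooth_map q ?f'"
    and leaf: "\<And>L. L \<in> leaves q \<Longrightarrow> \<exists>L'. leaf_holomorphic q L L' f"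
    and H: "\<forall>h\<in>Hopf lam \<phi>. f h = h"
    using f by (auto simp: Aut_rel_def Aut_def leaf_biholomorphic_def)
  have bij: "bij_betw f (q ` Rtilde) (q ` Rtilde)" using B by (simp add: Bij_def)
  have HR: "Hopf lam \<phi> \<subseteq> q ` Rtilde" using Htilde_subset by (auto simp: Hopf_def)
  have inv: "?f' (f r) = r" "f (?f' r) = r" if "r \<in> q ` Rtilde" for r
    using bij_betw_inv_into_left[OF bij that] bij_betw_inv_into_right[OF bij that] by simp_all
  have H': "\<forall>h\<in>Hopf lam \<phi>. ?f' h = h"
    using H HR inv(1) by (metis subsetD)
  obtain F where F: "is_cont_lift f F" using cont_lift_exists[OF s(1) H] by blast
  obtain G where G: "is_cont_lift ?f' G" using cont_lift_exists[OF s(2) H'] by blast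
  note F' = is_cont_liftD[OF F] and G' = is_cont_liftD[OF G]
  have FG: "F (G p) = p" and GF: "G (F p) = p" if "p \<in> Rtilde" for p
    using cont_lift_inverse[OF G F _ that] cont_lift_inverse[OF F G _ that] inv by simp_all
  define \<beta> where "\<beta> = translation_part F"
  define \<eta> where "\<eta> = transverse_part F"
  note st' = cont_lift_structure[OF F s(1), folded \<beta>_def \<eta>_def]
  have aff: "F p = affine_map \<beta> \<eta> p" if "p \<in> Rtilde" for p
    by (rule st'(1)[OF leaf that])
  have smooth: "smooth_on {0..} \<beta>" "smooth_on {0..} \<eta>"
    by (rule st'(2)[OF leaf], assumption) (rule st'(3)[OF leaf])
  have \<beta>: "\<beta> (\<phi> x) = dilate lam (\<beta> x)" "0 \<le> \<eta> x" "\<eta> (\<phi> x) = \<phi> (\<eta> x)" if "0 \<le> x" for x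
    by (rule st'(4)[OF leaf that], assumption, rule st'(6)[OF leaf that], assumption)
      (rule st'(7)[OF leaf that])
  have \<beta>_neg: "\<beta> x = 0" if "x < 0" for x
    by (rule st'(5)[OF leaf that])
  define \<zeta> where "\<zeta> x = snd (G ((1, 0), x))" for x
  have R: "((1, 0), x) \<in> Rtilde" if "0 \<le> x" for x
    using that by (simp add: Rtilde_iff zero_prod_def)
  have \<zeta>0: "0 \<le> \<zeta> x" if "0 \<le> x" for x
    using G'(2)[OF R[OF that]] by (cases "G ((1, 0), x)") (simp add: \<zeta>_def Rtilde_iff)
  have \<eta>\<zeta>: "\<eta> (\<zeta> x) = x" if "0 \<le> x" for x
    using FG[OF R[OF that]] aff[OF G'(2)[OF R[OF that]]] by (simp add: affine_map_def \<zeta>_def)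
  have inj_\<eta>: "x = y" if xy: "0 \<le> x" "0 \<le> y" "\<eta> x = \<eta> y" for x y
  proof -
    have "finite {0, fst (\<beta> y - \<beta> x)}" by simp
    then obtain t :: complex where t: "t \<notin> {0, fst (\<beta> y - \<beta> x)}"
      using ex_new_if_finite[OF infinite_UNIV_char_0] by blast
    \<comment> \<open>neither \<open>z\<close> nor the point \<open>w\<close> of the leaf of \<open>y\<close> with the same image may be the origin\<close>
    define z where "z = (t, 0 :: complex)"
    have z: "z \<noteq> 0" "z \<noteq> \<beta> y - \<beta> x"
    proof -
      have "fst z \<noteq> fst 0" "fst z \<noteq> fst (\<beta> y - \<beta> x)" using t by (simp_all add: z_def)
      then show "z \<noteq> 0" "z \<noteq> \<beta> y - \<beta> x" by metis+
    qed
    define w where "w = z + \<beta> x - \<beta> y"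
    have R: "(z, x) \<in> Rtilde" "(w, y) \<in> Rtilde"
      using z xy by (auto simp: Rtilde_iff w_def algebra_simps)
    have "F (z, x) = F (w, y)"
      using aff[OF R(1)] aff[OF R(2)] xy(3) by (simp add: affine_map_def w_def)
    then have "G (F (z, x)) = G (F (w, y))" by (rule arg_cong)
    then have "(z, x) = (w, y)" unfolding GF[OF R(1)] GF[OF R(2)] .
    then show "x = y" by (rule Pair_inject)
  qed
  have \<zeta>\<eta>: "\<zeta> (\<eta> x) = x" if "0 \<le> x" for x
    by (rule inj_\<eta>[OF \<zeta>0[OF \<beta>(2)[OF that]] that \<eta>\<zeta>[OF \<beta>(2)[OF that]]])
  have "smooth_on {0..} (\<lambda>x. ((1, 0) :: complex \<times> complex, x))"
    by (rule smooth_on_Pair[OF smooth_on_const smooth_on_ident])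
  from smooth_on_compose[OF this cont_lift_smooth[OF s(2) G]]
  have "smooth_on {0..} (\<lambda>x. G ((1, 0), x))"
    using R by (simp add: image_subset_iff)
  then have s\<zeta>: "smooth_on {0..} \<zeta>"
    unfolding \<zeta>_def by (rule smooth_on_bounded_linear_compose[OF bounded_linear_snd])
  have \<eta>: "\<eta> \<in> carrier Z"
    by (rule centralizerI[OF _ smooth(2) s\<zeta>])
      (simp_all add: \<beta>(2,3) \<zeta>0 \<zeta>\<eta> \<eta>\<zeta>, simp add: \<eta>_def transverse_part_def)
  define g where "g = ((\<lambda>x. fst (\<beta> x), \<lambda>x. snd (\<beta> x)), \<eta>)"
  have g: "g \<in> carrier affine_group"
    using smooth_on_bounded_linear_compose[OF bounded_linear_fst smooth(1)]
      smooth_on_bounded_linear_compose[OF bounded_linear_snd smooth(1)]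
    by (simp add: g_def semidirect_product_def equivariant_group_def equivariant_functions_def \<eta> \<beta>(1) \<beta>_neg)
  have "act g p = F p" if "p \<in> Rtilde" for p
    using aff[OF that] by (simp add: g_def act_def)
  then have "induced_aut g (q p) = f (q p)" if "p \<in> Rtilde" for p
    using induced_aut_q[OF g that] F'(3)[OF that] that by simp
  moreover have "f \<in> extensional (Reeb lam \<phi>)" using B by (simp add: Bij_def Reeb_def)
  ultimately have "induced_aut g = f"
    by (intro eq_on_Reeb) (simp_all add: induced_aut_def induced_extensional)
  then show ?thesis using g by blast
qed

lemma Aut_rel_eq: "Aut_rel lam \<phi> = (BijGroup (Reeb lam \<phi>))\<lparr>carrier := carrier (Aut_rel lam \<phi>)\<rparr>"
  by (simp add: Aut_rel_def Aut_def Reeb_def)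

lemma carrier_Aut_rel: "carrier (Aut_rel lam \<phi>) = induced_aut ` carrier affine_group"
  using induced_aut_surj induced_aut_Aut_rel by blast

lemma Aut_relE:
  assumes "f \<in> carrier (Aut_rel lam \<phi>)"
  obtains g where "g \<in> carrier affine_group" "f = induced_aut g"
  using induced_aut_surj[OF assms] by (elim bexE) (rule that, assumption, erule sym)

lemma mult_Aut_rel:
  assumes "g \<in> carrier affine_group" "h \<in> carrier affine_group"
  shows "induced_aut g \<otimes>\<^bsub>Aut_rel lam \<phi>\<^esub> induced_aut h = induced_aut (g \<otimes>\<^bsub>affine_group\<^esub> h)"
  using induced_aut_Bij[OF assms(1)] induced_aut_Bij[OF assms(2)]
  by (subst Aut_rel_eq) (simp add: BijGroup_def induced_aut_mult[OF assms])

lemma group_Aut_rel: "group (Aut_rel lam \<phi>)"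
proof -
  have "induced_aut \<in> hom affine_group (BijGroup (Reeb lam \<phi>))"
    by (rule homI) (simp_all add: BijGroup_def induced_aut_Bij induced_aut_mult)
  then have "group_hom affine_group (BijGroup (Reeb lam \<phi>)) induced_aut"
    by (simp add: group_hom_def group_hom_axioms_def group_affine_group group_BijGroup)
  then have "subgroup (carrier (Aut_rel lam \<phi>)) (BijGroup (Reeb lam \<phi>))"
    unfolding carrier_Aut_rel by (rule group_hom.img_is_subgroup)
  then show ?thesis
    using subgroup.subgroup_is_group[OF _ group_BijGroup] Aut_rel_eq by metis
qed

lemma induced_aut_iso: "induced_aut \<in> iso affine_group (Aut_rel lam \<phi>)"
proof (rule isoI)
  show "induced_aut \<in> hom affine_group (Aut_rel lam \<phi>)"
    by (rule homI) (simp_all add: induced_aut_Aut_rel mult_Aut_rel)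
  show "bij_betw induced_aut (carrier affine_group) (carrier (Aut_rel lam \<phi>))"
    using inj_induced_aut carrier_Aut_rel by (simp add: bij_betw_def)
qed

lemma Aut_id_smooth:
  assumes F: "F \<in> carrier (Aut id)"
  shows "smooth_on Rtilde F"
proof (rule smooth_on_local)
  fix p assume p: "p \<in> Rtilde"
  have "smooth_map id F" using F by (simp add: Aut_def)
  from this[unfolded smooth_map_def, rule_format, OF p]
  obtain U V where U: "is_chart id U" "p \<in> U" "F ` id ` U \<subseteq> id ` V"
      "smooth_on U (\<lambda>u. inv_into V id (F (id u)))"
    by blast
  obtain A where A: "open A" "U = Rtilde \<inter> A" using U(1) by (auto simp: is_chart_def openin_open)
  have "inv_into V id (F (id u)) = F u" if "u \<in> U" for u
    using inv_into_f_f[of id V "F u"] U(3) that by auto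
  from smooth_on_cong[OF U(4) this] have "smooth_on (Rtilde \<inter> A) F" by (simp add: A(2))
  then show "\<exists>V. open V \<and> p \<in> V \<and> smooth_on (Rtilde \<inter> V) F" using A U(2) by blast
qed

lemma is_lift_imp_is_cont_lift:
  assumes "is_lift lam \<phi> f F"
  shows "is_cont_lift f F"
proof -
  have F: "F \<in> carrier (Aut id)" using assms by (simp add: is_lift_def)
  then have "F \<in> Bij Rtilde" by (simp add: Aut_def)
  then show ?thesis
    using assms smooth_on_imp_continuous_on[OF Aut_id_smooth[OF F]] Bij_imp_funcset[of F Rtilde]
    by (auto simp: is_cont_lift_def is_lift_def)
qed

lemma is_lift_act:
  assumes g: "g \<in> carrier affine_group"
  shows "is_lift lam \<phi> (induced_aut g) (restrict (act g) Rtilde)"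
proof -
  have "bij_betw (act g) Rtilde Rtilde"
    by (rule bij_betw_byWitness[where f' = "act (inv\<^bsub>affine_group\<^esub> g)"])
      (auto simp: act_inv[OF g] act_mem[OF g] act_mem[OF group.inv_closed[OF group_affine_group g]])
  then have "restrict (act g) Rtilde \<in> Bij (id ` Rtilde)"
    by (simp add: Bij_def bij_betw_restrict_eq)
  from affine_in_Aut[OF good_projection_id g _ this]
  have "restrict (act g) Rtilde \<in> carrier (Aut id)" by simp
  then show ?thesis
    using induced_aut_q[OF g] act_T[OF g] T_mem act_Htilde[OF g] Htilde_subset
    by (auto simp: is_lift_def)
qed

text \<open>By the uniqueness of lifts every admissible \<open>\<eta>\<close> is the transverse part of \<^term>\<open>act g\<close>.\<close>

lemma P_map_induced_aut:
  assumes g: "g \<in> carrier affine_group"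
  shows "P_map lam \<phi> (induced_aut g) = snd g"
  unfolding P_map_def
proof (rule the_equality)
  obtain b1 b2 \<eta> where g': "g = ((b1, b2), \<eta>)" "\<eta> \<in> carrier Z"
    using affine_groupE[OF g] by metis
  have ext: "\<eta> \<in> extensional {0..}" using centralizerD(1)[OF g'(2)] by (simp add: Bij_def)
  have "\<forall>z x. (z, x) \<in> Rtilde \<longrightarrow> snd (restrict (act g) Rtilde (z, x)) = snd g x"
    by (simp add: g'(1) act_eq)
  then show "snd g \<in> extensional {0..} \<and> (\<exists>F. is_lift lam \<phi> (induced_aut g) F \<and>
      (\<forall>z x. (z, x) \<in> Rtilde \<longrightarrow> snd (F (z, x)) = snd g x))"
    using is_lift_act[OF g] ext g'(1) by auto
  fix \<zeta> assume "\<zeta> \<in> extensional {0..} \<and> (\<exists>F. is_lift lam \<phi> (induced_aut g) F \<and>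
      (\<forall>z x. (z, x) \<in> Rtilde \<longrightarrow> snd (F (z, x)) = \<zeta> x))"
  then obtain F where \<zeta>: "\<zeta> \<in> extensional {0..}" and F: "is_lift lam \<phi> (induced_aut g) F"
      "\<And>z x. (z, x) \<in> Rtilde \<Longrightarrow> snd (F (z, x)) = \<zeta> x" by blast
  show "\<zeta> = snd g"
  proof (rule extensionalityI[OF \<zeta>])
    show "snd g \<in> extensional {0..}" using ext g'(1) by simp
    fix x :: real assume "x \<in> {0..}"
    then have R: "((1, 0), x) \<in> Rtilde" by (simp add: Rtilde_iff zero_prod_def)
    have "F ((1, 0), x) = act g ((1, 0), x)"
      by (rule cont_lift_unique[OF is_lift_imp_is_cont_lift[OF F(1)] is_cont_lift_act[OF g] R])
    then show "\<zeta> x = snd g x" using F(2)[OF R] by (simp add: g'(1) act_eq)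
  qed
qed

lemma translation_mem:
  "b \<in> carrier translation_group \<Longrightarrow> (b, \<one>\<^bsub>Z\<^esub>) \<in> carrier affine_group"
  using monoid.one_closed[OF group.is_monoid[OF group_centralizer]] by (simp add: semidirect_product_def)

lemma translation_aut_eq:
  assumes b: "b \<in> carrier translation_group"
  shows "translation_aut lam \<phi> b = induced_aut (b, \<one>\<^bsub>Z\<^esub>)"
proof -
  obtain b1 b2 where b': "b = (b1, b2)" by (cases b)
  let ?F = "\<lambda>((z1, z2), x). ((z1 + b1 x, z2 + b2 x), x)"
  let ?g = "(b, \<one>\<^bsub>Z\<^esub>)"
  have g: "?g \<in> carrier affine_group" by (rule translation_mem[OF b])
  have eq: "?F p = act ?g p" if "p \<in> Rtilde" for p
    using that by (cases p, cases "fst p") (simp add: b' act_eq one_centralizer Rtilde_iff)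
  show ?thesis
  proof (rule eq_on_Reeb)
    fix p assume p: "p \<in> Rtilde"
    have "induced lam \<phi> ?F (q p) = q (?F p)"
      by (rule induced_q[where F = ?F, OF _ _ p]) (simp_all only: eq act_mem[OF g] act_T[OF g] T_mem)
    then show "translation_aut lam \<phi> b (q p) = induced_aut ?g (q p)"
      by (simp only: b' translation_aut_def prod.case eq[OF p, unfolded b'] induced_aut_q[OF g p, unfolded b'])
  qed (simp_all add: induced_aut_def induced_extensional translation_aut_def b')
qed

lemma translation_mult:
  assumes b: "b \<in> carrier translation_group" "b' \<in> carrier translation_group"
  shows "(b, \<one>\<^bsub>Z\<^esub>) \<otimes>\<^bsub>affine_group\<^esub> (b', \<one>\<^bsub>Z\<^esub>) =
    (b \<otimes>\<^bsub>translation_group\<^esub> b', \<one>\<^bsub>Z\<^esub>)"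
proof -
  have "pullback_pair \<one>\<^bsub>Z\<^esub> b = b"
    using b(1) by (cases b) (auto simp: pullback_pair_def pullback_def one_centralizer fun_eq_iff
        equivariant_group_def equivariant_functions_def)
  moreover have "b' \<otimes>\<^bsub>translation_group\<^esub> b = b \<otimes>\<^bsub>translation_group\<^esub> b'"
    by (cases b, cases b') (simp add: equivariant_group_def add.commute)
  ultimately show ?thesis
    using monoid.l_one[OF group.is_monoid[OF group_centralizer]
      monoid.one_closed[OF group.is_monoid[OF group_centralizer]]]
    by (simp add: semidirect_product_def)
qed

lemma translation_aut_mon: "translation_aut lam \<phi> \<in> mon translation_group (Aut_rel lam \<phi>)"
  unfolding mon_def
proof (intro CollectI conjI)
  interpret N: group translation_group by (rule group_translation_group)
  show "translation_aut lam \<phi> \<in> hom translation_group (Aut_rel lam \<phi>)"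
  proof (rule homI)
    fix b b' assume b: "b \<in> carrier translation_group" "b' \<in> carrier translation_group"
    show "translation_aut lam \<phi> (b \<otimes>\<^bsub>translation_group\<^esub> b') =
        translation_aut lam \<phi> b \<otimes>\<^bsub>Aut_rel lam \<phi>\<^esub> translation_aut lam \<phi> b'"
      unfolding translation_aut_eq[OF b(1)] translation_aut_eq[OF b(2)]
        translation_aut_eq[OF N.m_closed[OF b]] translation_mult[OF b, symmetric]
      by (rule mult_Aut_rel[OF translation_mem[OF b(1)] translation_mem[OF b(2)], symmetric])
  qed (simp only: translation_aut_eq induced_aut_Aut_rel translation_mem)
  show "inj_on (translation_aut lam \<phi>) (carrier translation_group)"
  proof (rule inj_onI)
    fix b b' assume b: "b \<in> carrier translation_group" "b' \<in> carrier translation_group"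
      and "translation_aut lam \<phi> b = translation_aut lam \<phi> b'"
    then have "induced_aut (b, \<one>\<^bsub>Z\<^esub>) = induced_aut (b', \<one>\<^bsub>Z\<^esub>)"
      by (simp only: translation_aut_eq)
    then show "b = b'"
      using inj_onD[OF inj_induced_aut _ translation_mem[OF b(1)]
          translation_mem[OF b(2)]] by simp
  qed
qed

lemma snd_affine_group: "g \<in> carrier affine_group \<Longrightarrow> snd g \<in> carrier Z"
  and fst_affine_group: "g \<in> carrier affine_group \<Longrightarrow> fst g \<in> carrier translation_group"
  by (auto simp: semidirect_product_def)

lemma translation_aut_image:
  "translation_aut lam \<phi> ` carrier translation_group =
     Coset.kernel (Aut_rel lam \<phi>) Z (P_map lam \<phi>)"
proof (intro equalityI subsetI)
  fix f assume "f \<in> translation_aut lam \<phi> ` carrier translation_group"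
  then obtain b where b: "b \<in> carrier translation_group" "f = induced_aut (b, \<one>\<^bsub>Z\<^esub>)"
    using translation_aut_eq by blast
  then show "f \<in> Coset.kernel (Aut_rel lam \<phi>) Z (P_map lam \<phi>)"
    using induced_aut_Aut_rel[OF translation_mem[OF b(1)]]
      P_map_induced_aut[OF translation_mem[OF b(1)]]
    by (simp add: kernel_def)
next
  fix f assume "f \<in> Coset.kernel (Aut_rel lam \<phi>) Z (P_map lam \<phi>)"
  then have f: "f \<in> carrier (Aut_rel lam \<phi>)" "P_map lam \<phi> f = \<one>\<^bsub>Z\<^esub>"
    by (simp_all add: kernel_def)
  obtain g where g: "g \<in> carrier affine_group" "induced_aut g = f"
    using induced_aut_surj[OF f(1)] by blast
  then have "snd g = \<one>\<^bsub>Z\<^esub>" using f(2) P_map_induced_aut by metis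
  then have "f = translation_aut lam \<phi> (fst g)"
    using g(2) translation_aut_eq[OF fst_affine_group[OF g(1)]] by (metis prod.collapse)
  then show "f \<in> translation_aut lam \<phi> ` carrier translation_group"
    using fst_affine_group[OF g(1)] by blast
qed

lemma P_map_epi: "P_map lam \<phi> \<in> epi (Aut_rel lam \<phi>) Z"
  unfolding epi_def
proof (intro CollectI conjI)
  interpret G: group affine_group by (rule group_affine_group)
  show "P_map lam \<phi> \<in> hom (Aut_rel lam \<phi>) Z"
  proof (rule homI)
    fix f assume "f \<in> carrier (Aut_rel lam \<phi>)"
    then obtain g where "g \<in> carrier affine_group" "f = induced_aut g" by (rule Aut_relE)
    then show "P_map lam \<phi> f \<in> carrier Z"
      by (simp only: P_map_induced_aut snd_affine_group)
  next
    fix f f' assume f: "f \<in> carrier (Aut_rel lam \<phi>)" "f' \<in> carrier (Aut_rel lam \<phi>)"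
    obtain g where g: "g \<in> carrier affine_group" "f = induced_aut g" using f(1) by (rule Aut_relE)
    obtain g' where g': "g' \<in> carrier affine_group" "f' = induced_aut g'" using f(2) by (rule Aut_relE)
    have "snd (g \<otimes>\<^bsub>affine_group\<^esub> g') = snd g \<otimes>\<^bsub>Z\<^esub> snd g'"
      by (cases g, cases g') (simp add: semidirect_product_def)
    then show "P_map lam \<phi> (f \<otimes>\<^bsub>Aut_rel lam \<phi>\<^esub> f') =
        P_map lam \<phi> f \<otimes>\<^bsub>Z\<^esub> P_map lam \<phi> f'"
      by (simp only: g(2) g'(2) mult_Aut_rel[OF g(1) g'(1)] P_map_induced_aut[OF G.m_closed[OF g(1) g'(1)]]
          P_map_induced_aut[OF g(1)] P_map_induced_aut[OF g'(1)])
  qed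
  show "P_map lam \<phi> ` carrier (Aut_rel lam \<phi>) = carrier Z"
  proof (intro equalityI subsetI)
    fix \<eta> assume "\<eta> \<in> P_map lam \<phi> ` carrier (Aut_rel lam \<phi>)"
    then obtain f where "f \<in> carrier (Aut_rel lam \<phi>)" "\<eta> = P_map lam \<phi> f" by blast
    then obtain g where "g \<in> carrier affine_group" "\<eta> = P_map lam \<phi> (induced_aut g)"
      by (metis Aut_relE)
    then show "\<eta> \<in> carrier Z"
      by (simp only: P_map_induced_aut snd_affine_group)
  next
    fix \<eta> assume "\<eta> \<in> carrier Z"
    then have g: "(\<one>\<^bsub>translation_group\<^esub>, \<eta>) \<in> carrier affine_group"
      using monoid.one_closed[OF group.is_monoid[OF group_translation_group]]
      by (simp add: semidirect_product_def)
    have "P_map lam \<phi> (induced_aut (\<one>\<^bsub>translation_group\<^esub>, \<eta>)) = \<eta>"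
      using P_map_induced_aut[OF g] by (simp only: snd_conv)
    then show "\<eta> \<in> P_map lam \<phi> ` carrier (Aut_rel lam \<phi>)"
      using induced_aut_Aut_rel[OF g] by (metis imageI)
  qed
qed

lemma Aut_rel_iso_affine_group:
  "\<exists>\<Psi> \<in> iso (Aut_rel lam \<phi>) affine_group.
     (\<forall>b \<in> carrier translation_group. \<Psi> (translation_aut lam \<phi> b) = (b, \<one>\<^bsub>Z\<^esub>)) \<and>
     (\<forall>f \<in> carrier (Aut_rel lam \<phi>). snd (\<Psi> f) = P_map lam \<phi> f)"
proof (rule bexI)
  let ?\<Psi> = "inv_into (carrier affine_group) induced_aut"
  show "?\<Psi> \<in> iso (Aut_rel lam \<phi>) affine_group"
    by (rule group.iso_set_sym[OF group_affine_group induced_aut_iso])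
  have inv: "?\<Psi> (induced_aut g) = g" if "g \<in> carrier affine_group" for g
    by (rule inv_into_f_f[OF inj_induced_aut that])
  show "(\<forall>b \<in> carrier translation_group. ?\<Psi> (translation_aut lam \<phi> b) = (b, \<one>\<^bsub>Z\<^esub>)) \<and>
     (\<forall>f \<in> carrier (Aut_rel lam \<phi>). snd (?\<Psi> f) = P_map lam \<phi> f)"
  proof (intro conjI ballI)
    fix b assume b: "b \<in> carrier translation_group"
    show "?\<Psi> (translation_aut lam \<phi> b) = (b, \<one>\<^bsub>Z\<^esub>)"
      unfolding translation_aut_eq[OF b] by (rule inv[OF translation_mem[OF b]])
  next
    fix f assume "f \<in> carrier (Aut_rel lam \<phi>)"
    then obtain g where "g \<in> carrier affine_group" "f = induced_aut g" by (rule Aut_relE)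
    then show "snd (?\<Psi> f) = P_map lam \<phi> f"
      by (simp only: inv P_map_induced_aut)
  qed
qed

end

theorem theorem3p9:
  fixes lam :: complex and \<phi> :: "real \<Rightarrow> real"
  assumes "cmod lam > 1"
    and "\<phi> \<in> carrier Diff_halfline"
    and "\<forall>x>0. \<phi> x > x"
    and "infinitely_tangent_to_id \<phi>"
  shows
   "group (Aut_rel lam \<phi>) \<and> group (centralizer \<phi>) \<and>
    group (equivariant_group \<phi> lam \<times>\<times> equivariant_group \<phi> lam) \<and>
    translation_aut lam \<phi> \<in> mon (equivariant_group \<phi> lam \<times>\<times> equivariant_group \<phi> lam)
      (Aut_rel lam \<phi>) \<and>
    translation_aut lam \<phi> ` carrier (equivariant_group \<phi> lam \<times>\<times> equivariant_group \<phi> lam) =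
      Coset.kernel (Aut_rel lam \<phi>) (centralizer \<phi>) (P_map lam \<phi>) \<and>
    P_map lam \<phi> \<in> epi (Aut_rel lam \<phi>) (centralizer \<phi>) \<and>
    (\<exists>\<Psi> \<in> iso (Aut_rel lam \<phi>)
         (semidirect_product (equivariant_group \<phi> lam \<times>\<times> equivariant_group \<phi> lam)
           (centralizer \<phi>) pullback_pair).
       (\<forall>b \<in> carrier (equivariant_group \<phi> lam \<times>\<times> equivariant_group \<phi> lam).
          \<Psi> (translation_aut lam \<phi> b) = (b, \<one>\<^bsub>centralizer \<phi>\<^esub>)) \<and>
       (\<forall>f \<in> carrier (Aut_rel lam \<phi>). snd (\<Psi> f) = P_map lam \<phi> f)) \<and>
    complex_fun.subspace (equivariant_functions \<phi> lam) \<and>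
    \<not> (\<exists>B. finite B \<and> complex_fun.span B = equivariant_functions \<phi> lam)"
proof -
  interpret tangent_reeb \<phi> lam
    by unfold_locales (use assms infinitely_tangent_deriv_0 in auto)
  show ?thesis
    by (intro conjI group_Aut_rel group_centralizer group_translation_group translation_aut_mon
        translation_aut_image P_map_epi Aut_rel_iso_affine_group subspace_equivariant_functions
        equivariant_functions_infinite_dim)
qed

end
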